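(* Consider a family, indexed by $N$, of $M/GI/1$ systems $\mathcal S_1$ with random number of waiting places $\zeta=\zeta(N)$ and loss probability $\Pi_{\zeta(N)}$ as described in the context. Let $\varrho=1+\varepsilon$ with $\varepsilon=\varepsilon(N)>0$, and suppose that $\varepsilon\,\zeta(N)\to C>0$ (almost surely, $C$ a constant) as $\varepsilon\to0$ and $N\to\infty$, and that $p=p(N)\to0$. Assume also that $\varrho_3=\varrho_3(N)$ is a bounded sequence and that the limit $\widetilde\varrho_2=\lim_{N\to\infty}\varrho_2(N)$ exists. (i) If $p/\varepsilon\to D\ge0$, then $$\Pi_{\zeta(N)}=\Big(D+\frac{e^{2C/\widetilde\varrho_2}}{e^{2C/\widetilde\varrho_2}-1}\Big)\varepsilon+o(\varepsilon).$$ (ii) If $p/\varepsilon\to\infty$, then $$\Pi_{\zeta(N)}=p+O(\varepsilon).$$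
   Context: Queueing system $\mathcal S_1$. Let $\nu_1,\nu_2,\dots$ be i.i.d. positive-integer random variables (numbers of packets in messages) with $\mathbf P\{\nu^{lower}\le\nu_i\le\nu^{upper}\}=1$ for fixed bounds $\nu^{lower},\nu^{upper}$. Let $N$ be the buffer size (in packets) and $\zeta=\zeta(N)=\sup\{m:\sum_{i=1}^m\nu_i\le N\}$; hence $\mathbf P\{\zeta^{lower}\le\zeta\le\zeta^{upper}\}=1$ for some values $\zeta^{lower},\zeta^{upper}$ depending on $N$. Messages arrive at a single-server queue according to a Poisson process of rate $\lambda>0$; service times are i.i.d., independent of arrivals, with distribution function $B(x)$ and mean $b=\int_0^\infty x\,dB(x)\in(0,\infty)$. Let $\varrho_j=\lambda^j\int_0^\infty x^j\,dB(x)$ and $\varrho=\varrho_1=\lambda b$. Here the parameters of arrivals and service may depend on $N$, and so $\varrho_j=\varrho_j(N)$. Let $\zeta_1,\zeta_2,\dots$ be a strictly stationary and ergodic sequence of random variables, each with the distribution of $\zeta$, independent of the arrivals and service times. Let $\xi_i$ be the number of messages in the system immediately before the arrival of the $i$th message, with $\xi_1=0$. The $i$th message is refused (leaves without service) if $\xi_i>\zeta_i$; otherwise it joins the queue. Each message is, independently of everything else, marked (erroneous because one of its packets is corrupted) with probability $p$; a marked message still occupies the buffer and is served if it is not refused. A message is lost if it is refused or marked. A busy period starts when a message arrives to the empty system and ends when the system next becomes empty. $P_\zeta$, $M_\zeta$, $R_\zeta$ are, respectively, the number of processed (served) messages, the number of marked messages among the processed ones (so $\mathbf E M_\zeta=p\mathbf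 E P_\zeta$), and the number of refused messages during a busy period; $L_\zeta=R_\zeta+M_\zeta$ is the number of lost messages. The loss probability is $$\Pi_\zeta=\frac{\mathbf E L_\zeta}{\mathbf E R_\zeta+\mathbf E P_\zeta}=\frac{\mathbf E R_\zeta+p\,\mathbf E P_\zeta}{\mathbf E R_\zeta+\mathbf E P_\zeta}.$$ *)

theory Defs
  imports "HOL-Probability.Probability" "HOL-Library.Landau_Symbols"
begin

section \<open>Sample paths of the single-server queue\<close>

text \<open>
  Sequences are indexed from 0: index \<open>i\<close> stands for the message number \<open>i + 1\<close> in the
  usual numbering.  Along a sample path, \<open>a i\<close> is the time between the arrival of message
  \<open>i - 1\<close> (the time origin if \<open>i = 0\<close>) and that of message \<open>i\<close>, \<open>s i\<close> the service time
  of message \<open>i\<close> (used only if it is not refused), \<open>z i\<close> the number of waiting places met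
  by message \<open>i\<close>, and \<open>mark i\<close> tells whether it is marked.  Service is in order of arrival.
\<close>

definition arrival_time :: "(nat \<Rightarrow> real) \<Rightarrow> nat \<Rightarrow> real" where
  "arrival_time a i = (\<Sum>j\<le>i. a j)"

text \<open>
  \<open>departures a s z i\<close> lists the departure times of the accepted messages among the first
  \<open>i\<close> arrivals, latest first.  A message with departure time \<open>d\<close> is in the system immediately
  before time \<open>t\<close> iff it arrived before \<open>t\<close> and \<open>t \<le> d\<close>.
\<close>

primrec departures ::
  "(nat \<Rightarrow> real) \<Rightarrow> (nat \<Rightarrow> real) \<Rightarrow> (nat \<Rightarrow> nat) \<Rightarrow> nat \<Rightarrow> real list" where
  "departures a s z 0 = []"
| "departures a s z (Suc i) =
     (let ds = departures a s z i; t = arrival_time a i in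
      if length (filter (\<lambda>d. t \<le> d) ds) > z i then ds
      else ((case ds of [] \<Rightarrow> t | d # _ \<Rightarrow> max t d) + s i) # ds)"

definition number_before ::
  "(nat \<Rightarrow> real) \<Rightarrow> (nat \<Rightarrow> real) \<Rightarrow> (nat \<Rightarrow> nat) \<Rightarrow> nat \<Rightarrow> nat" where
  "number_before a s z i = length (filter (\<lambda>d. arrival_time a i \<le> d) (departures a s z i))"

definition refused ::
  "(nat \<Rightarrow> real) \<Rightarrow> (nat \<Rightarrow> real) \<Rightarrow> (nat \<Rightarrow> nat) \<Rightarrow> nat \<Rightarrow> bool" where
  "refused a s z i \<longleftrightarrow> number_before a s z i > z i"

text \<open>
  The busy period considered is the one started by message 0, which finds the system empty.
  It ends when the system next becomes empty, so it comprises the messages that arrive before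
  the next one that finds the system empty.
\<close>

definition in_busy_period ::
  "(nat \<Rightarrow> real) \<Rightarrow> (nat \<Rightarrow> real) \<Rightarrow> (nat \<Rightarrow> nat) \<Rightarrow> nat \<Rightarrow> bool" where
  "in_busy_period a s z i \<longleftrightarrow> (\<forall>j. 0 < j \<and> j \<le> i \<longrightarrow> number_before a s z j > 0)"

text \<open>
  The numbers of messages below are counted in \<open>ennreal\<close>, so that an infinite busy period
  counts as infinite.
\<close>

definition num_processed ::
  "(nat \<Rightarrow> real) \<Rightarrow> (nat \<Rightarrow> real) \<Rightarrow> (nat \<Rightarrow> nat) \<Rightarrow> ennreal" where
  "num_processed a s z =
     (\<Sum>i. of_bool (in_busy_period a s z i \<and> \<not> refused a s z i))"

definition num_refused ::
  "(nat \<Rightarrow> real) \<Rightarrow> (nat \<Rightarrow> real) \<Rightarrow> (nat \<Rightarrow> nat) \<Rightarrow> ennreal" where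
  "num_refused a s z =
     (\<Sum>i. of_bool (in_busy_period a s z i \<and> refused a s z i))"

definition num_marked ::
  "(nat \<Rightarrow> real) \<Rightarrow> (nat \<Rightarrow> real) \<Rightarrow> (nat \<Rightarrow> nat) \<Rightarrow> (nat \<Rightarrow> bool) \<Rightarrow> ennreal" where
  "num_marked a s z mark =
     (\<Sum>i. of_bool (in_busy_period a s z i \<and> \<not> refused a s z i \<and> mark i))"

definition num_lost ::
  "(nat \<Rightarrow> real) \<Rightarrow> (nat \<Rightarrow> real) \<Rightarrow> (nat \<Rightarrow> nat) \<Rightarrow> (nat \<Rightarrow> bool) \<Rightarrow> ennreal" where
  "num_lost a s z mark = num_refused a s z + num_marked a s z mark"

definition loss_probability ::
  "'b measure \<Rightarrow> (nat \<Rightarrow> 'b \<Rightarrow> real) \<Rightarrow> (nat \<Rightarrow> 'b \<Rightarrow> real) \<Rightarrow> (nat \<Rightarrow> 'b \<Rightarrow> nat)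
     \<Rightarrow> (nat \<Rightarrow> 'b \<Rightarrow> bool) \<Rightarrow> real" where
  "loss_probability Q a s z mark = enn2real
     ((\<integral>\<^sup>+\<omega>. num_lost (\<lambda>i. a i \<omega>) (\<lambda>i. s i \<omega>) (\<lambda>i. z i \<omega>) (\<lambda>i. mark i \<omega>) \<partial>Q) /
      ((\<integral>\<^sup>+\<omega>. num_refused (\<lambda>i. a i \<omega>) (\<lambda>i. s i \<omega>) (\<lambda>i. z i \<omega>) \<partial>Q) +
       (\<integral>\<^sup>+\<omega>. num_processed (\<lambda>i. a i \<omega>) (\<lambda>i. s i \<omega>) (\<lambda>i. z i \<omega>) \<partial>Q)))"


section \<open>Probabilistic assumptions\<close>

locale message_sizes = prob_space M for M :: "'a measure" +
  fixes \<nu> :: "nat \<Rightarrow> 'a \<Rightarrow> nat" and \<nu>_lower \<nu>_upper :: nat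
  assumes size_iid: "indep_vars (\<lambda>_. count_space UNIV) \<nu> UNIV"
      "\<And>i. distr M (count_space UNIV) (\<nu> i) = distr M (count_space UNIV) (\<nu> 0)"
    and size_pos: "\<And>i \<omega>. \<omega> \<in> space M \<Longrightarrow> \<nu> i \<omega> > 0"
    and size_bounds: "\<And>i. AE \<omega> in M. \<nu>_lower \<le> \<nu> i \<omega> \<and> \<nu> i \<omega> \<le> \<nu>_upper"

text \<open>
  The set below is finite and nonempty, because message sizes are positive; hence \<open>Sup\<close> on
  \<open>nat\<close> is its maximum.
\<close>

definition waiting_places :: "(nat \<Rightarrow> 'a \<Rightarrow> nat) \<Rightarrow> nat \<Rightarrow> 'a \<Rightarrow> nat" where
  "waiting_places \<nu> N \<omega> = Sup {m. (\<Sum>i<m. \<nu> i \<omega>) \<le> N}"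

definition strictly_stationary :: "'b measure \<Rightarrow> (nat \<Rightarrow> 'b \<Rightarrow> nat) \<Rightarrow> bool" where
  "strictly_stationary Q z \<longleftrightarrow>
     distr Q (PiM UNIV (\<lambda>_. count_space UNIV)) (\<lambda>\<omega> i. z (Suc i) \<omega>) =
     distr Q (PiM UNIV (\<lambda>_. count_space UNIV)) (\<lambda>\<omega> i. z i \<omega>)"

definition ergodic_sequence :: "'b measure \<Rightarrow> (nat \<Rightarrow> 'b \<Rightarrow> nat) \<Rightarrow> bool" where
  "ergodic_sequence Q z \<longleftrightarrow>
     (\<forall>A \<in> sets (PiM UNIV (\<lambda>_. count_space UNIV)).
        (\<lambda>x i. x (Suc i)) -` A = A \<longrightarrow>
        measure Q {\<omega> \<in> space Q. (\<lambda>i. z i \<omega>) \<in> A} \<in> {0, 1})"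

text \<open>
  The independent sources of randomness; the sequence \<open>z\<close> of numbers of waiting places
  may be dependent in itself and forms one source.
\<close>

datatype source = Interarrival nat | Service nat | Mark nat | Places

text \<open>
  The Poisson arrival process of rate \<open>lam\<close> is given by its i.i.d. exponential interarrival
  times.  \<open>B\<close> is the law of a service time (the measure \<open>dB(x)\<close>), \<open>Z\<close> the common law of
  the numbers of waiting places.
\<close>

locale loss_queue = prob_space Q for Q :: "'b measure" +
  fixes lam :: real and B :: "real measure" and Z :: "nat measure" and p :: real
    and a s :: "nat \<Rightarrow> 'b \<Rightarrow> real" and z :: "nat \<Rightarrow> 'b \<Rightarrow> nat" and mark :: "nat \<Rightarrow> 'b \<Rightarrow> bool"
  assumes rate_pos: "lam > 0"
    and service_law: "real_distribution B" "AE x in B. 0 \<le> x"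
    and service_mean: "integrable B (\<lambda>x. x)" "(\<integral>x. x \<partial>B) > 0"
    and mark_prob_bounds: "0 \<le> p" "p \<le> 1"
    and interarrival: "\<And>i. distributed Q lborel (a i) (exponential_density lam)"
    and service: "\<And>i. s i \<in> borel_measurable Q" "\<And>i. distr Q borel (s i) = B"
    and places: "\<And>i. z i \<in> measurable Q (count_space UNIV)"
      "\<And>i. distr Q (count_space UNIV) (z i) = Z"
    and places_stationary: "strictly_stationary Q z"
    and places_ergodic: "ergodic_sequence Q z"
    and marks: "\<And>i. mark i \<in> measurable Q (count_space UNIV)"
      "\<And>i. prob {\<omega> \<in> space Q. mark i \<omega>} = p"
    and independence: "indep_sets (\<lambda>k. case k of
        Interarrival i \<Rightarrow> {a i -` A \<inter> space Q | A. A \<in> sets borel}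
      | Service i \<Rightarrow> {s i -` A \<inter> space Q | A. A \<in> sets borel}
      | Mark i \<Rightarrow> {mark i -` A \<inter> space Q | A. A \<in> sets (count_space UNIV)}
      | Places \<Rightarrow> {(\<lambda>\<omega> i. z i \<omega>) -` A \<inter> space Q | A. A \<in> sets (PiM UNIV (\<lambda>_. count_space UNIV))})
      UNIV"

definition rho :: "nat \<Rightarrow> real \<Rightarrow> real measure \<Rightarrow> real" where
  "rho j lam B = lam ^ j * (\<integral>x. x ^ j \<partial>B)"

end

theory Submission
  imports Defs
begin

text \<open>
  Let \<open>P\<close> and \<open>R\<close> be the mean numbers of processed and of refused messages of a busy period.
  While one message is served, \<open>\<rho> = 1 + \<epsilon>\<close> messages arrive on average, so Wald's identity
  (\<open>start_arrivals\<close>) gives \<open>R + P = 1 + \<rho> * P\<close>, and the loss probability equals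
  \<open>(1 + (\<epsilon> + p) * P) / (1 + \<rho> * P)\<close> (\<open>loss_probability_eq\<close>).  Both statements follow once
  \<open>\<epsilon> * P\<close> is known to converge to \<open>exp (2 * C / \<rho>2) - 1\<close> (\<open>processed_mean_tendsto\<close>).

  To find \<open>P\<close>, fix the numbers of places.  The service times of waiting messages do not influence
  who is refused before they begin, so they may be averaged out, and the expected number of messages still to be
  processed becomes a function of the number \<open>k\<close> of waiting messages and of the residual service \<open>x\<close>
  of the message being served.  With \<open>y\<close> for \<open>x\<close> times the arrival rate, consider
  \<open>\<beta> * (1 - (1 - \<gamma>) ^ k * exp (- \<gamma> * y)) - (\<rho> * k + y) / \<epsilon>\<close> with \<open>\<gamma>\<close> close to \<open>2 * \<epsilon> / \<rho>2\<close>.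
  As long as nobody is refused, its expected decrease equals, up to a small error, the expected number of
  accepted messages.  Accepting one more message is favourable for small \<open>k\<close> and unfavourable for large \<open>k\<close>;
  when \<open>\<beta>\<close> is adjusted so that the change occurs at the capacity \<open>m\<close>, refusals do
  no harm to the comparison, and the function gives \<open>P \<approx> ((1 - \<gamma>) ^ (- m) - 1) / \<epsilon>\<close>.
  This argument yields a lower bound if all numbers of places are at least \<open>m\<close>
  (\<open>start_processed_ge\<close>) and an upper bound if they are at most \<open>m\<close> (\<open>start_processed_le\<close>);
  the latter needs a correction for very long services, which the third moment makes negligible.
  For \<open>m\<close> close to \<open>C / \<epsilon>\<close> the limit appears.

  It remains to replace random by constant numbers of places.  By Hoeffding's inequality a number of places
  differs from \<open>C / \<epsilon>\<close> by more than \<open>\<eta> / \<epsilon>\<close> only with a probability exponentially small in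
  \<open>1 / \<epsilon>\<close> (\<open>waiting_places_concentrated\<close>).  The first \<open>n\<close> arrivals of the busy period, \<open>n\<close> of order
  \<open>1 / \<epsilon> ^ 3\<close>, therefore all meet about \<open>C / \<epsilon>\<close> places, up to an event of negligible probability.  The
  busy period survives them with probability of order \<open>\<epsilon>\<^sup>2\<close>, and what it has left is of order
  \<open>1 / \<epsilon>\<^sup>2\<close> (\<open>start_total_le_truncated\<close>), a bounded error against \<open>P\<close>, which is of order \<open>1 / \<epsilon>\<close>.
\<close>

section \<open>A measurable space of finite lists\<close>

text \<open>
  The state of the queue is a list of reals of varying length.  Embedding lists into pairs of a
  length and a sequence padded with zeros gives them a measurable structure for which measurability
  can be checked entry by entry.
\<close>

definition list_borel :: "real list measure" where
  "list_borel = vimage_algebra UNIV (\<lambda>xs. (length xs, nth_default 0 xs))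
     (count_space UNIV \<Otimes>\<^sub>M (\<Pi>\<^sub>M i\<in>UNIV. borel))"

lemma space_list_borel [simp]: "space list_borel = UNIV"
  by (simp add: list_borel_def)

lemma measurable_list_borel_iff:
  "f \<in> measurable M list_borel \<longleftrightarrow> (\<lambda>x. length (f x)) \<in> measurable M (count_space UNIV) \<and>
     (\<forall>i. (\<lambda>x. nth_default 0 (f x) i) \<in> borel_measurable M)" (is "?L \<longleftrightarrow> ?R")
proof
  have e: "(\<lambda>xs. (length xs, nth_default 0 xs)) \<in> measurable list_borel
      (count_space UNIV \<Otimes>\<^sub>M (\<Pi>\<^sub>M i\<in>UNIV. borel))"
    unfolding list_borel_def by (rule measurable_vimage_algebra1) (auto simp: space_pair_measure space_PiM)
  assume ?L
  from measurable_compose[OF this e]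
  have 1: "(\<lambda>x. (length (f x), nth_default 0 (f x))) \<in> measurable M
      (count_space UNIV \<Otimes>\<^sub>M (\<Pi>\<^sub>M i\<in>UNIV. borel))" .
  from measurable_compose[OF 1 measurable_fst] measurable_compose[OF 1 measurable_snd]
  show ?R by (auto intro: measurable_compose[OF _ measurable_component_singleton])
next
  assume ?R
  then show ?L
    unfolding list_borel_def
    by (intro measurable_vimage_algebra2) (auto intro!: measurable_Pair measurable_PiM_single')
qed

lemma measurable_list_borelI:
  assumes "(\<lambda>x. length (f x)) \<in> measurable M (count_space UNIV)"
    and "\<And>i. (\<lambda>x. nth_default 0 (f x) i) \<in> borel_measurable M"
  shows "f \<in> measurable M list_borel"
  using assms by (simp add: measurable_list_borel_iff)

lemma measurable_length_list_borel [measurable]: "length \<in> measurable list_borel (count_space UNIV)"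
  using measurable_list_borel_iff[of "\<lambda>x. x" list_borel] by simp

lemma measurable_nth_list_borel [measurable]: "(\<lambda>xs. nth_default 0 xs i) \<in> borel_measurable list_borel"
  using measurable_list_borel_iff[of "\<lambda>x. x" list_borel] by simp

lemma measurable_cons_list_borel [measurable (raw)]:
  assumes [measurable]: "f \<in> borel_measurable M" "g \<in> measurable M list_borel"
  shows "(\<lambda>x. f x # g x) \<in> measurable M list_borel"
proof (rule measurable_list_borelI)
  fix i show "(\<lambda>x. nth_default 0 (f x # g x) i) \<in> borel_measurable M"
    by (cases i) simp_all
qed simp

lemma measurable_snoc_list_borel [measurable (raw)]:
  assumes [measurable]: "f \<in> borel_measurable M" "g \<in> measurable M list_borel"
  shows "(\<lambda>x. g x @ [f x]) \<in> measurable M list_borel"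
proof (rule measurable_list_borelI)
  fix i
  have "(\<lambda>x. nth_default 0 (g x @ [f x]) i) =
      (\<lambda>x. if i < length (g x) then nth_default 0 (g x) i else if i = length (g x) then f x else 0)"
    by (auto simp: nth_default_def nth_append fun_eq_iff)
  then show "(\<lambda>x. nth_default 0 (g x @ [f x]) i) \<in> borel_measurable M"
    by simp
qed simp

lemma measurable_tl_list_borel [measurable]: "tl \<in> measurable list_borel list_borel"
proof (rule measurable_list_borelI)
  fix i
  have "(\<lambda>xs::real list. nth_default 0 (tl xs) i) = (\<lambda>xs. nth_default 0 xs (Suc i))"
  proof
    fix xs :: "real list" show "nth_default 0 (tl xs) i = nth_default 0 xs (Suc i)"
      by (cases xs) simp_all
  qed
  then show "(\<lambda>xs::real list. nth_default 0 (tl xs) i) \<in> borel_measurable list_borel"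
    by simp
qed simp

lemma sum_list_eq_sum_nth_default: "sum_list xs = (\<Sum>i<length xs. nth_default 0 xs i)"
  for xs :: "real list"
  by (simp add: sum_list_sum_nth nth_default_def atLeast0LessThan)

lemma measurable_sum_list_borel [measurable]: "sum_list \<in> borel_measurable list_borel"
proof -
  have "(\<lambda>xs::real list. \<Sum>i<length xs. nth_default 0 xs i) \<in> borel_measurable list_borel"
    by (rule measurable_compose_countable[where f = "\<lambda>n xs. \<Sum>i<n. nth_default 0 xs i"]) simp_all
  then show ?thesis
    by (simp add: sum_list_eq_sum_nth_default[abs_def])
qed

lemma measurable_Nil_test [measurable]: "Measurable.pred list_borel (\<lambda>xs. xs = [])"
proof -
  have "(\<lambda>xs::real list. xs = []) = (\<lambda>xs. length xs = 0)" by auto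
  moreover have "Measurable.pred list_borel (\<lambda>xs::real list. length xs = 0)" by measurable
  ultimately show ?thesis by simp
qed

section \<open>Serving a queue for a given time\<close>

text \<open>
  A state \<open>r # xs\<close> means that the message in service needs \<open>r\<close> more time and that the
  messages behind it need the service times \<open>xs\<close>.  A service that ends exactly at the observed
  time leaves a message with residual service 0, in accordance with the non-strict inequality in
  \<open>number_before\<close>.
\<close>

primrec advance :: "real \<Rightarrow> real list \<Rightarrow> real list" where
  "advance a [] = []"
| "advance a (r # xs) = (if a \<le> r then (r - a) # xs else advance (a - r) xs)"

text \<open>
  The recursion of \<open>advance\<close> runs over the list, so measurability is proved for lists of each
  fixed length and the countably many pieces are put together.
\<close>

lemma measurable_advance [measurable (raw)]:
  assumes [measurable]: "f \<in> borel_measurable M" "g \<in> measurable M list_borel"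
  shows "(\<lambda>x. advance (f x) (g x)) \<in> measurable M list_borel"
proof -
  define h where "h = (\<lambda>n (y::real \<times> real list). if length (snd y) = n then advance (fst y) (snd y) else [])"
  have "h n \<in> measurable (borel \<Otimes>\<^sub>M list_borel) list_borel" for n
  proof (induction n)
    case 0
    have "h 0 = (\<lambda>_. [])" by (auto simp: h_def)
    then show ?case by simp
  next
    case (Suc n)
    note [measurable] = Suc
    have "h (Suc n) = (\<lambda>y. if length (snd y) = Suc n then
        if fst y \<le> nth_default 0 (snd y) 0 then (nth_default 0 (snd y) 0 - fst y) # tl (snd y)
        else h n (fst y - nth_default 0 (snd y) 0, tl (snd y)) else [])"
    proof
      fix y :: "real \<times> real list"
      show "h (Suc n) y = (if length (snd y) = Suc n then
        if fst y \<le> nth_default 0 (snd y) 0 then (nth_default 0 (snd y) 0 - fst y) # tl (snd y)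
        else h n (fst y - nth_default 0 (snd y) 0, tl (snd y)) else [])"
        by (cases "snd y") (simp_all add: h_def)
    qed
    then show ?case by simp
  qed
  note [measurable] = this
  have "(\<lambda>y. h (length (snd y)) y) \<in> measurable (borel \<Otimes>\<^sub>M list_borel) list_borel"
    by (rule measurable_compose_countable[where f = h]) simp_all
  then have [measurable]: "(\<lambda>y. advance (fst y) (snd y)) \<in> measurable (borel \<Otimes>\<^sub>M list_borel) list_borel"
    by (simp add: h_def)
  have "(\<lambda>x. (\<lambda>y. advance (fst y) (snd y)) (f x, g x)) \<in> measurable M list_borel"
    by measurable
  then show ?thesis by simp
qed

lemma advance_nonneg: "list_all (\<lambda>x. 0 \<le> x) xs \<Longrightarrow> list_all (\<lambda>x. 0 \<le> x) (advance a xs)"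
  by (induction xs arbitrary: a) auto

section \<open>Averages over unrevealed services and over an interarrival time\<close>

locale single_server =
  fixes lam :: real and B :: "real measure"
  assumes lam_pos: "lam > 0"
    and B_dist: "real_distribution B"
    and B_nonneg: "AE x in B. 0 \<le> x"
begin

sublocale B: prob_space B
  using B_dist by (simp add: real_distribution_def)

lemma sets_B [measurable_cong, simp]: "sets B = sets borel"
  using B_dist by (simp add: real_distribution_def real_distribution_axioms_def)

lemma space_B [simp]: "space B = UNIV"
  using sets_eq_imp_space_eq[OF sets_B] by simp

lemma emeasure_B_UNIV [simp]: "emeasure B UNIV = 1"
  using B.emeasure_space_1 by simp

definition gap :: "real measure" where
  "gap = density lborel (exponential_density lam)"

sublocale gap: prob_space gap
  unfolding gap_def by (rule prob_space_exponential_density[OF lam_pos])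

lemma sets_gap [measurable_cong, simp]: "sets gap = sets borel"
  by (simp add: gap_def)

lemma space_gap [simp]: "space gap = UNIV"
  by (simp add: gap_def)

lemma emeasure_gap_UNIV [simp]: "emeasure gap UNIV = 1"
  using gap.emeasure_space_1 by simp

definition after_gap :: "(real list \<Rightarrow> ennreal) \<Rightarrow> real list \<Rightarrow> ennreal" where
  "after_gap G xs = (\<integral>\<^sup>+a. G (advance a xs) \<partial>gap)"

text \<open>
  \<open>avg k G xs\<close> reveals only the service times in \<open>xs\<close> and averages over those of \<open>k\<close>
  further waiting messages.  Refusals depend on the number of messages and on services already
  begun, so the services of waiting messages may stay unrevealed; the averaged state is
  just the pair of \<open>k\<close> and the residual service, although all service times are drawn on arrival.
\<close>

primrec avg :: "nat \<Rightarrow> (real list \<Rightarrow> ennreal) \<Rightarrow> real list \<Rightarrow> ennreal" where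
  "avg 0 G xs = G xs"
| "avg (Suc k) G xs = (\<integral>\<^sup>+x. avg k G (xs @ [x]) \<partial>B)"

lemma measurable_after_gap [measurable]:
  "G \<in> borel_measurable list_borel \<Longrightarrow> after_gap G \<in> borel_measurable list_borel"
  unfolding after_gap_def[abs_def] by (intro gap.borel_measurable_nn_integral) simp

lemma measurable_avg [measurable]:
  "G \<in> borel_measurable list_borel \<Longrightarrow> avg k G \<in> borel_measurable list_borel"
proof (induction k)
  case 0
  moreover have "avg 0 G = G" by (simp add: fun_eq_iff)
  ultimately show ?case by simp
next
  case (Suc k)
  then have [measurable]: "avg k G \<in> borel_measurable list_borel" by simp
  show ?case
    unfolding avg.simps by (intro B.borel_measurable_nn_integral) simp
qed

lemma after_gap_mono: "(\<And>xs. G xs \<le> H xs) \<Longrightarrow> after_gap G xs \<le> after_gap H xs"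
  unfolding after_gap_def by (intro nn_integral_mono)

lemma avg_cong:
  "(\<And>ys. G (xs @ ys) = H (xs @ ys) \<or> length ys \<noteq> k) \<Longrightarrow> avg k G xs = avg k H xs"
proof (induction k arbitrary: xs)
  case 0 from 0[of "[]"] show ?case by simp
next
  case (Suc k)
  show ?case unfolding avg.simps
  proof (intro nn_integral_cong Suc.IH)
    fix x ys show "G ((xs @ [x]) @ ys) = H ((xs @ [x]) @ ys) \<or> length ys \<noteq> k"
      using Suc.prems[of "x # ys"] by simp
  qed
qed

lemma avg_Suc_inner: "avg k (\<lambda>ys. \<integral>\<^sup>+s. G (ys @ [s]) \<partial>B) xs = avg (Suc k) G xs"
  by (induction k arbitrary: xs) simp_all

lemma avg_tl: "avg k (\<lambda>ys. G (tl ys)) (r # xs) = avg k G xs"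
  by (induction k arbitrary: xs) simp_all

lemma avg_add:
  assumes [measurable]: "G \<in> borel_measurable list_borel" "H \<in> borel_measurable list_borel"
  shows "avg k (\<lambda>xs. G xs + H xs) xs = avg k G xs + avg k H xs"
  by (induction k arbitrary: xs) (simp_all add: nn_integral_add)

lemma avg_cmult:
  assumes [measurable]: "G \<in> borel_measurable list_borel"
  shows "avg k (\<lambda>xs. c * G xs) xs = c * avg k G xs"
  by (induction k arbitrary: xs) (simp_all add: nn_integral_cmult)

lemma avg_const: "avg k (\<lambda>_. c) xs = c"
  by (induction k arbitrary: xs) simp_all

lemma avg_nn_integral:
  assumes "sigma_finite_measure N"
    and G: "(\<lambda>(t, xs). G t xs) \<in> borel_measurable (N \<Otimes>\<^sub>M list_borel)"
  shows "avg k (\<lambda>xs. \<integral>\<^sup>+t. G t xs \<partial>N) xs = (\<integral>\<^sup>+t. avg k (G t) xs \<partial>N)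
      \<and> (\<lambda>(t, xs). avg k (G t) xs) \<in> borel_measurable (N \<Otimes>\<^sub>M list_borel)"
proof (induction k arbitrary: xs)
  case 0 then show ?case using G by simp
next
  case (Suc k)
  interpret N: sigma_finite_measure N by fact
  interpret NB: pair_sigma_finite N B ..
  have m [measurable]: "(\<lambda>(t, xs). avg k (G t) xs) \<in> borel_measurable (N \<Otimes>\<^sub>M list_borel)"
    using Suc by blast
  have m': "(\<lambda>x. avg k (G (f x)) (g x)) \<in> borel_measurable L"
    if [measurable]: "f \<in> measurable L N" "g \<in> measurable L list_borel" for L f g
    using measurable_compose[OF measurable_Pair[OF that] m] by simp
  have "avg (Suc k) (\<lambda>xs. \<integral>\<^sup>+t. G t xs \<partial>N) xs = (\<integral>\<^sup>+x. (\<integral>\<^sup>+t. avg k (G t) (xs @ [x]) \<partial>N) \<partial>B)"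
    using Suc by simp
  also have "\<dots> = (\<integral>\<^sup>+t. (\<integral>\<^sup>+x. avg k (G t) (xs @ [x]) \<partial>B) \<partial>N)"
    by (intro NB.Fubini') (simp add: split_beta m')
  finally have "avg (Suc k) (\<lambda>xs. \<integral>\<^sup>+t. G t xs \<partial>N) xs = (\<integral>\<^sup>+t. avg (Suc k) (G t) xs \<partial>N)"
    by simp
  moreover have "(\<lambda>y. \<integral>\<^sup>+x. avg k (G (fst y)) (snd y @ [x]) \<partial>B) \<in> borel_measurable (N \<Otimes>\<^sub>M list_borel)"
    by (intro B.borel_measurable_nn_integral) (simp add: split_beta m')
  ultimately show ?case by (simp add: split_beta)
qed

lemma after_gap_Nil [simp]: "after_gap G [] = G []"
  by (simp add: after_gap_def)

text \<open>
  Either the next arrival comes while the first message of the list is still being served, or,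
  by memorylessness, the interarrival time starts afresh when that service ends.
\<close>

lemma after_gap_Cons:
  assumes [measurable]: "G \<in> borel_measurable list_borel" and r: "0 \<le> r"
  shows "after_gap G (r # xs) =
     (\<integral>\<^sup>+a\<in>{0..r}. ennreal (lam * exp (- lam * a)) * G ((r - a) # xs) \<partial>lborel)
     + ennreal (exp (- lam * r)) * after_gap G xs"
proof -
  define e where "e = exponential_density lam"
  have [measurable]: "e \<in> borel_measurable borel" by (simp add: e_def)
  have dens: "after_gap G ys = (\<integral>\<^sup>+a. ennreal (e a) * G (advance a ys) \<partial>lborel)" for ys
    unfolding after_gap_def gap_def e_def by (subst nn_integral_density) auto
  have "after_gap G (r # xs) = (\<integral>\<^sup>+a. ennreal (e a) * G ((r - a) # xs) * indicator {0..r} a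
        + ennreal (e a) * G (advance (a - r) xs) * indicator {r<..} a \<partial>lborel)"
    unfolding dens
    by (intro nn_integral_cong) (use r in \<open>auto simp: indicator_def e_def exponential_density_def\<close>)
  also have "\<dots> = (\<integral>\<^sup>+a\<in>{0..r}. ennreal (e a) * G ((r - a) # xs) \<partial>lborel)
        + (\<integral>\<^sup>+a. ennreal (e a) * G (advance (a - r) xs) * indicator {r<..} a \<partial>lborel)"
    by (intro nn_integral_add) simp_all
  also have "(\<integral>\<^sup>+a. ennreal (e a) * G (advance (a - r) xs) * indicator {r<..} a \<partial>lborel)
      = (\<integral>\<^sup>+a. ennreal (e (r + a)) * G (advance a xs) * indicator {r<..} (r + a) \<partial>lborel)"
    by (subst nn_integral_real_affine[where c = 1 and t = r]) simp_all
  also have "\<dots> = (\<integral>\<^sup>+a. ennreal (exp (- lam * r)) * (ennreal (e a) * G (advance a xs)) \<partial>lborel)"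
  proof (intro nn_integral_cong_AE eventually_mono[OF AE_lborel_singleton[of "0::real"]])
    fix a :: real assume a: "a \<noteq> 0"
    show "ennreal (e (r + a)) * G (advance a xs) * indicator {r<..} (r + a) =
        ennreal (exp (- lam * r)) * (ennreal (e a) * G (advance a xs))"
    proof (cases "0 < a")
      case True
      then have "e (r + a) = exp (- lam * r) * e a"
        using r by (simp add: e_def exponential_density_def distrib_right exp_add[symmetric] algebra_simps)
      moreover have "0 \<le> e a" using lam_pos by (simp add: e_def exponential_density_nonneg)
      ultimately show ?thesis
        using True by (simp add: ennreal_mult mult.assoc)
    next
      case False
      then show ?thesis using a by (simp add: e_def exponential_density_def)
    qed
  qed
  also have "\<dots> = ennreal (exp (- lam * r)) * after_gap G xs"
    unfolding dens by (intro nn_integral_cmult) simp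
  also have "(\<integral>\<^sup>+a\<in>{0..r}. ennreal (e a) * G ((r - a) # xs) \<partial>lborel) =
      (\<integral>\<^sup>+a\<in>{0..r}. ennreal (lam * exp (- lam * a)) * G ((r - a) # xs) \<partial>lborel)"
    by (intro nn_integral_cong) (auto simp: e_def exponential_density_def indicator_def mult_ac)
  finally show ?thesis .
qed

text \<open>
  The first-step decomposition of the averaged process: an arrival during the current service keeps
  all \<open>k\<close> waiting services unrevealed, the end of the service reveals the next one.
\<close>

lemma avg_after_gap:
  assumes [measurable]: "G \<in> borel_measurable list_borel" and r: "0 \<le> r"
  shows "avg k (after_gap G) [r] =
     (\<integral>\<^sup>+a\<in>{0..r}. ennreal (lam * exp (- lam * a)) * avg k G [r - a] \<partial>lborel)
     + ennreal (exp (- lam * r)) * avg k (after_gap G) []"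
proof -
  define I where "I = (\<lambda>a ys. ennreal (lam * exp (- lam * a)) * indicator {0..r} a * G ((r - a) # tl ys))"
  have [measurable]: "(\<lambda>(t, xs). I t xs) \<in> borel_measurable (lborel \<Otimes>\<^sub>M list_borel)"
    unfolding I_def split_beta by measurable
  have [measurable]: "(\<lambda>xs. \<integral>\<^sup>+t. I t xs \<partial>lborel) \<in> borel_measurable list_borel"
    by (intro sigma_finite_measure.borel_measurable_nn_integral) (auto intro: lborel.sigma_finite_measure_axioms)
  have shift: "avg k (\<lambda>ys. G (t # tl ys)) (r # xs) = avg k G (t # xs)" for t xs k
    by (induction k arbitrary: xs) simp_all
  have "avg k (after_gap G) [r] =
    avg k (\<lambda>ys. (\<integral>\<^sup>+t. I t ys \<partial>lborel) + ennreal (exp (- lam * r)) * after_gap G (tl ys)) [r]"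
    by (rule avg_cong) (auto simp: after_gap_Cons r I_def mult_ac intro!: nn_integral_cong)
  also have "\<dots> = avg k (\<lambda>ys. (\<integral>\<^sup>+t. I t ys \<partial>lborel)) [r]
      + ennreal (exp (- lam * r)) * avg k (\<lambda>ys. after_gap G (tl ys)) [r]"
    by (simp add: avg_add avg_cmult)
  also have "avg k (\<lambda>ys. after_gap G (tl ys)) [r] = avg k (after_gap G) []"
    by (rule avg_tl)
  also have "avg k (\<lambda>ys. (\<integral>\<^sup>+t. I t ys \<partial>lborel)) [r] = (\<integral>\<^sup>+t. avg k (I t) [r] \<partial>lborel)"
    using avg_nn_integral[of lborel I k "[r]"] by (simp add: lborel.sigma_finite_measure_axioms)
  also have "\<dots> = (\<integral>\<^sup>+t\<in>{0..r}. ennreal (lam * exp (- lam * t)) * avg k G [r - t] \<partial>lborel)"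
  proof (intro nn_integral_cong)
    fix t :: real
    have "avg k (I t) [r] = ennreal (lam * exp (- lam * t)) * indicator {0..r} t * avg k (\<lambda>ys. G ((r - t) # tl ys)) [r]"
      unfolding I_def by (rule avg_cmult) simp
    then show "avg k (I t) [r] = ennreal (lam * exp (- lam * t)) * avg k G [r - t] * indicator {0..r} t"
      by (simp only: shift mult_ac)
  qed
  finally show ?thesis .
qed

lemma avg_after_gap_Nil:
  "avg 0 (after_gap G) [] = G []"
  "avg (Suc k) (after_gap G) [] = (\<integral>\<^sup>+x. avg k (after_gap G) [x] \<partial>B)"
  by simp_all

text \<open>
  Let \<open>f r\<close> be the value of a state with residual service \<open>r\<close> just after an arrival and
  \<open>g r\<close> its value just before one.  During a service \<open>r\<close> decreases at unit rate, so \<open>f\<close> is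
  the expected value of \<open>g\<close> at the next arrival, or of \<open>f 0\<close> if the service ends first,
  iff \<open>f' = lam * (g - f)\<close>.  This is why the value just before an arrival appears below
  as \<open>f + f' / lam\<close>.
\<close>

lemma exponential_average:
  fixes f f' :: "real \<Rightarrow> real"
  assumes r: "0 \<le> r"
    and deriv: "\<And>x. 0 \<le> x \<Longrightarrow> (f has_real_derivative f' x) (at x)"
    and cont: "\<And>x. 0 \<le> x \<Longrightarrow> isCont f' x"
  shows "has_bochner_integral lborel
     (\<lambda>a. (lam * exp (- lam * a) * (f (r - a) + f' (r - a) / lam)) * indicator {0..r} a)
     (f r - exp (- lam * r) * f 0)"
proof -
  define F where "F = (\<lambda>a. - exp (- lam * a) * f (r - a))"
  have "has_bochner_integral lborel
     (\<lambda>a. (lam * exp (- lam * a) * (f (r - a) + f' (r - a) / lam)) * indicator {0..r} a) (F r - F 0)"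
  proof (rule has_bochner_integral_FTC_Icc_real[OF r])
    fix a assume a: "0 \<le> a" "a \<le> r"
    have d: "((\<lambda>a. r - a) has_real_derivative - 1) (at a)"
      by (auto intro!: derivative_eq_intros)
    have 1: "((\<lambda>a. f (r - a)) has_real_derivative f' (r - a) * (- 1)) (at a)"
      by (rule DERIV_chain2[OF deriv d]) (use a in auto)
    have 2: "((\<lambda>a. - exp (- lam * a)) has_real_derivative lam * exp (- lam * a)) (at a)"
      by (auto intro!: derivative_eq_intros)
    have "(F has_real_derivative lam * exp (- lam * a) * f (r - a) + f' (r - a) * (- 1) * (- exp (- lam * a))) (at a)"
      unfolding F_def by (rule DERIV_mult[OF 2 1])
    moreover have "lam * exp (- lam * a) * f (r - a) + f' (r - a) * (- 1) * (- exp (- lam * a)) =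
        lam * exp (- lam * a) * (f (r - a) + f' (r - a) / lam)"
      using lam_pos by (simp add: field_simps)
    ultimately show "(F has_real_derivative lam * exp (- lam * a) * (f (r - a) + f' (r - a) / lam)) (at a)"
      by simp
    show "isCont (\<lambda>a. lam * exp (- lam * a) * (f (r - a) + f' (r - a) / lam)) a"
    proof -
      have "isCont (\<lambda>a. f' (r - a)) a"
        by (rule isCont_o2[OF DERIV_isCont[OF d] cont]) (use a in simp)
      then show ?thesis
        using lam_pos by (intro continuous_intros DERIV_isCont[OF 1]) auto
    qed
  qed
  then show ?thesis by (simp add: F_def)
qed

lemma nn_exponential_average_le:
  fixes f f' :: "real \<Rightarrow> real"
  assumes r: "0 \<le> r"
    and deriv: "\<And>x. 0 \<le> x \<Longrightarrow> (f has_real_derivative f' x) (at x)"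
    and cont: "\<And>x. 0 \<le> x \<Longrightarrow> isCont f' x"
    and g: "\<And>x. 0 \<le> x \<Longrightarrow> g x \<le> ennreal (f x + f' x / lam)"
    and nonneg: "\<And>x. 0 \<le> x \<Longrightarrow> 0 \<le> f x + f' x / lam"
    and f0: "0 \<le> f 0" and R: "R \<le> ennreal (f 0)"
  shows "(\<integral>\<^sup>+a\<in>{0..r}. ennreal (lam * exp (- lam * a)) * g (r - a) \<partial>lborel)
     + ennreal (exp (- lam * r)) * R \<le> ennreal (f r)"
proof -
  let ?h = "\<lambda>a. (lam * exp (- lam * a) * (f (r - a) + f' (r - a) / lam)) * indicator {0..r} a"
  note I = exponential_average[OF r deriv cont]
  have nn: "0 \<le> ?h a" for a
    using nonneg[of "r - a"] lam_pos by (auto simp: indicator_def)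
  have "(\<integral>\<^sup>+a\<in>{0..r}. ennreal (lam * exp (- lam * a)) * g (r - a) \<partial>lborel) \<le> (\<integral>\<^sup>+a. ennreal (?h a) \<partial>lborel)"
  proof (intro nn_integral_mono)
    fix a
    show "ennreal (lam * exp (- lam * a)) * g (r - a) * indicator {0..r} a \<le> ennreal (?h a)"
    proof (cases "a \<in> {0..r}")
      case True
      then have "ennreal (lam * exp (- lam * a)) * g (r - a)
          \<le> ennreal (lam * exp (- lam * a)) * ennreal (f (r - a) + f' (r - a) / lam)"
        by (intro mult_left_mono g) auto
      also have "\<dots> = ennreal (?h a)"
        using True lam_pos by (simp add: ennreal_mult')
      finally show ?thesis using True by simp
    qed simp
  qed
  also have "\<dots> = ennreal (f r - exp (- lam * r) * f 0)"
    using nn_integral_eq_integral[of lborel ?h] I nn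
    by (simp add: has_bochner_integral_iff)
  finally have 1: "(\<integral>\<^sup>+a\<in>{0..r}. ennreal (lam * exp (- lam * a)) * g (r - a) \<partial>lborel)
      \<le> ennreal (f r - exp (- lam * r) * f 0)" .
  have "0 \<le> integral\<^sup>L lborel ?h" using nn by (intro Bochner_Integration.integral_nonneg) simp
  then have 2: "0 \<le> f r - exp (- lam * r) * f 0"
    using I by (simp add: has_bochner_integral_iff)
  have "ennreal (exp (- lam * r)) * R \<le> ennreal (exp (- lam * r) * f 0)"
    using R f0 by (simp add: ennreal_mult mult_left_mono)
  with 1 have "(\<integral>\<^sup>+a\<in>{0..r}. ennreal (lam * exp (- lam * a)) * g (r - a) \<partial>lborel)
     + ennreal (exp (- lam * r)) * R
     \<le> ennreal (f r - exp (- lam * r) * f 0) + ennreal (exp (- lam * r) * f 0)"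
    by (rule add_mono)
  also have "\<dots> = ennreal (f r)"
    using 2 f0 by (simp flip: ennreal_plus)
  finally show ?thesis .
qed

lemma ennreal_add_le: "ennreal (u + v) \<le> ennreal u + ennreal v"
proof (cases "0 \<le> u \<and> 0 \<le> v")
  case False
  then have "ennreal (u + v) \<le> ennreal u \<or> ennreal (u + v) \<le> ennreal v"
    by (auto intro: ennreal_leI)
  then show ?thesis
    by (auto intro: order_trans add_increasing add_increasing2)
qed simp

lemma nn_exponential_average_ge:
  fixes f f' :: "real \<Rightarrow> real"
  assumes r: "0 \<le> r"
    and deriv: "\<And>x. 0 \<le> x \<Longrightarrow> (f has_real_derivative f' x) (at x)"
    and cont: "\<And>x. 0 \<le> x \<Longrightarrow> isCont f' x"
    and g: "\<And>x. 0 \<le> x \<Longrightarrow> ennreal (f x + f' x / lam) \<le> g x"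
    and R: "ennreal (f 0) \<le> R"
  shows "ennreal (f r) \<le> (\<integral>\<^sup>+a\<in>{0..r}. ennreal (lam * exp (- lam * a)) * g (r - a) \<partial>lborel)
     + ennreal (exp (- lam * r)) * R"
proof -
  let ?h = "\<lambda>a. (lam * exp (- lam * a) * (f (r - a) + f' (r - a) / lam)) * indicator {0..r} a"
  note I = exponential_average[OF r deriv cont]
  have int: "integrable lborel ?h" and eq: "integral\<^sup>L lborel ?h = f r - exp (- lam * r) * f 0"
    using I by (simp_all add: has_bochner_integral_iff)
  have pos: "integrable lborel (\<lambda>a. max 0 (?h a))" using int by simp
  have "f r - exp (- lam * r) * f 0 \<le> integral\<^sup>L lborel (\<lambda>a. max 0 (?h a))"
    unfolding eq[symmetric] by (intro integral_mono int pos) simp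
  then have "ennreal (f r - exp (- lam * r) * f 0) \<le> ennreal (integral\<^sup>L lborel (\<lambda>a. max 0 (?h a)))"
    by (rule ennreal_leI)
  also have "\<dots> = (\<integral>\<^sup>+a. ennreal (max 0 (?h a)) \<partial>lborel)"
    using pos by (intro nn_integral_eq_integral[symmetric]) simp_all
  also have "\<dots> \<le> (\<integral>\<^sup>+a\<in>{0..r}. ennreal (lam * exp (- lam * a)) * g (r - a) \<partial>lborel)"
  proof (intro nn_integral_mono)
    fix a
    show "ennreal (max 0 (?h a)) \<le> ennreal (lam * exp (- lam * a)) * g (r - a) * indicator {0..r} a"
    proof (cases "a \<in> {0..r}")
      case True
      then have "ennreal (max 0 (?h a)) = ennreal (lam * exp (- lam * a)) * ennreal (f (r - a) + f' (r - a) / lam)"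
        using lam_pos by (simp add: ennreal_mult' max_def zero_le_mult_iff ennreal_neg)
      also have "\<dots> \<le> ennreal (lam * exp (- lam * a)) * g (r - a)"
        using True by (intro mult_left_mono g) auto
      finally show ?thesis using True by simp
    qed simp
  qed
  finally have 1: "ennreal (f r - exp (- lam * r) * f 0) \<le>
      (\<integral>\<^sup>+a\<in>{0..r}. ennreal (lam * exp (- lam * a)) * g (r - a) \<partial>lborel)" .
  have 2: "ennreal (exp (- lam * r) * f 0) \<le> ennreal (exp (- lam * r)) * R"
    using R by (simp add: ennreal_mult' mult_left_mono)
  have "ennreal (f r) \<le> ennreal (f r - exp (- lam * r) * f 0) + ennreal (exp (- lam * r) * f 0)"
    by (rule order_trans[OF _ ennreal_add_le]) simp
  with 1 2 show ?thesis by (meson add_mono order_trans)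
qed

end

section \<open>Rewards collected during a busy period\<close>

definition serve :: "real \<times> real \<Rightarrow> nat \<Rightarrow> real list \<Rightarrow> real list" where
  "serve y m xs = advance (fst y) (if length xs \<le> m then xs @ [snd y] else xs)"

text \<open>
  Starting before an arrival to a nonempty system with state \<open>xs\<close>, \<open>reward\<close> collects \<open>u\<close> per
  accepted and \<open>v\<close> per refused message among the next \<open>n\<close> arrivals of the busy period, and
  \<open>t\<close> of the state and of the places still to come after them.  The pair \<open>w i\<close> consists of the
  time from arrival \<open>i\<close> to arrival \<open>i + 1\<close> and of the service time of message \<open>i\<close>.
\<close>

primrec reward :: "ennreal \<Rightarrow> ennreal \<Rightarrow> ((nat \<Rightarrow> nat) \<Rightarrow> real list \<Rightarrow> ennreal) \<Rightarrow> nat \<Rightarrow>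
    (nat \<Rightarrow> nat) \<Rightarrow> (nat \<Rightarrow> real \<times> real) \<Rightarrow> real list \<Rightarrow> ennreal" where
  "reward u v t 0 z w xs = t z xs"
| "reward u v t (Suc n) z w xs = (if xs = [] then 0 else
     (if length xs \<le> z 0 then u else v) +
     reward u v t n (\<lambda>i. z (Suc i)) (\<lambda>i. w (Suc i)) (serve (w 0) (z 0) xs))"

abbreviation places_space :: "(nat \<Rightarrow> nat) measure" where
  "places_space \<equiv> \<Pi>\<^sub>M i\<in>UNIV. count_space UNIV"

lemma pred_le_nat [measurable (raw)]:
  fixes l m :: "'a \<Rightarrow> nat"
  assumes l: "l \<in> measurable M (count_space UNIV)" and m: "m \<in> measurable M (count_space UNIV)"
  shows "Measurable.pred M (\<lambda>x. l x \<le> m x)"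
  by (rule measurable_compose_countable[where f = "\<lambda>i x. i \<le> m x" and g = l, OF _ l])
    (rule measurable_compose[OF m measurable_count_space])

lemma measurable_serve [measurable (raw)]:
  assumes [measurable]: "f \<in> measurable M (borel \<Otimes>\<^sub>M borel)" "m \<in> measurable M (count_space UNIV)"
    "g \<in> measurable M list_borel"
  shows "(\<lambda>x. serve (f x) (m x) (g x)) \<in> measurable M list_borel"
  unfolding serve_def by measurable

lemma measurable_reward:
  assumes t: "(\<lambda>(z, xs). t z xs) \<in> borel_measurable (places_space \<Otimes>\<^sub>M list_borel)"
    and z: "z \<in> measurable M places_space"
    and w: "w \<in> measurable M (\<Pi>\<^sub>M i\<in>UNIV. borel \<Otimes>\<^sub>M borel)"
    and g: "g \<in> measurable M list_borel"
  shows "(\<lambda>x. reward u v t n (z x) (w x) (g x)) \<in> borel_measurable M"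
  using z w g
proof (induction n arbitrary: z w g)
  case 0
  then show ?case using measurable_compose[OF measurable_Pair[OF 0(1) 0(3)] t] by simp
next
  case (Suc n)
  note [measurable] = Suc.prems
  have zi [measurable]: "(\<lambda>x. z x i) \<in> measurable M (count_space UNIV)" for i
    by (rule measurable_compose[OF Suc.prems(1) measurable_component_singleton]) simp
  have wi [measurable]: "(\<lambda>x. w x i) \<in> measurable M (borel \<Otimes>\<^sub>M borel)" for i
    by (rule measurable_compose[OF Suc.prems(2) measurable_component_singleton]) simp
  have [measurable]: "(\<lambda>x. reward u v t n (\<lambda>i. z x (Suc i)) (\<lambda>i. w x (Suc i)) (serve (w x 0) (z x 0) (g x)))
      \<in> borel_measurable M"
    by (rule Suc.IH) (auto intro!: measurable_PiM_single' simp: space_pair_measure)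
  show ?case by simp
qed

lemma reward_add:
  "reward (u + u') (v + v') (\<lambda>z xs. t z xs + t' z xs) n z w xs =
   reward u v t n z w xs + reward u' v' t' n z w xs"
proof (induction n arbitrary: z w xs)
  case (Suc n)
  show ?case
    unfolding reward.simps Suc by (cases "xs = []"; cases "length xs \<le> z 0")
      (simp_all only: simp_thms refl if_True if_False add.assoc add.left_commute add_0_left)
qed simp

lemma incseq_reward: "incseq (\<lambda>n. reward u v (\<lambda>_ _. 0) n z w xs)"
proof (rule incseq_SucI)
  show "reward u v (\<lambda>_ _. 0) n z w xs \<le> reward u v (\<lambda>_ _. 0) (Suc n) z w xs" for n
  proof (induction n arbitrary: z w xs)
    case (Suc n)
    show ?case
      using Suc[where z = "\<lambda>i. z (Suc i)" and w = "\<lambda>i. w (Suc i)" and xs = "serve (w 0) (z 0) xs"]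
      unfolding reward.simps(2)[of u v _ n z w xs] reward.simps(2)[of u v _ "Suc n" z w xs]
      by (auto simp del: reward.simps intro: add_left_mono)
  qed simp
qed

lemma Nil_reward: "t z [] = 0 \<Longrightarrow> reward u v t n z w [] = 0"
  by (cases n) simp_all

context single_server
begin

definition steps :: "(nat \<Rightarrow> real \<times> real) measure" where
  "steps = (\<Pi>\<^sub>M i\<in>UNIV. gap \<Otimes>\<^sub>M B)"

sublocale GB: pair_prob_space gap B ..

sublocale S: product_prob_space "\<lambda>_. gap \<Otimes>\<^sub>M B" "UNIV :: nat set" ..

sublocale sequence_space "gap \<Otimes>\<^sub>M B" ..

sublocale steps: prob_space steps
  unfolding steps_def by (rule S.prob_space_axioms)

lemma sets_steps [measurable_cong]: "sets steps = sets (\<Pi>\<^sub>M i\<in>UNIV. borel \<Otimes>\<^sub>M borel)"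
  unfolding steps_def by (intro sets_PiM_cong sets_pair_measure_cong) simp_all

lemma space_steps [simp]: "space steps = UNIV"
  by (simp add: steps_def space_PiM space_pair_measure)

text \<open>
  An i.i.d. sequence is its first entry followed by an independent copy of itself; this turns
  expectations over sample paths into a recursion.
\<close>

lemma nn_integral_steps:
  assumes f: "f \<in> borel_measurable steps"
  shows "(\<integral>\<^sup>+w. f w \<partial>steps) = (\<integral>\<^sup>+s. (\<integral>\<^sup>+a. (\<integral>\<^sup>+w. f (case_nat (a, s) w) \<partial>steps) \<partial>gap) \<partial>B)"
proof -
  interpret steps: sigma_finite_measure steps ..
  have f' [measurable]: "f \<in> borel_measurable S" using f by (simp add: steps_def)
  have m: "(\<lambda>(s, \<omega>). case_nat s \<omega>) \<in> measurable ((gap \<Otimes>\<^sub>M B) \<Otimes>\<^sub>M S) S" by measurable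
  have fm [measurable]: "(\<lambda>x. f ((\<lambda>(s, \<omega>). case_nat s \<omega>) x)) \<in> borel_measurable ((gap \<Otimes>\<^sub>M B) \<Otimes>\<^sub>M S)"
    using measurable_compose[OF m f'] .
  have "(\<integral>\<^sup>+w. f w \<partial>steps) = (\<integral>\<^sup>+w. f w \<partial>distr ((gap \<Otimes>\<^sub>M B) \<Otimes>\<^sub>M S) S (\<lambda>(s, \<omega>). case_nat s \<omega>))"
    unfolding PiM_iter by (simp add: steps_def)
  also have "\<dots> = (\<integral>\<^sup>+x. f ((\<lambda>(s, \<omega>). case_nat s \<omega>) x) \<partial>((gap \<Otimes>\<^sub>M B) \<Otimes>\<^sub>M S))"
    by (rule nn_integral_distr[OF m]) simp
  also have "\<dots> = (\<integral>\<^sup>+y. (\<integral>\<^sup>+w. f (case_nat y w) \<partial>S) \<partial>(gap \<Otimes>\<^sub>M B))"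
    by (subst S.nn_integral_fst[symmetric]) (simp_all add: fm)
  also have "\<dots> = (\<integral>\<^sup>+s. (\<integral>\<^sup>+a. (\<integral>\<^sup>+w. f (case_nat (a, s) w) \<partial>S) \<partial>gap) \<partial>B)"
  proof -
    have g: "(\<lambda>y. \<integral>\<^sup>+w. f (case_nat y w) \<partial>S) \<in> borel_measurable (gap \<Otimes>\<^sub>M B)"
      using fm by (intro S.borel_measurable_nn_integral) (simp add: split_beta')
    show ?thesis
      using GB.nn_integral_snd[OF g] by simp
  qed
  finally show ?thesis by (simp add: steps_def)
qed

definition expected_reward :: "ennreal \<Rightarrow> ennreal \<Rightarrow> ((nat \<Rightarrow> nat) \<Rightarrow> real list \<Rightarrow> ennreal) \<Rightarrow> nat \<Rightarrow>
    (nat \<Rightarrow> nat) \<Rightarrow> real list \<Rightarrow> ennreal" where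
  "expected_reward u v t n z xs = (\<integral>\<^sup>+w. reward u v t n z w xs \<partial>steps)"

text \<open>
  Admissible terminal rewards vanish on the empty system, because the busy period is over there.
\<close>

definition terminal :: "((nat \<Rightarrow> nat) \<Rightarrow> real list \<Rightarrow> ennreal) \<Rightarrow> bool" where
  "terminal t \<longleftrightarrow> (\<lambda>(z, xs). t z xs) \<in> borel_measurable (places_space \<Otimes>\<^sub>M list_borel) \<and> (\<forall>z. t z [] = 0)"

lemma terminal_zero [simp]: "terminal (\<lambda>_ _. 0)"
  by (simp add: terminal_def)

lemma terminal_nonempty: "terminal (\<lambda>_ xs. if xs = [] then 0 else c)"
  by (simp add: terminal_def)

lemma measurable_expected_reward_joint:
  assumes t: "terminal t"
    and z: "z \<in> measurable M places_space" and g: "g \<in> measurable M list_borel"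
  shows "(\<lambda>x. expected_reward u v t n (z x) (g x)) \<in> borel_measurable M"
proof -
  have "(\<lambda>y. reward u v t n (z (fst y)) (snd y) (g (fst y))) \<in> borel_measurable (M \<Otimes>\<^sub>M steps)"
    using t unfolding terminal_def
    by (intro measurable_reward measurable_compose[OF measurable_fst z] measurable_compose[OF measurable_fst g])
      (simp_all add: measurable_cong_sets[OF refl sets_steps[symmetric]])
  then show ?thesis
    unfolding expected_reward_def by (intro steps.borel_measurable_nn_integral) (simp add: split_beta')
qed

lemma measurable_expected_reward [measurable]:
  "terminal t \<Longrightarrow> expected_reward u v t n z \<in> borel_measurable list_borel"
  by (rule measurable_expected_reward_joint) (auto intro: measurable_const simp: space_PiM)

lemma terminal_expected_reward: "terminal t \<Longrightarrow> terminal (expected_reward u v t n)"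
  by (auto simp: terminal_def[of "expected_reward u v t n"] split_beta' expected_reward_def[of _ _ _ _ _ "[]"]
      Nil_reward terminal_def[of t] intro!: measurable_expected_reward_joint)

lemma expected_reward_Nil [simp]: "terminal t \<Longrightarrow> expected_reward u v t n z [] = 0"
  by (simp add: expected_reward_def terminal_def Nil_reward)

lemma expected_reward_0 [simp]: "expected_reward u v t 0 z xs = t z xs"
  using steps.emeasure_space_1 by (simp add: expected_reward_def)

lemma expected_reward_Suc:
  assumes t: "terminal t" and xs: "xs \<noteq> []"
  shows "expected_reward u v t (Suc n) z xs =
    (if length xs \<le> z 0
     then u + (\<integral>\<^sup>+s. after_gap (expected_reward u v t n (\<lambda>i. z (Suc i))) (xs @ [s]) \<partial>B)
     else v + after_gap (expected_reward u v t n (\<lambda>i. z (Suc i))) xs)"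
proof -
  have m: "(\<lambda>w. reward u v t (Suc n) z w xs) \<in> borel_measurable steps"
    using t unfolding terminal_def
    by (intro measurable_reward) (auto simp: measurable_cong_sets[OF refl sets_steps[symmetric]] space_PiM)
  have m2: "(\<lambda>w. reward u v t n z' w ys) \<in> borel_measurable steps" for z' ys
    using t unfolding terminal_def
    by (intro measurable_reward) (auto simp: measurable_cong_sets[OF refl sets_steps[symmetric]] space_PiM)
  let ?c = "if length xs \<le> z 0 then u else v"
  let ?V = "expected_reward u v t n (\<lambda>i. z (Suc i))"
  note [measurable] = measurable_expected_reward[OF t]
  have "expected_reward u v t (Suc n) z xs =
     (\<integral>\<^sup>+s. (\<integral>\<^sup>+a. ?c + ?V (serve (a, s) (z 0) xs) \<partial>gap) \<partial>B)"
    unfolding expected_reward_def nn_integral_steps[OF m]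
    by (intro nn_integral_cong) (use xs m2 steps.emeasure_space_1 in \<open>simp add: nn_integral_add\<close>)
  also have "\<dots> = (\<integral>\<^sup>+s. ?c + (\<integral>\<^sup>+a. ?V (serve (a, s) (z 0) xs) \<partial>gap) \<partial>B)"
    by (intro nn_integral_cong) (simp add: nn_integral_add)
  also have "\<dots> = ?c + (\<integral>\<^sup>+s. (\<integral>\<^sup>+a. ?V (serve (a, s) (z 0) xs) \<partial>gap) \<partial>B)"
    by (subst nn_integral_add) (auto intro!: gap.borel_measurable_nn_integral)
  also have "\<dots> = (if length xs \<le> z 0
     then u + (\<integral>\<^sup>+s. after_gap ?V (xs @ [s]) \<partial>B) else v + after_gap ?V xs)"
    by (simp add: serve_def after_gap_def)
  finally show ?thesis .
qed

text \<open>
  The recursion for the averaged state: an accepted message only increases the number of unrevealed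
  services.
\<close>

lemma avg_expected_reward_Suc:
  assumes t: "terminal t"
  shows "avg k (expected_reward u v t (Suc n) z) [r] =
    (if Suc k \<le> z 0 then u + avg (Suc k) (after_gap (expected_reward u v t n (\<lambda>i. z (Suc i)))) [r]
     else v + avg k (after_gap (expected_reward u v t n (\<lambda>i. z (Suc i)))) [r])"
proof -
  let ?V = "after_gap (expected_reward u v t n (\<lambda>i. z (Suc i)))"
  note [measurable] = measurable_expected_reward[OF t]
  have [measurable]: "(\<lambda>xs. \<integral>\<^sup>+s. ?V (xs @ [s]) \<partial>B) \<in> borel_measurable list_borel"
    by (intro B.borel_measurable_nn_integral) simp
  show ?thesis
  proof (cases "Suc k \<le> z 0")
    case True
    have "avg k (expected_reward u v t (Suc n) z) [r] = avg k (\<lambda>xs. u + (\<integral>\<^sup>+s. ?V (xs @ [s]) \<partial>B)) [r]"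
      by (rule avg_cong) (use True in \<open>auto simp: expected_reward_Suc[OF t]\<close>)
    also have "\<dots> = u + avg (Suc k) ?V [r]"
      by (simp only: avg_add[of "\<lambda>_. u"] avg_const borel_measurable_const
          \<open>(\<lambda>xs. \<integral>\<^sup>+s. ?V (xs @ [s]) \<partial>B) \<in> borel_measurable list_borel\<close> avg_Suc_inner)
    finally show ?thesis using True by simp
  next
    case False
    have "avg k (expected_reward u v t (Suc n) z) [r] = avg k (\<lambda>xs. v + ?V xs) [r]"
      by (rule avg_cong) (use False in \<open>auto simp: expected_reward_Suc[OF t]\<close>)
    also have "\<dots> = v + avg k ?V [r]"
      by (simp add: avg_add avg_const)
    finally show ?thesis using False by simp
  qed
qed

lemma expected_reward_add:
  assumes t: "terminal t" "terminal t'"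
  shows "expected_reward (u + u') (v + v') (\<lambda>z xs. t z xs + t' z xs) n z xs =
    expected_reward u v t n z xs + expected_reward u' v' t' n z xs"
proof -
  have "(\<lambda>w. reward u v t n z w xs) \<in> borel_measurable steps" if "terminal t" for u v t
    using that unfolding terminal_def
    by (intro measurable_reward) (auto simp: measurable_cong_sets[OF refl sets_steps[symmetric]] space_PiM)
  then show ?thesis
    unfolding expected_reward_def reward_add using t by (intro nn_integral_add) auto
qed

lemma incseq_expected_reward: "incseq (\<lambda>n. expected_reward u v (\<lambda>_ _. 0) n z xs)"
  unfolding expected_reward_def incseq_def using incseq_reward
  by (auto intro!: nn_integral_mono simp: incseq_def)

definition total_reward :: "ennreal \<Rightarrow> ennreal \<Rightarrow> (nat \<Rightarrow> nat) \<Rightarrow> real list \<Rightarrow> ennreal" where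
  "total_reward u v z xs = (SUP n. expected_reward u v (\<lambda>_ _. 0) n z xs)"

lemma terminal_total_reward: "terminal (total_reward u v)"
  unfolding terminal_def
proof
  show "(\<lambda>(z, xs). total_reward u v z xs) \<in> borel_measurable (places_space \<Otimes>\<^sub>M list_borel)"
    unfolding total_reward_def split_beta'
    by (intro borel_measurable_SUP measurable_expected_reward_joint) auto
qed (simp add: total_reward_def)

lemma measurable_total_reward [measurable]: "total_reward u v z \<in> borel_measurable list_borel"
  unfolding total_reward_def[abs_def] by measurable

lemma after_gap_SUP:
  assumes "incseq F" "\<And>n. F n \<in> borel_measurable list_borel"
  shows "after_gap (\<lambda>xs. SUP n. F n xs) xs = (SUP n. after_gap (F n) xs)"
  unfolding after_gap_def using assms
  by (intro nn_integral_monotone_convergence_SUP) (auto simp: incseq_def le_fun_def)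

text \<open>
  The expectation over the state before the second arrival of a busy period; the first message finds
  the system empty and is always accepted.
\<close>

definition start :: "(real list \<Rightarrow> ennreal) \<Rightarrow> ennreal" where
  "start G = (\<integral>\<^sup>+x. after_gap G [x] \<partial>B)"

lemma start_SUP:
  assumes F: "incseq F" "\<And>n. F n \<in> borel_measurable list_borel"
  shows "start (\<lambda>xs. SUP n. F n xs) = (SUP n. start (F n))"
proof -
  note [measurable] = F(2)
  show ?thesis
    unfolding start_def after_gap_SUP[OF assms] using F(1)
    by (intro nn_integral_monotone_convergence_SUP)
      (auto simp: incseq_def le_fun_def intro!: after_gap_mono)
qed

lemma start_mono: "(\<And>xs. G xs \<le> H xs) \<Longrightarrow> start G \<le> start H"
  unfolding start_def by (intro nn_integral_mono after_gap_mono)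

lemma after_gap_add:
  assumes [measurable]: "G \<in> borel_measurable list_borel" "H \<in> borel_measurable list_borel"
  shows "after_gap (\<lambda>xs. G xs + H xs) xs = after_gap G xs + after_gap H xs"
  unfolding after_gap_def by (intro nn_integral_add) simp_all

lemma after_gap_cmult:
  assumes [measurable]: "G \<in> borel_measurable list_borel"
  shows "after_gap (\<lambda>xs. c * G xs) xs = c * after_gap G xs"
  unfolding after_gap_def by (intro nn_integral_cmult) simp_all

lemma start_add:
  assumes [measurable]: "G \<in> borel_measurable list_borel" "H \<in> borel_measurable list_borel"
  shows "start (\<lambda>xs. G xs + H xs) = start G + start H"
  unfolding start_def after_gap_add[OF assms] by (intro nn_integral_add) simp_all

lemma start_cmult:
  assumes [measurable]: "G \<in> borel_measurable list_borel"
  shows "start (\<lambda>xs. c * G xs) = c * start G"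
  unfolding start_def after_gap_cmult[OF assms] by (intro nn_integral_cmult) simp_all

section \<open>Comparison functions\<close>

text \<open>
  The integral over the current service is evaluated by \<open>nn_exponential_average_le\<close>; what remains
  to be bounded is the reward when the next message enters service.
\<close>

lemma avg_after_gap_le:
  assumes G: "G \<in> borel_measurable list_borel" "G [] = 0"
    and deriv: "\<And>k x. k \<le> K \<Longrightarrow> 0 \<le> x \<Longrightarrow> (f k has_real_derivative f' k x) (at x)"
    and cont: "\<And>k x. k \<le> K \<Longrightarrow> 0 \<le> x \<Longrightarrow> isCont (f' k) x"
    and before: "\<And>k x. k \<le> K \<Longrightarrow> 0 \<le> x \<Longrightarrow> avg k G [x] \<le> ennreal (f k x + f' k x / lam)"
    and nonneg: "\<And>k x. k \<le> K \<Longrightarrow> 0 \<le> x \<Longrightarrow> 0 \<le> f k x + f' k x / lam"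
    and f0: "\<And>k. k \<le> K \<Longrightarrow> 0 \<le> f k 0"
    and departure: "\<And>k. k < K \<Longrightarrow> (\<integral>\<^sup>+x. avg k (after_gap G) [x] \<partial>B) \<le> ennreal (f (Suc k) 0)"
    and k: "k \<le> K" and r: "0 \<le> r"
  shows "avg k (after_gap G) [r] \<le> ennreal (f k r)"
  unfolding avg_after_gap[OF G(1) r]
proof (rule nn_exponential_average_le[OF r deriv[OF k] cont[OF k] before[OF k] nonneg[OF k] f0[OF k]])
  show "avg k (after_gap G) [] \<le> ennreal (f k 0)"
    using departure[of "k - 1"] k G(2) by (cases k) (auto simp: avg_after_gap_Nil)
qed

text \<open>
  If \<open>f\<close> is superharmonic at departures, the bound at departures follows from the bound for one
  message fewer, by induction on the number of waiting messages.
\<close>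

lemma avg_after_gap_le_harmonic:
  assumes G: "G \<in> borel_measurable list_borel" "G [] = 0"
    and deriv: "\<And>k x. k \<le> K \<Longrightarrow> 0 \<le> x \<Longrightarrow> (f k has_real_derivative f' k x) (at x)"
    and cont: "\<And>k x. k \<le> K \<Longrightarrow> 0 \<le> x \<Longrightarrow> isCont (f' k) x"
    and before: "\<And>k x. k \<le> K \<Longrightarrow> 0 \<le> x \<Longrightarrow> avg k G [x] \<le> ennreal (f k x + f' k x / lam)"
    and nonneg: "\<And>k x. k \<le> K \<Longrightarrow> 0 \<le> x \<Longrightarrow> 0 \<le> f k x + f' k x / lam"
    and f0: "\<And>k. k \<le> K \<Longrightarrow> 0 \<le> f k 0"
    and departure: "\<And>k. k < K \<Longrightarrow> (\<integral>\<^sup>+x. ennreal (f k x) \<partial>B) \<le> ennreal (f (Suc k) 0)"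
  shows "k \<le> K \<Longrightarrow> 0 \<le> r \<Longrightarrow> avg k (after_gap G) [r] \<le> ennreal (f k r)"
proof (induction k arbitrary: r rule: less_induct)
  case (less k)
  show ?case
  proof (rule avg_after_gap_le[where K = k and f = f and f' = f', OF G])
    fix j assume j: "j < k"
    have "(\<integral>\<^sup>+x. avg j (after_gap G) [x] \<partial>B) \<le> (\<integral>\<^sup>+x. ennreal (f j x) \<partial>B)"
      by (intro nn_integral_mono_AE eventually_mono[OF B_nonneg]) (use less j in auto)
    also have "\<dots> \<le> ennreal (f (Suc j) 0)" using departure j less by auto
    finally show "(\<integral>\<^sup>+x. avg j (after_gap G) [x] \<partial>B) \<le> ennreal (f (Suc j) 0)" .
  qed (use less deriv cont before nonneg f0 in auto)
qed

text \<open>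
  Here negative values are harmless: \<open>ennreal\<close> truncates them at 0, and the positive part of a
  subharmonic function is subharmonic.
\<close>

lemma avg_after_gap_ge_harmonic:
  assumes G: "G \<in> borel_measurable list_borel"
    and deriv: "\<And>k x. 0 \<le> x \<Longrightarrow> (f k has_real_derivative f' k x) (at x)"
    and cont: "\<And>k x. 0 \<le> x \<Longrightarrow> isCont (f' k) x"
    and before: "\<And>k x. 0 \<le> x \<Longrightarrow> ennreal (f k x + f' k x / lam) \<le> avg k G [x]"
    and f0: "f 0 0 \<le> 0"
    and departure: "\<And>k. ennreal (f (Suc k) 0) \<le> (\<integral>\<^sup>+x. ennreal (f k x) \<partial>B)"
  shows "0 \<le> r \<Longrightarrow> ennreal (f k r) \<le> avg k (after_gap G) [r]"
proof (induction k arbitrary: r)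
  case 0
  show ?case unfolding avg_after_gap[OF G 0]
    by (rule nn_exponential_average_ge[OF 0 deriv cont before]) (use f0 in \<open>simp_all add: ennreal_neg\<close>)
next
  case (Suc k)
  show ?case unfolding avg_after_gap[OF G Suc.prems]
  proof (rule nn_exponential_average_ge[OF Suc.prems deriv cont before])
    have "ennreal (f (Suc k) 0) \<le> (\<integral>\<^sup>+x. ennreal (f k x) \<partial>B)" by (rule departure)
    also have "\<dots> \<le> (\<integral>\<^sup>+x. avg k (after_gap G) [x] \<partial>B)"
      by (intro nn_integral_mono_AE eventually_mono[OF B_nonneg]) (use Suc in auto)
    finally show "ennreal (f (Suc k) 0) \<le> avg (Suc k) (after_gap G) []" by simp
  qed
qed

text \<open>
  Needed for terminal rewards whose bound holds only on average over the unrevealed services.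
\<close>

lemma avg_after_gap_mono:
  assumes G: "G \<in> borel_measurable list_borel" and H: "H \<in> borel_measurable list_borel"
    and before: "\<And>k x. k \<le> K \<Longrightarrow> 0 \<le> x \<Longrightarrow> avg k G [x] \<le> c * avg k H [x]"
    and Nil: "G [] \<le> c * H []"
  shows "k \<le> K \<Longrightarrow> 0 \<le> r \<Longrightarrow> avg k (after_gap G) [r] \<le> c * avg k (after_gap H) [r]"
proof (induction k arbitrary: r)
  have int: "(\<integral>\<^sup>+a\<in>{0..r}. ennreal (lam * exp (- lam * a)) * avg k G [r - a] \<partial>lborel) \<le>
      c * (\<integral>\<^sup>+a\<in>{0..r}. ennreal (lam * exp (- lam * a)) * avg k H [r - a] \<partial>lborel)"
    if k: "k \<le> K" for k r
  proof -
    note [measurable] = G H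
    have "(\<lambda>a. avg k H [r - a]) \<in> borel_measurable lborel" by simp
    then have "c * (\<integral>\<^sup>+a\<in>{0..r}. ennreal (lam * exp (- lam * a)) * avg k H [r - a] \<partial>lborel) =
       (\<integral>\<^sup>+a. c * (ennreal (lam * exp (- lam * a)) * avg k H [r - a] * indicator {0..r} a) \<partial>lborel)"
      by (intro nn_integral_cmult[symmetric]) simp
    moreover have "(\<integral>\<^sup>+a\<in>{0..r}. ennreal (lam * exp (- lam * a)) * avg k G [r - a] \<partial>lborel) \<le> \<dots>"
    proof (intro nn_integral_mono)
      fix a
      show "ennreal (lam * exp (- lam * a)) * avg k G [r - a] * indicator {0..r} a
        \<le> c * (ennreal (lam * exp (- lam * a)) * avg k H [r - a] * indicator {0..r} a)"
      proof (cases "a \<in> {0..r}")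
        case True
        then have "ennreal (lam * exp (- lam * a)) * avg k G [r - a] \<le>
            ennreal (lam * exp (- lam * a)) * (c * avg k H [r - a])"
          by (intro mult_left_mono before k) auto
        then show ?thesis using True by (simp add: mult_ac)
      qed simp
    qed
    ultimately show ?thesis by simp
  qed
  {
    case 0
    show ?case unfolding avg_after_gap[OF G 0(2)] avg_after_gap[OF H 0(2)]
      using int[of 0 r] Nil
      by (auto simp: distrib_left mult.left_commute[of c] intro!: add_mono mult_left_mono)
  next
    case (Suc k)
    note [measurable] = G H
    have "(\<integral>\<^sup>+x. avg k (after_gap G) [x] \<partial>B) \<le> (\<integral>\<^sup>+x. c * avg k (after_gap H) [x] \<partial>B)"
      by (intro nn_integral_mono_AE eventually_mono[OF B_nonneg]) (use Suc in auto)
    also have "\<dots> = c * (\<integral>\<^sup>+x. avg k (after_gap H) [x] \<partial>B)"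
      by (intro nn_integral_cmult) simp
    finally have "avg (Suc k) (after_gap G) [] \<le> c * avg (Suc k) (after_gap H) []" by simp
    then show ?case unfolding avg_after_gap[OF G Suc.prems(2)] avg_after_gap[OF H Suc.prems(2)]
      using int[of "Suc k" r] Suc.prems
      by (auto simp: distrib_left mult.left_commute[of c] simp del: avg.simps intro!: add_mono mult_left_mono)
  }
qed

end

section \<open>Elementary bounds for the exponential function\<close>

lemma exp_minus_le:
  fixes x :: real assumes x: "0 \<le> x"
  shows "exp (- x) \<le> 1 - x + x\<^sup>2 / 2"
proof -
  have "1 - 0 + 0\<^sup>2 / 2 - exp (- 0) \<le> 1 - x + x\<^sup>2 / 2 - exp (- x)"
  proof (rule DERIV_nonneg_imp_nondecreasing[OF x])
    fix y :: real
    have "((\<lambda>x. 1 - x + x\<^sup>2 / 2 - exp (- x)) has_real_derivative - 1 + y + exp (- y)) (at y)"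
      by (auto intro!: derivative_eq_intros)
    moreover have "0 \<le> - 1 + y + exp (- y)" using exp_ge_add_one_self[of "- y"] by simp
    ultimately show "\<exists>d. ((\<lambda>x. 1 - x + x\<^sup>2 / 2 - exp (- x)) has_real_derivative d) (at y) \<and> 0 \<le> d"
      by blast
  qed
  then show ?thesis by simp
qed

lemma saturation_ge:
  fixes c y :: real assumes "0 < c" "0 \<le> y"
  shows "y - y\<^sup>2 / 2 / c \<le> c * (1 - exp (- y / c))"
proof -
  have "c * exp (- (y / c)) \<le> c * (1 - y / c + (y / c)\<^sup>2 / 2)"
    using assms by (intro mult_left_mono exp_minus_le) auto
  also have "\<dots> = c - y + y\<^sup>2 / 2 / c"
    using assms by (simp add: field_simps power2_eq_square)
  finally show ?thesis by (simp add: right_diff_distrib)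
qed

lemma exp_minus_ge:
  fixes x :: real assumes x: "0 \<le> x"
  shows "1 - x + x\<^sup>2 / 2 - x ^ 3 / 6 \<le> exp (- x)"
proof -
  have "exp (- 0) - (1 - 0 + 0\<^sup>2 / 2 - 0 ^ 3 / 6) \<le> exp (- x) - (1 - x + x\<^sup>2 / 2 - x ^ 3 / 6)"
  proof (rule DERIV_nonneg_imp_nondecreasing[OF x])
    fix y :: real assume "0 \<le> y"
    have "((\<lambda>x. exp (- x) - (1 - x + x\<^sup>2 / 2 - x ^ 3 / 6)) has_real_derivative 1 - y + y\<^sup>2 / 2 - exp (- y)) (at y)"
      by (auto intro!: derivative_eq_intros simp: power2_eq_square)
    moreover have "0 \<le> 1 - y + y\<^sup>2 / 2 - exp (- y)" using exp_minus_le[OF \<open>0 \<le> y\<close>] by simp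
    ultimately show "\<exists>d. ((\<lambda>x. exp (- x) - (1 - x + x\<^sup>2 / 2 - x ^ 3 / 6)) has_real_derivative d) (at y) \<and> 0 \<le> d"
      by blast
  qed
  then show ?thesis by simp
qed

context single_server
begin

section \<open>Counting arrivals: the Wald identity\<close>

definition step :: "nat \<Rightarrow> (real list \<Rightarrow> ennreal) \<Rightarrow> real list \<Rightarrow> ennreal" where
  "step m G xs = (if length xs \<le> m then \<integral>\<^sup>+s. after_gap G (xs @ [s]) \<partial>B else after_gap G xs)"

lemma expected_reward_step:
  "terminal t \<Longrightarrow> xs \<noteq> [] \<Longrightarrow> expected_reward u v t (Suc n) z xs =
    (if length xs \<le> z 0 then u else v) + step (z 0) (expected_reward u v t n (\<lambda>i. z (Suc i))) xs"
  by (simp add: expected_reward_Suc step_def)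

lemma step_add:
  assumes [measurable]: "G \<in> borel_measurable list_borel" "H \<in> borel_measurable list_borel"
  shows "step m (\<lambda>xs. G xs + H xs) xs = step m G xs + step m H xs"
  unfolding step_def after_gap_add[OF assms] by (simp add: nn_integral_add)

lemma step_cmult:
  assumes [measurable]: "G \<in> borel_measurable list_borel"
  shows "step m (\<lambda>xs. c * G xs) xs = c * step m G xs"
  unfolding step_def after_gap_cmult[OF assms] by (simp add: nn_integral_cmult)

lemma step_SUP:
  assumes F: "incseq F" "\<And>n. F n \<in> borel_measurable list_borel"
  shows "step m (\<lambda>xs. SUP n. F n xs) xs = (SUP n. step m (F n) xs)"
proof -
  note [measurable] = F(2)
  have "(\<integral>\<^sup>+s. (SUP n. after_gap (F n) (xs @ [s])) \<partial>B) = (SUP n. \<integral>\<^sup>+s. after_gap (F n) (xs @ [s]) \<partial>B)"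
    using F(1) by (intro nn_integral_monotone_convergence_SUP)
      (auto simp: incseq_def le_fun_def intro!: after_gap_mono)
  then show ?thesis by (simp add: step_def after_gap_SUP[OF F])
qed

abbreviation nonneg :: "real list \<Rightarrow> bool" where
  "nonneg xs \<equiv> list_all (\<lambda>x. 0 \<le> x) xs"

lemma after_gap_mono_nonneg:
  "(\<And>xs. nonneg xs \<Longrightarrow> G xs \<le> H xs) \<Longrightarrow> nonneg ys \<Longrightarrow> after_gap G ys \<le> after_gap H ys"
  unfolding after_gap_def by (intro nn_integral_mono) (auto intro: advance_nonneg)

lemma step_mono_nonneg:
  assumes "\<And>xs. nonneg xs \<Longrightarrow> G xs \<le> H xs" "nonneg ys"
  shows "step m G ys \<le> step m H ys"
  unfolding step_def using assms
  by (auto intro!: nn_integral_mono_AE eventually_mono[OF B_nonneg] after_gap_mono_nonneg)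

lemma step_cong_nonneg:
  "(\<And>xs. nonneg xs \<Longrightarrow> G xs = H xs) \<Longrightarrow> nonneg ys \<Longrightarrow> step m G ys = step m H ys"
  by (intro antisym step_mono_nonneg) auto

lemma step_const: "step m (\<lambda>_. c) xs = c"
  by (simp add: step_def after_gap_def)

lemma start_mono_nonneg:
  assumes "\<And>xs. nonneg xs \<Longrightarrow> G xs \<le> H xs"
  shows "start G \<le> start H"
  unfolding start_def using assms
  by (auto intro!: nn_integral_mono_AE eventually_mono[OF B_nonneg] after_gap_mono_nonneg)

lemma start_cong_nonneg:
  "(\<And>xs. nonneg xs \<Longrightarrow> G xs = H xs) \<Longrightarrow> start G = start H"
  by (intro antisym start_mono_nonneg) auto

lemma total_reward_step:
  assumes "xs \<noteq> []"
  shows "total_reward u v z xs =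
    (if length xs \<le> z 0 then u else v) + step (z 0) (total_reward u v (\<lambda>i. z (Suc i))) xs"
proof -
  let ?E = "expected_reward u v (\<lambda>_ _. 0)"
  have "total_reward u v z xs = (SUP n. ?E (Suc n) z xs)"
    unfolding total_reward_def
    by (intro antisym SUP_mono' SUP_least SUP_upper incseq_SucD[OF incseq_expected_reward] UNIV_I)
  also have "\<dots> = (if length xs \<le> z 0 then u else v) + (SUP n. step (z 0) (?E n (\<lambda>i. z (Suc i))) xs)"
    using assms by (simp add: expected_reward_step ennreal_SUP_add_right)
  also have "(SUP n. step (z 0) (?E n (\<lambda>i. z (Suc i))) xs) = step (z 0) (total_reward u v (\<lambda>i. z (Suc i))) xs"
    unfolding total_reward_def[abs_def]
    by (rule step_SUP[symmetric])
      (auto simp: incseq_def le_fun_def intro: incseqD[OF incseq_expected_reward])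
  finally show ?thesis .
qed

lemma expected_reward_total_reward:
  "expected_reward u v (total_reward u v) n z xs = total_reward u v z xs"
proof (induction n arbitrary: z xs)
  case (Suc n)
  note IH = ext[OF Suc]
  show ?case
  proof (cases "xs = []")
    case True
    then show ?thesis using terminal_total_reward[of u v] by (simp add: terminal_def terminal_total_reward)
  next
    case False
    show ?thesis
      unfolding expected_reward_step[OF terminal_total_reward False] total_reward_step[OF False] IH ..
  qed
qed simp

lemma total_reward_split:
  "total_reward u v z xs = expected_reward u v (\<lambda>_ _. 0) n z xs
     + expected_reward 0 0 (total_reward u v) n z xs"
  using expected_reward_add[OF terminal_zero terminal_total_reward, of u 0 v 0 u v n z xs]
  by (simp add: expected_reward_total_reward)

text \<open>
  The probability that the busy period is still going on after \<open>n\<close> more arrivals.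
\<close>

definition alive :: "nat \<Rightarrow> (nat \<Rightarrow> nat) \<Rightarrow> real list \<Rightarrow> ennreal" where
  "alive = expected_reward 0 0 (\<lambda>_ xs. if xs = [] then 0 else 1)"

lemma measurable_alive [measurable]: "alive n z \<in> borel_measurable list_borel"
  unfolding alive_def by (intro measurable_expected_reward terminal_nonempty)

lemma alive_Suc: "xs \<noteq> [] \<Longrightarrow> alive (Suc n) z xs = step (z 0) (alive n (\<lambda>i. z (Suc i))) xs"
  by (simp add: alive_def expected_reward_step[OF terminal_nonempty])

lemma alive_Nil: "alive n z [] = 0"
  by (simp add: alive_def terminal_nonempty)

lemma alive_le_1: "alive n z xs \<le> 1"
proof (induction n arbitrary: z xs)
  case (Suc n)
  have "step (z 0) (alive n (\<lambda>i. z (Suc i))) xs \<le> step (z 0) (\<lambda>_. 1) xs"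
    unfolding step_def by (auto intro!: nn_integral_mono after_gap_mono Suc)
  then show ?case by (cases "xs = []") (simp_all add: alive_Suc alive_Nil step_const)
qed (simp add: alive_def)

text \<open>
  Markov's inequality: a busy period that survives \<open>n\<close> arrivals contains at least \<open>n\<close> of them.
\<close>

lemma alive_le_arrivals: "of_nat n * alive n z xs \<le> expected_reward 1 1 (\<lambda>_ _. 0) n z xs"
proof (induction n arbitrary: z xs)
  case (Suc n)
  show ?case
  proof (cases "xs = []")
    case False
    let ?z = "\<lambda>i. z (Suc i)"
    have "of_nat (Suc n) * alive (Suc n) z xs = alive (Suc n) z xs + step (z 0) (\<lambda>xs. of_nat n * alive n ?z xs) xs"
      using False by (simp add: step_cmult alive_Suc distrib_right)
    also have "\<dots> \<le> 1 + step (z 0) (expected_reward 1 1 (\<lambda>_ _. 0) n ?z) xs"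
      unfolding step_def
      by (intro add_mono alive_le_1) (auto intro!: nn_integral_mono after_gap_mono Suc)
    also have "\<dots> = expected_reward 1 1 (\<lambda>_ _. 0) (Suc n) z xs"
      using False by (simp add: expected_reward_step)
    finally show ?thesis .
  qed (simp add: alive_Nil)
qed simp

text \<open>
  The workload measured in mean interarrival times, plus 1 in a nonempty system.  The
  summand 1 accounts for the arrival at which the state is observed; with it, the expected
  change per arrival is exactly \<open>rho\<close> per accepted message minus 1.
\<close>

definition backlog :: "real list \<Rightarrow> ennreal" where
  "backlog xs = ennreal (lam * sum_list xs) + (if xs = [] then 0 else 1)"

lemma measurable_backlog [measurable]: "backlog \<in> borel_measurable list_borel"
  unfolding backlog_def[abs_def] by measurable

lemma terminal_backlog: "terminal (\<lambda>_. backlog)"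
  by (auto simp: terminal_def backlog_def split_beta')

lemma nonneg_sum_list: "nonneg xs \<Longrightarrow> 0 \<le> sum_list xs"
  by (simp add: list_all_iff sum_list_nonneg)

text \<open>
  Until the next arrival the workload \<open>w\<close> decreases by the minimum of \<open>w\<close> and an
  exponential time, of mean \<open>(1 - exp (- lam * w)) / lam\<close>, and the system is nonempty at that
  arrival with probability \<open>1 - exp (- lam * w)\<close>: the two effects cancel.
\<close>

lemma after_gap_backlog: "nonneg xs \<Longrightarrow> after_gap backlog xs = ennreal (lam * sum_list xs)"
proof (induction xs)
  case Nil then show ?case by (simp add: backlog_def)
next
  case (Cons r xs)
  let ?f = "\<lambda>x. lam * (x + sum_list xs)"
  have r: "0 \<le> r" and xs: "nonneg xs" using Cons.prems by auto
  have IH: "after_gap backlog xs = ennreal (?f 0)" using Cons by simp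
  have d: "(?f has_real_derivative lam) (at x)" for x
    by (auto intro!: derivative_eq_intros)
  have g: "backlog (x # xs) = ennreal (?f x + lam / lam)" if "0 \<le> x" for x
    using lam_pos that nonneg_sum_list[OF xs] by (simp add: backlog_def)
  have "after_gap backlog (r # xs) = ennreal (?f r)"
    unfolding after_gap_Cons[OF measurable_backlog r] IH
    by (intro antisym nn_exponential_average_le[where g = "\<lambda>x. backlog (x # xs)" and f = ?f and f' = "\<lambda>_. lam"]
        nn_exponential_average_ge[where g = "\<lambda>x. backlog (x # xs)" and f = ?f and f' = "\<lambda>_. lam"])
      (use r d g lam_pos nonneg_sum_list[OF xs] in auto)
  then show ?case by simp
qed

text \<open>
  The function \<open>\<alpha> * (1 - exp (- y / \<alpha>))\<close> of the workload \<open>y\<close> has slope at most 1 and is increasing, so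
  between arrivals it loses on average no more than the unit that a nonempty system adds, and acceptances only
  increase it.  It is bounded, so that what it contributes after \<open>n\<close> arrivals is controlled by
  the probability that the busy period survives, and it increases to \<open>y\<close> as \<open>\<alpha>\<close> grows.
\<close>

lemma saturated_backlog_le:
  assumes \<alpha>: "\<alpha> > 0" and xs: "nonneg xs"
  shows "ennreal (\<alpha> * (1 - exp (- (lam * sum_list xs) / \<alpha>))) + (if xs = [] then 0 else 1)
    \<le> expected_reward 1 1 (\<lambda>_ _. 0) n z xs + ennreal (\<alpha> + 1) * alive n z xs"
  using xs
proof (induction n arbitrary: z xs)
  case 0
  have "\<alpha> * (1 - exp (- (lam * sum_list xs) / \<alpha>)) \<le> \<alpha>"
    using \<alpha> by (simp add: mult_le_cancel_left1)
  then have "ennreal (\<alpha> * (1 - exp (- (lam * sum_list xs) / \<alpha>))) + 1 \<le> ennreal \<alpha> + 1"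
    by (intro add_right_mono ennreal_leI)
  then show ?case
    using \<alpha> by (cases "xs = []") (simp_all add: alive_def)
next
  case (Suc n)
  define v where "v = (\<lambda>y. \<alpha> * (1 - exp (- (lam * y) / \<alpha>)))"
  define G where "G = (\<lambda>ys. ennreal (v (sum_list ys)) + (if ys = [] then 0 else 1))"
  let ?z = "\<lambda>i. z (Suc i)"
  have v_mono: "v x \<le> v y" if "x \<le> y" for x y
    using that \<alpha> lam_pos unfolding v_def by (simp add: divide_le_cancel)
  have v0: "v 0 = 0" by (simp add: v_def)
  have v_nn: "0 \<le> v y" if "0 \<le> y" for y using v_mono[OF that] v0 by simp
  have [measurable]: "G \<in> borel_measurable list_borel"
    unfolding G_def v_def by measurable
  have gap_G: "ennreal (v (sum_list ys)) \<le> after_gap G ys" if "nonneg ys" for ys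
    using that
  proof (induction ys)
    case Nil then show ?case by (simp add: v0)
  next
    case (Cons r ys)
    have r: "0 \<le> r" and ys: "nonneg ys" using Cons.prems by auto
    let ?f = "\<lambda>x. v (x + sum_list ys)"
    let ?f' = "\<lambda>x. lam * exp (- (lam * (x + sum_list ys)) / \<alpha>)"
    have d: "(?f has_real_derivative ?f' x) (at x)" for x
      unfolding v_def using \<alpha> by (auto intro!: derivative_eq_intros)
    have g: "ennreal (?f x + ?f' x / lam) \<le> G (x # ys)" if "0 \<le> x" for x
    proof -
      have "?f' x / lam \<le> 1" using lam_pos \<alpha> that nonneg_sum_list[OF ys] by simp
      then have "ennreal (?f x + ?f' x / lam) \<le> ennreal (?f x + 1)" by (intro ennreal_leI) simp
      also have "\<dots> = G (x # ys)"
        using v_nn[of "x + sum_list ys"] that nonneg_sum_list[OF ys] by (simp add: G_def)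
      finally show ?thesis .
    qed
    have "ennreal (?f r) \<le> after_gap G (r # ys)"
      unfolding after_gap_Cons[OF \<open>G \<in> borel_measurable list_borel\<close> r]
      by (rule nn_exponential_average_ge[where g = "\<lambda>x. G (x # ys)", OF r d _ g])
        (use Cons.IH ys \<alpha> in \<open>auto intro!: continuous_intros\<close>)
    then show ?case by simp
  qed
  show ?case
  proof (cases "xs = []")
    case False
    have "ennreal (v (sum_list xs)) \<le> step (z 0) G xs"
    proof (cases "length xs \<le> z 0")
      case True
      have "ennreal (v (sum_list xs)) = (\<integral>\<^sup>+s. ennreal (v (sum_list xs)) \<partial>B)" by simp
      also have "\<dots> \<le> (\<integral>\<^sup>+s. after_gap G (xs @ [s]) \<partial>B)"
      proof (intro nn_integral_mono_AE eventually_mono[OF B_nonneg])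
        fix s :: real assume "0 \<le> s"
        then show "ennreal (v (sum_list xs)) \<le> after_gap G (xs @ [s])"
          using gap_G[of "xs @ [s]"] Suc.prems
          by (intro order_trans[OF ennreal_leI[OF v_mono] gap_G]) auto
      qed
      finally show ?thesis using True by (simp add: step_def)
    qed (simp add: step_def gap_G Suc.prems)
    also have "\<dots> \<le> step (z 0) (\<lambda>xs. expected_reward 1 1 (\<lambda>_ _. 0) n ?z xs + ennreal (\<alpha> + 1) * alive n ?z xs) xs"
      by (rule step_mono_nonneg[OF _ Suc.prems]) (use Suc.IH in \<open>auto simp: G_def v_def\<close>)
    also have "\<dots> = step (z 0) (expected_reward 1 1 (\<lambda>_ _. 0) n ?z) xs + ennreal (\<alpha> + 1) * alive (Suc n) z xs"
      using False by (simp add: step_add step_cmult alive_Suc)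
    finally have "ennreal (v (sum_list xs)) + 1 \<le>
        step (z 0) (expected_reward 1 1 (\<lambda>_ _. 0) n ?z) xs + ennreal (\<alpha> + 1) * alive (Suc n) z xs + 1"
      by (rule add_right_mono)
    then show ?thesis
      using False by (simp add: expected_reward_step v_def ac_simps)
  qed simp
qed

text \<open>
  On average at least as many messages arrive in the rest of the busy period as during the
  work already present.
\<close>

lemma backlog_le_arrivals:
  assumes xs: "nonneg xs"
  shows "backlog xs \<le> total_reward 1 1 z xs"
proof (cases "xs = [] \<or> total_reward 1 1 z xs = \<top>")
  case True then show ?thesis by (auto simp: backlog_def)
next
  case False
  let ?K = "total_reward 1 1 z xs"
  let ?y = "lam * sum_list xs"
  from False obtain K where K: "?K = ennreal K" "0 \<le> K" by (cases ?K) auto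
  have "\<alpha> * (1 - exp (- ?y / \<alpha>)) + 1 \<le> K" if \<alpha>: "\<alpha> > 0" for \<alpha>
  proof -
    have y: "0 \<le> ?y" using lam_pos nonneg_sum_list[OF xs] by simp
    have nn: "0 \<le> \<alpha> * (1 - exp (- ?y / \<alpha>))" using \<alpha> y by simp
    have "\<alpha> * (1 - exp (- ?y / \<alpha>)) + 1 \<le> K + (\<alpha> + 1) * K / real (Suc n)" for n
    proof -
      have EK: "expected_reward 1 1 (\<lambda>_ _. 0) m z xs \<le> ennreal K" for m
        unfolding K(1)[symmetric] total_reward_def by (rule SUP_upper) simp
      have "of_nat (Suc n) * alive (Suc n) z xs \<le> ennreal K"
        using alive_le_arrivals EK order_trans by blast
      moreover obtain q where q: "alive (Suc n) z xs = ennreal q" "0 \<le> q"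
        using alive_le_1[of "Suc n" z xs] by (cases "alive (Suc n) z xs") (auto simp: top_unique)
      ultimately have "real (Suc n) * q \<le> K"
        using K(2) by (simp add: ennreal_of_nat_eq_real_of_nat ennreal_mult'[symmetric] del: of_nat_Suc)
      then have q_le: "q \<le> K / real (Suc n)" by (simp add: field_simps del: of_nat_Suc)
      have "ennreal (\<alpha> * (1 - exp (- ?y / \<alpha>))) + 1 \<le> ennreal K + ennreal (\<alpha> + 1) * alive (Suc n) z xs"
        using saturated_backlog_le[OF \<alpha> xs, of "Suc n" z] False EK[of "Suc n"]
        by (auto intro: order_trans add_right_mono)
      then have "ennreal (\<alpha> * (1 - exp (- ?y / \<alpha>)) + 1) \<le> ennreal (K + (\<alpha> + 1) * q)"
        using nn K(2) q \<alpha> by (simp add: ennreal_mult)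
      then have "\<alpha> * (1 - exp (- ?y / \<alpha>)) + 1 \<le> K + (\<alpha> + 1) * q"
        using K(2) q \<alpha> by (subst (asm) ennreal_le_iff) auto
      also have "\<dots> \<le> K + (\<alpha> + 1) * (K / real (Suc n))"
        using \<alpha> by (intro add_left_mono mult_left_mono q_le) auto
      finally show ?thesis by simp
    qed
    moreover have "(\<lambda>n. K + (\<alpha> + 1) * K / real (Suc n)) \<longlonglongrightarrow> K + 0"
      by (intro tendsto_add tendsto_const lim_const_over_n[THEN LIMSEQ_Suc])
    ultimately show ?thesis
      using LIMSEQ_le_const by fastforce
  qed
  note sat = this
  have "?y - ?y\<^sup>2 / 2 / real (Suc n) + 1 \<le> K" for n
  proof -
    have "?y - ?y\<^sup>2 / 2 / real (Suc n) \<le> real (Suc n) * (1 - exp (- ?y / real (Suc n)))"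
      by (rule saturation_ge) (use lam_pos nonneg_sum_list[OF xs] in auto)
    with sat[of "real (Suc n)"] show ?thesis by simp
  qed
  moreover have "(\<lambda>n. ?y - ?y\<^sup>2 / 2 / real (Suc n) + 1) \<longlonglongrightarrow> ?y - 0 + 1"
    by (intro tendsto_add tendsto_diff tendsto_const lim_const_over_n[THEN LIMSEQ_Suc])
  ultimately have "?y + 1 \<le> K"
    by (metis (no_types, lifting) LIMSEQ_le_const2 diff_zero)
  then show ?thesis
    using False K lam_pos nonneg_sum_list[OF xs] by (auto simp: backlog_def ennreal_plus[symmetric] ennreal_1[symmetric] simp del: ennreal_plus ennreal_1)
qed

lemma nn_integral_load:
  assumes "integrable B (\<lambda>x. x)"
  shows "(\<integral>\<^sup>+s. ennreal (lam * s) \<partial>B) = ennreal (rho 1 lam B)"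
proof -
  have "AE s in B. 0 \<le> lam * s"
    using B_nonneg by eventually_elim (use lam_pos in simp)
  then show ?thesis
    using nn_integral_eq_integral[of B "\<lambda>s. lam * s"] assms by (simp add: rho_def)
qed

text \<open>
  Wald's identity stopped after \<open>n\<close> arrivals.
\<close>

lemma arrivals_balance:
  assumes int: "integrable B (\<lambda>x. x)" and xs: "nonneg xs"
  shows "backlog xs + ennreal (rho 1 lam B) * expected_reward 1 0 (\<lambda>_ _. 0) n z xs =
    expected_reward 1 1 (\<lambda>_ _. 0) n z xs + expected_reward 0 0 (\<lambda>_. backlog) n z xs"
  using xs
proof (induction n arbitrary: z xs)
  case (Suc n)
  let ?z = "\<lambda>i. z (Suc i)" and ?r = "ennreal (rho 1 lam B)"
  note [measurable] = terminal_backlog[THEN measurable_expected_reward]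
  show ?case
  proof (cases "xs = []")
    case True
    have "backlog [] = 0" by (simp add: backlog_def)
    then show ?thesis using True by (simp add: expected_reward_Nil[OF terminal_backlog])
  next
    case False
    have sB: "step (z 0) backlog xs = ennreal (lam * sum_list xs) + (if length xs \<le> z 0 then ?r else 0)"
    proof (cases "length xs \<le> z 0")
      case True
      have ag: "after_gap backlog (xs @ [s]) = ennreal (lam * sum_list xs) + ennreal (lam * s)" if "0 \<le> s" for s
        using after_gap_backlog[of "xs @ [s]"] Suc.prems that lam_pos nonneg_sum_list[OF Suc.prems]
        by (simp add: distrib_left)
      have "(\<integral>\<^sup>+s. after_gap backlog (xs @ [s]) \<partial>B) =
          (\<integral>\<^sup>+s. ennreal (lam * sum_list xs) + ennreal (lam * s) \<partial>B)"
        by (intro nn_integral_cong_AE eventually_mono[OF B_nonneg]) (auto simp: ag)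
      also have "\<dots> = ennreal (lam * sum_list xs) + (\<integral>\<^sup>+s. ennreal (lam * s) \<partial>B)"
        by (subst nn_integral_add) auto
      also have "(\<integral>\<^sup>+s. ennreal (lam * s) \<partial>B) = ?r"
        by (rule nn_integral_load[OF int])
      finally show ?thesis using True by (simp add: step_def)
    qed (simp add: step_def after_gap_backlog Suc.prems)
    have "step (z 0) (\<lambda>xs. backlog xs + ?r * expected_reward 1 0 (\<lambda>_ _. 0) n ?z xs) xs =
       step (z 0) (\<lambda>xs. expected_reward 1 1 (\<lambda>_ _. 0) n ?z xs + expected_reward 0 0 (\<lambda>_. backlog) n ?z xs) xs"
      by (rule step_cong_nonneg[OF Suc.IH Suc.prems])
    then have "step (z 0) backlog xs + ?r * step (z 0) (expected_reward 1 0 (\<lambda>_ _. 0) n ?z) xs =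
       step (z 0) (expected_reward 1 1 (\<lambda>_ _. 0) n ?z) xs + step (z 0) (expected_reward 0 0 (\<lambda>_. backlog) n ?z) xs"
      by (simp add: step_add step_cmult)
    moreover have bx: "backlog xs = ennreal (lam * sum_list xs) + 1"
      using False by (simp add: backlog_def)
    ultimately show ?thesis
      using False
      by (simp only: expected_reward_step[OF terminal_zero False] expected_reward_step[OF terminal_backlog False] sB)
        (cases "length xs \<le> z 0"; simp add: bx distrib_left ac_simps del: One_nat_def)
  qed
qed simp

text \<open>
  Wald's identity for the whole busy period.  The term left over after \<open>n\<close> arrivals is at most
  the expected number of arrivals after the first \<open>n\<close>, so that term and the arrivals
  already counted never exceed the total.
\<close>

theorem start_arrivals:
  assumes int: "integrable B (\<lambda>x. x)"
  shows "start (total_reward 1 1 z) = ennreal (rho 1 lam B) + ennreal (rho 1 lam B) * start (total_reward 1 0 z)"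
proof -
  let ?r = "ennreal (rho 1 lam B)"
  let ?K = "\<lambda>n. expected_reward 1 1 (\<lambda>_ _. 0) n z" and ?P = "\<lambda>n. expected_reward 1 0 (\<lambda>_ _. 0) n z"
  note [measurable] = terminal_backlog[THEN measurable_expected_reward]
    terminal_total_reward[THEN measurable_expected_reward]
  have sB: "start backlog = ?r"
  proof -
    have "start backlog = (\<integral>\<^sup>+s. ennreal (lam * s) \<partial>B)"
      unfolding start_def by (intro nn_integral_cong_AE eventually_mono[OF B_nonneg]) (auto simp: after_gap_backlog)
    also have "\<dots> = ?r"
      by (rule nn_integral_load[OF int])
    finally show ?thesis .
  qed
  have bal: "?r + ?r * start (?P n) = start (?K n) + start (expected_reward 0 0 (\<lambda>_. backlog) n z)" for n
  proof -
    have "start (\<lambda>xs. backlog xs + ?r * ?P n xs) =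
        start (\<lambda>xs. ?K n xs + expected_reward 0 0 (\<lambda>_. backlog) n z xs)"
      by (rule start_cong_nonneg[OF arrivals_balance[OF int]])
    then show ?thesis by (simp add: start_add start_cmult sB)
  qed
  have SUPs: "start (total_reward u v z) = (SUP n. start (expected_reward u v (\<lambda>_ _. 0) n z))" for u v
    unfolding total_reward_def[abs_def]
    by (rule start_SUP) (auto simp: incseq_def le_fun_def intro: incseqD[OF incseq_expected_reward])
  show ?thesis
  proof (rule antisym)
    have "start (?K n) \<le> ?r + ?r * start (?P n)" for n
      unfolding bal by simp
    also have "?r + ?r * start (?P n) \<le> ?r + ?r * start (total_reward 1 0 z)" for n
      unfolding SUPs by (intro add_left_mono mult_left_mono SUP_upper) auto
    finally show "start (total_reward 1 1 z) \<le> ?r + ?r * start (total_reward 1 0 z)"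
      unfolding SUPs[of 1 1] by (intro SUP_least)
  next
    have mono: "expected_reward 0 0 (\<lambda>_. backlog) n z xs \<le> expected_reward 0 0 (total_reward 1 1) n z xs"
      if "nonneg xs" for n z xs
      using that
    proof (induction n arbitrary: z xs)
      case 0 then show ?case by (simp add: backlog_le_arrivals)
    next
      case (Suc n)
      show ?case
        by (cases "xs = []")
          (use Suc in \<open>auto simp: terminal_backlog terminal_total_reward expected_reward_step intro!: step_mono_nonneg\<close>)
    qed
    have "?r + ?r * start (?P n) \<le> start (total_reward 1 1 z)" for n
    proof -
      have "start (total_reward 1 1 z) = start (?K n) + start (expected_reward 0 0 (total_reward 1 1) n z)"
        by (subst start_add[symmetric]) (auto simp: total_reward_split[symmetric] intro!: arg_cong[where f = start] terminal_total_reward)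
      moreover have "start (expected_reward 0 0 (\<lambda>_. backlog) n z) \<le> start (expected_reward 0 0 (total_reward 1 1) n z)"
        by (rule start_mono_nonneg[OF mono])
      ultimately show ?thesis unfolding bal by (simp add: add_left_mono)
    qed
    moreover have "?r + ?r * start (total_reward 1 0 z) = (SUP n. ?r + ?r * start (?P n))"
      by (simp add: SUPs ennreal_SUP_add_right SUP_mult_left_ennreal)
    ultimately show "?r + ?r * start (total_reward 1 0 z) \<le> start (total_reward 1 1 z)"
      by (simp add: SUP_least)
  qed
qed

lemma start_alive_le:
  assumes int: "integrable B (\<lambda>x. x)"
  shows "of_nat n * start (alive n z) \<le> ennreal (rho 1 lam B) + ennreal (rho 1 lam B) * start (total_reward 1 0 z)"
proof -
  have "of_nat n * start (alive n z) = start (\<lambda>xs. of_nat n * alive n z xs)"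
    by (simp add: start_cmult)
  also have "\<dots> \<le> start (total_reward 1 1 z)"
    unfolding total_reward_def
    by (intro start_mono order_trans[OF alive_le_arrivals] SUP_upper) simp
  finally show ?thesis by (simp add: start_arrivals[OF int])
qed

end

section \<open>Bounds for the number of processed messages\<close>

lemma ennreal_integral_le:
  assumes int: "integrable M f"
  shows "ennreal (integral\<^sup>L M f) \<le> (\<integral>\<^sup>+x. ennreal (f x) \<partial>M)"
proof -
  have "integral\<^sup>L M f \<le> integral\<^sup>L M (\<lambda>x. max 0 (f x))"
    using int by (intro integral_mono) auto
  then have "ennreal (integral\<^sup>L M f) \<le> ennreal (integral\<^sup>L M (\<lambda>x. max 0 (f x)))"
    by (rule ennreal_leI)
  also have "\<dots> = (\<integral>\<^sup>+x. ennreal (max 0 (f x)) \<partial>M)"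
    using int by (intro nn_integral_eq_integral[symmetric]) auto
  finally show ?thesis by (simp add: ennreal_max_0)
qed

lemma (in single_server) avg_SUP:
  assumes F: "incseq F" "\<And>n. F n \<in> borel_measurable list_borel"
  shows "avg k (\<lambda>xs. SUP n. F n xs) xs = (SUP n. avg k (F n) xs)"
proof (induction k arbitrary: xs)
  case (Suc k)
  note [measurable] = F(2)
  have mono: "avg k (F m) ys \<le> avg k (F n) ys" if "m \<le> n" for m n k ys
    using F(1) that by (induction k arbitrary: ys) (auto simp: incseq_def le_fun_def intro!: nn_integral_mono)
  show ?case
    unfolding avg.simps Suc
    by (intro nn_integral_monotone_convergence_SUP) (auto simp: incseq_def le_fun_def mono)
qed simp

locale overloaded_server = single_server +
  assumes third_moment: "integrable B (\<lambda>x. x ^ 3)"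
    and overload: "rho 1 lam B > 1"
begin

definition excess :: real where "excess = rho 1 lam B - 1"

lemma excess_pos: "excess > 0" and rho_eq: "rho 1 lam B = 1 + excess"
  using overload by (simp_all add: excess_def)

lemma moment_bound:
  fixes x :: real assumes "0 \<le> x"
  shows "x \<le> 1 + x ^ 3" "x\<^sup>2 \<le> 1 + x ^ 3"
proof -
  show "x\<^sup>2 \<le> 1 + x ^ 3"
  proof (cases "x \<le> 1")
    case True
    then have "x\<^sup>2 \<le> 1" using assms by (simp add: power_le_one)
    then show ?thesis using assms by (simp add: add_increasing2)
  next
    case False
    then have "x\<^sup>2 \<le> x ^ 3" by (intro power_increasing) auto
    then show ?thesis by simp
  qed
  show "x \<le> 1 + x ^ 3"
  proof (cases "x \<le> 1")
    case False
    then have "x ^ 1 \<le> x ^ 3" by (intro power_increasing) auto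
    then show ?thesis by simp
  qed (use assms in \<open>simp add: add_increasing2\<close>)
qed

lemma first_moment [simp]: "integrable B (\<lambda>x. x)" and second_moment [simp]: "integrable B (\<lambda>x. x\<^sup>2)"
proof -
  have i: "integrable B (\<lambda>x. 1 + x ^ 3)" using third_moment by simp
  show "integrable B (\<lambda>x. x)" "integrable B (\<lambda>x. x\<^sup>2)"
    by (rule Bochner_Integration.integrable_bound[OF i];
        use B_nonneg in \<open>auto elim!: eventually_mono simp: moment_bound\<close>)+
qed

declare third_moment [simp]

text \<open>
  The Laplace transform of the service time in units of the mean interarrival time.
\<close>

definition transform :: "real \<Rightarrow> real" where
  "transform \<gamma> = (\<integral>x. exp (- \<gamma> * (lam * x)) \<partial>B)"

lemma integrable_transform:
  assumes "0 \<le> \<gamma>" shows "integrable B (\<lambda>x. exp (- \<gamma> * (lam * x)))"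
proof (rule B.integrable_const_bound[where B = 1])
  show "AE x in B. norm (exp (- \<gamma> * (lam * x))) \<le> 1"
    using B_nonneg by eventually_elim (use assms lam_pos in simp)
qed simp

lemma transform_le:
  assumes "0 \<le> \<gamma>"
  shows "transform \<gamma> \<le> 1 - \<gamma> * rho 1 lam B + \<gamma>\<^sup>2 * rho 2 lam B / 2"
proof -
  have "transform \<gamma> \<le> (\<integral>x. 1 - \<gamma> * lam * x + \<gamma>\<^sup>2 * lam\<^sup>2 / 2 * x\<^sup>2 \<partial>B)"
    unfolding transform_def
  proof (intro integral_mono_AE integrable_transform assms)
    show "AE x in B. exp (- \<gamma> * (lam * x)) \<le> 1 - \<gamma> * lam * x + \<gamma>\<^sup>2 * lam\<^sup>2 / 2 * x\<^sup>2"
      using B_nonneg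
    proof eventually_elim
      case (elim x)
      then have "0 \<le> \<gamma> * lam * x" using assms lam_pos by simp
      from exp_minus_le[OF this] show ?case by (simp add: power_mult_distrib mult_ac)
    qed
  qed simp
  also have "\<dots> = 1 - \<gamma> * rho 1 lam B + \<gamma>\<^sup>2 * rho 2 lam B / 2"
    by (simp add: rho_def B.prob_space[simplified])
  finally show ?thesis .
qed

lemma transform_ge:
  assumes "0 \<le> \<gamma>"
  shows "1 - \<gamma> * rho 1 lam B + \<gamma>\<^sup>2 * rho 2 lam B / 2 - \<gamma> ^ 3 * rho 3 lam B / 6 \<le> transform \<gamma>"
    and "1 - \<gamma> * rho 1 lam B \<le> transform \<gamma>"
proof -
  have "1 - \<gamma> * rho 1 lam B + \<gamma>\<^sup>2 * rho 2 lam B / 2 - \<gamma> ^ 3 * rho 3 lam B / 6 =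
      (\<integral>x. 1 - \<gamma> * lam * x + \<gamma>\<^sup>2 * lam\<^sup>2 / 2 * x\<^sup>2 - \<gamma> ^ 3 * lam ^ 3 / 6 * x ^ 3 \<partial>B)"
    by (simp add: rho_def B.prob_space[simplified])
  also have "\<dots> \<le> transform \<gamma>"
    unfolding transform_def
  proof (intro integral_mono_AE integrable_transform assms)
    show "AE x in B. 1 - \<gamma> * lam * x + \<gamma>\<^sup>2 * lam\<^sup>2 / 2 * x\<^sup>2 - \<gamma> ^ 3 * lam ^ 3 / 6 * x ^ 3 \<le> exp (- \<gamma> * (lam * x))"
      using B_nonneg
    proof eventually_elim
      case (elim x)
      then have "0 \<le> \<gamma> * lam * x" using assms lam_pos by simp
      from exp_minus_ge[OF this] show ?case by (simp add: power_mult_distrib mult_ac)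
    qed
  qed simp
  finally show "1 - \<gamma> * rho 1 lam B + \<gamma>\<^sup>2 * rho 2 lam B / 2 - \<gamma> ^ 3 * rho 3 lam B / 6 \<le> transform \<gamma>" .
  have "1 - \<gamma> * rho 1 lam B = (\<integral>x. 1 - \<gamma> * lam * x \<partial>B)"
    by (simp add: rho_def B.prob_space[simplified])
  also have "\<dots> \<le> transform \<gamma>"
    unfolding transform_def
  proof (intro integral_mono integrable_transform assms)
    fix x show "1 - \<gamma> * lam * x \<le> exp (- \<gamma> * (lam * x))"
      using exp_ge_add_one_self[of "- \<gamma> * (lam * x)"] by (simp add: mult_ac)
  qed simp
  finally show "1 - \<gamma> * rho 1 lam B \<le> transform \<gamma>" .
qed

abbreviation processed :: "nat \<Rightarrow> (nat \<Rightarrow> nat) \<Rightarrow> real list \<Rightarrow> ennreal" where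
  "processed \<equiv> expected_reward 1 0 (\<lambda>_ _. 0)"

text \<open>
  With \<open>\<theta> = 1 - \<gamma>\<close>, the function \<open>\<theta> ^ k * exp (- \<gamma> * (lam * x))\<close> is harmonic between departures for the queue
  that refuses nobody, and at departures its mean changes by the factor \<open>transform \<gamma> / \<theta>\<close>, which is
  1 to leading order for \<open>\<gamma> = 2 * excess / rho 2\<close>.  The linear part
  compensates a reward of 1 per accepted message, the queue growing on average by \<open>excess\<close> per service.
  Without a bound on the queue every choice of \<open>\<beta>\<close> is possible; the capacity determines it.
\<close>

definition profile :: "real \<Rightarrow> real \<Rightarrow> nat \<Rightarrow> real \<Rightarrow> real" where
  "profile \<beta> \<gamma> k x = \<beta> * (1 - (1 - \<gamma>) ^ k * exp (- \<gamma> * (lam * x))) - (rho 1 lam B * k + lam * x) / excess"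

text \<open>
  The gain from accepting a message, which is at the same time the derivative of the profile in
  units of \<open>lam\<close>.  It changes sign once as \<open>k\<close> increases, and \<open>\<beta>\<close> is chosen such that it does so at
  the capacity of the buffer.
\<close>

definition profile_slope :: "real \<Rightarrow> real \<Rightarrow> nat \<Rightarrow> real \<Rightarrow> real" where
  "profile_slope \<beta> \<gamma> k x = \<beta> * \<gamma> * ((1 - \<gamma>) ^ k * exp (- \<gamma> * (lam * x))) - 1 / excess"

lemma profile_deriv:
  "(profile \<beta> \<gamma> k has_real_derivative lam * profile_slope \<beta> \<gamma> k x) (at x)"
  unfolding profile_def[abs_def] profile_slope_def using excess_pos
  by (auto intro!: derivative_eq_intros simp: field_simps)

lemma profile_slope_cont: "isCont (\<lambda>x. lam * profile_slope \<beta> \<gamma> k x) x"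
  unfolding profile_slope_def by (intro continuous_intros)

lemma profile_accept: "1 + profile \<beta> \<gamma> (Suc k) x = profile \<beta> \<gamma> k x + profile_slope \<beta> \<gamma> k x"
  unfolding profile_def profile_slope_def rho_eq using excess_pos
  by (simp add: field_simps)

lemma integrable_profile: "0 \<le> \<gamma> \<Longrightarrow> integrable B (profile \<beta> \<gamma> k)"
  unfolding profile_def[abs_def] using integrable_transform[of \<gamma>] by simp

lemma integral_profile:
  assumes "0 \<le> \<gamma>"
  shows "integral\<^sup>L B (profile \<beta> \<gamma> k) =
    \<beta> * (1 - (1 - \<gamma>) ^ k * transform \<gamma>) - rho 1 lam B * (k + 1) / excess"
proof -
  have "integral\<^sup>L B (profile \<beta> \<gamma> k) = (\<integral>x. \<beta> - \<beta> * (1 - \<gamma>) ^ k * exp (- \<gamma> * (lam * x))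
      - rho 1 lam B * k / excess - lam / excess * x \<partial>B)"
    unfolding profile_def by (intro Bochner_Integration.integral_cong) (auto simp: field_simps add_divide_distrib)
  also have "\<dots> = \<beta> - \<beta> * (1 - \<gamma>) ^ k * transform \<gamma> - rho 1 lam B * k / excess - rho 1 lam B / excess"
    using integrable_transform[OF assms] by (simp add: transform_def rho_def B.prob_space[simplified])
  finally show ?thesis by (simp add: field_simps add_divide_distrib)
qed

lemma expected_reward_scaled_alive:
  "expected_reward 0 0 (\<lambda>_ xs. if xs = [] then 0 else c) n z xs = c * alive n z xs"
proof (induction n arbitrary: z xs)
  case (Suc n)
  note IH = ext[OF Suc]
  show ?case
    by (cases "xs = []")
      (simp_all add: expected_reward_step[OF terminal_nonempty] alive_Suc alive_Nil IH step_cmult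
        expected_reward_Nil[OF terminal_nonempty])
qed (simp add: alive_def)

text \<open>
  With \<open>\<beta> = 1 / (\<gamma> * excess * (1 - \<gamma>) ^ lo)\<close> a refusal at a queue longer than \<open>lo\<close> cannot decrease
  the profile, so the profile is subharmonic whenever all numbers of places are at least
  \<open>lo\<close>.  Since the profile is at most \<open>\<beta>\<close>, stopping after \<open>n\<close> arrivals costs at most \<open>\<beta>\<close> times the
  probability that the busy period survives.
\<close>

theorem start_processed_ge:
  assumes \<gamma>: "0 < \<gamma>" "\<gamma> < 1" and L: "transform \<gamma> \<le> 1 - \<gamma>"
    and lo: "\<And>i. i < n \<Longrightarrow> lo \<le> z i"
  defines "\<beta> \<equiv> 1 / (\<gamma> * excess * (1 - \<gamma>) ^ lo)"
  shows "ennreal ((1 / (1 - \<gamma>) ^ lo - 1) / excess - 1) \<le> start (processed n z) + ennreal \<beta> * start (alive n z)"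
proof -
  let ?E = "expected_reward 1 0 (\<lambda>_ xs. if xs = [] then 0 else ennreal \<beta>)"
  let ?f = "profile \<beta> \<gamma>" and ?D = "profile_slope \<beta> \<gamma>"
  note [measurable] = measurable_expected_reward[OF terminal_nonempty]
  have \<beta>: "0 < \<beta>" using \<gamma> excess_pos by (simp add: \<beta>_def)
  have departure: "ennreal (?f (Suc k) 0) \<le> (\<integral>\<^sup>+x. ennreal (?f k x) \<partial>B)" for k
  proof -
    have "\<beta> * ((1 - \<gamma>) ^ k * transform \<gamma>) \<le> \<beta> * ((1 - \<gamma>) ^ k * (1 - \<gamma>))"
      using \<beta> \<gamma> L by (intro mult_left_mono) auto
    then have "?f (Suc k) 0 \<le> integral\<^sup>L B (?f k)"
      unfolding integral_profile[OF less_imp_le[OF \<gamma>(1)]]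
      by (simp add: profile_def right_diff_distrib mult_ac)
    then have "ennreal (?f (Suc k) 0) \<le> ennreal (integral\<^sup>L B (?f k))" by (rule ennreal_leI)
    also have "\<dots> \<le> (\<integral>\<^sup>+x. ennreal (?f k x) \<partial>B)"
      by (rule ennreal_integral_le) (use \<gamma> in \<open>simp add: integrable_profile\<close>)
    finally show ?thesis .
  qed
  have post: "ennreal (?f k r) \<le> avg k (after_gap (?E n z)) [r]"
    if "0 \<le> r" and "\<And>k x. 0 \<le> x \<Longrightarrow> ennreal (?f k x + ?D k x) \<le> avg k (?E n z) [x]" for k r n z
  proof (rule avg_after_gap_ge_harmonic[where f = ?f and f' = "\<lambda>k x. lam * ?D k x"])
    show "?f 0 0 \<le> 0" by (simp add: profile_def)
  qed (use that lam_pos departure profile_deriv profile_slope_cont in auto)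
  have pre: "ennreal (?f k x + ?D k x) \<le> avg k (?E n z) [x]"
    if "\<And>i. i < n \<Longrightarrow> lo \<le> z i" "0 \<le> x" for k x n z
    using that
  proof (induction n arbitrary: z k x)
    case 0
    have "avg k (?E 0 z) [x] = avg k (\<lambda>_. ennreal \<beta>) [x]"
      by (rule avg_cong) simp
    moreover have "?f k x + ?D k x \<le> \<beta>"
    proof -
      have "0 \<le> \<beta> * ((1 - \<gamma>) ^ Suc k * exp (- \<gamma> * (lam * x)))" using \<beta> \<gamma> by simp
      moreover have "1 \<le> (rho 1 lam B * real (Suc k) + lam * x) / excess"
      proof -
        have "excess \<le> rho 1 lam B * 1 + 0" using rho_eq by simp
        also have "\<dots> \<le> rho 1 lam B * real (Suc k) + lam * x"
          using overload lam_pos 0 by (intro add_mono mult_left_mono) auto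
        finally show ?thesis using excess_pos by simp
      qed
      ultimately show ?thesis
        unfolding profile_accept[symmetric] by (simp add: profile_def right_diff_distrib)
    qed
    ultimately show ?case by (metis avg_const ennreal_leI)
  next
    case (Suc n)
    let ?z = "\<lambda>i. z (Suc i)"
    have IH: "ennreal (?f k r) \<le> avg k (after_gap (?E n ?z)) [r]" if "0 \<le> r" for k r
      by (rule post[OF that Suc.IH]) (use Suc.prems in auto)
    show ?case
    proof (cases "Suc k \<le> z 0")
      case True
      have "ennreal (?f k x + ?D k x) \<le> 1 + ennreal (?f (Suc k) x)"
        unfolding profile_accept[symmetric] using ennreal_add_le[of 1] by simp
      also have "\<dots> \<le> 1 + avg (Suc k) (after_gap (?E n ?z)) [x]"
        using IH[OF Suc.prems(2)] by (rule add_left_mono)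
      finally show ?thesis
        using True by (simp add: avg_expected_reward_Suc[OF terminal_nonempty])
    next
      case False
      then have "lo \<le> k" using Suc.prems(1)[of 0] by simp
      have "(1 - \<gamma>) ^ k * exp (- \<gamma> * (lam * x)) \<le> (1 - \<gamma>) ^ lo * 1"
        using \<gamma> lam_pos Suc.prems(2) \<open>lo \<le> k\<close> by (intro mult_mono power_decreasing) auto
      from mult_left_mono[OF this, of "\<beta> * \<gamma>"] have "?D k x \<le> 0"
        using \<beta> \<gamma> excess_pos by (simp add: profile_slope_def \<beta>_def field_simps)
      then have "ennreal (?f k x + ?D k x) \<le> ennreal (?f k x)" by (intro ennreal_leI) simp
      also have "\<dots> \<le> avg k (after_gap (?E n ?z)) [x]" by (rule IH[OF Suc.prems(2)])
      finally show ?thesis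
        using False by (simp add: avg_expected_reward_Suc[OF terminal_nonempty])
    qed
  qed
  have "(1 / (1 - \<gamma>) ^ lo - 1) / excess - 1 = \<beta> * (1 - (1 - \<gamma>)) - rho 1 lam B / excess"
    unfolding rho_eq \<beta>_def using \<gamma> excess_pos by (simp add: field_simps)
  also have "\<dots> \<le> integral\<^sup>L B (?f 0)"
    unfolding integral_profile[OF less_imp_le[OF \<gamma>(1)]] using \<beta> L
    by (simp del: One_nat_def)
  finally have "ennreal ((1 / (1 - \<gamma>) ^ lo - 1) / excess - 1) \<le> ennreal (integral\<^sup>L B (?f 0))"
    by (rule ennreal_leI)
  also have "\<dots> \<le> (\<integral>\<^sup>+x. ennreal (?f 0 x) \<partial>B)"
    by (rule ennreal_integral_le) (use \<gamma> in \<open>simp add: integrable_profile\<close>)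
  also have "\<dots> \<le> start (?E n z)"
    unfolding start_def
  proof (intro nn_integral_mono_AE eventually_mono[OF B_nonneg])
    fix x :: real assume "0 \<le> x"
    have "ennreal (?f 0 x) \<le> avg 0 (after_gap (?E n z)) [x]"
      by (rule post[OF \<open>0 \<le> x\<close> pre[OF lo]])
    then show "ennreal (?f 0 x) \<le> after_gap (?E n z) [x]" by simp
  qed
  also have "start (?E n z) = start (\<lambda>xs. processed n z xs + ennreal \<beta> * alive n z xs)"
  proof (rule arg_cong[where f = start], rule ext)
    fix xs
    show "?E n z xs = processed n z xs + ennreal \<beta> * alive n z xs"
      using expected_reward_add[OF terminal_zero terminal_nonempty, of 1 0 0 0 "ennreal \<beta>" n z xs]
      by (simp add: expected_reward_scaled_alive)
  qed
  also have "\<dots> = start (processed n z) + ennreal \<beta> * start (alive n z)"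
    by (simp add: start_add start_cmult)
  finally show ?thesis .
qed

lemma rho3_nonneg: "0 \<le> rho 3 lam B"
  unfolding rho_def using lam_pos B_nonneg
  by (intro mult_nonneg_nonneg integral_nonneg_AE) (auto elim: eventually_mono)

text \<open>
  The bound on \<open>t\<close> holds only after averaging, so it is carried back one arrival at a time.
\<close>

lemma alive_reward_mono:
  assumes t: "terminal t"
    and bound: "\<And>k x z. (\<And>i. z i \<le> H) \<Longrightarrow> k \<le> H \<Longrightarrow> 0 \<le> x \<Longrightarrow> avg k (t z) [x] \<le> c"
    and z: "\<And>i. z i \<le> H" and k: "k \<le> H" and x: "0 \<le> x"
  shows "avg k (expected_reward 0 0 t n z) [x] \<le> c * avg k (alive n z) [x]"
  using z k x
proof (induction n arbitrary: z k x)
  case 0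
  have "avg k (alive 0 z) [x] = avg k (\<lambda>_. 1) [x]"
    by (rule avg_cong) (simp add: alive_def)
  moreover have "avg k (expected_reward 0 0 t 0 z) [x] = avg k (t z) [x]"
    by (rule avg_cong) simp
  ultimately show ?case using bound[OF 0] by (simp add: avg_const)
next
  case (Suc n)
  let ?z = "\<lambda>i. z (Suc i)"
  have IH: "avg k (after_gap (expected_reward 0 0 t n ?z)) [r] \<le> c * avg k (after_gap (alive n ?z)) [r]"
    if "k \<le> H" "0 \<le> r" for k r
    by (rule avg_after_gap_mono[OF _ _ Suc.IH _ that])
      (use Suc.prems t in \<open>auto simp: measurable_expected_reward alive_Nil\<close>)
  show ?case
    using IH[of k x] IH[of "Suc k" x] Suc.prems(1)[of 0] Suc.prems(2,3)
    unfolding alive_def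
    by (auto simp: avg_expected_reward_Suc[OF t] avg_expected_reward_Suc[OF terminal_nonempty] simp del: avg.simps)
qed

end

text \<open>
  For the upper bound the sign of \<open>profile_slope\<close> is wrong at the capacity \<open>hi\<close> if the residual service
  is long.  Placing the sign change \<open>\<kappa>\<close> above \<open>hi\<close> confines this to residual services with
  \<open>lam * x > \<kappa>\<close>, whose effect the third moment controls.
\<close>

locale overload_profile = overloaded_server +
  fixes \<gamma> \<kappa> :: real and hi :: nat
  assumes \<gamma>: "0 < \<gamma>" "\<gamma> < 1" and \<kappa>: "0 < \<kappa>" "excess \<le> \<gamma> * \<kappa>"
    and transform_large: "1 - \<gamma> \<le> transform \<gamma>"
    and penalty_small: "\<gamma> * rho 3 lam B < 12 * \<kappa> * excess"
begin

text \<open>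
  \<open>c * (lam * x)\<^sup>2\<close> dominates the negative part of \<open>profile_slope\<close>, because
  \<open>\<kappa> - y + y\<^sup>2 / (4 * \<kappa>)\<close> is a perfect square.  Its integral over a service, the cubic term of \<open>upper\<close>, has
  mean \<open>c * rho 3 / 3\<close>.  This is a cost per service, that is, per processed message, and the
  factor \<open>\<sigma>\<close> absorbs it: \<open>\<sigma> * (c * rho 3 / 3) = \<sigma> - 1\<close>.
\<close>

definition c :: real where "c = \<gamma> / (4 * \<kappa> * excess)"
definition \<sigma> :: real where "\<sigma> = 1 / (1 - c * rho 3 lam B / 3)"
definition \<beta> :: real where "\<beta> = exp (\<gamma> * \<kappa>) / (\<gamma> * excess * (1 - \<gamma>) ^ hi)"

definition upper :: "nat \<Rightarrow> real \<Rightarrow> real" where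
  "upper k x = \<sigma> * (profile \<beta> \<gamma> k x + c * (lam * x) ^ 3 / 3) + (\<sigma> - 1) * k"

definition upper_slope :: "nat \<Rightarrow> real \<Rightarrow> real" where
  "upper_slope k x = \<sigma> * (profile_slope \<beta> \<gamma> k x + c * (lam * x)\<^sup>2)"

lemma c_pos: "0 < c"
  using \<gamma> \<kappa> excess_pos by (simp add: c_def)

lemma \<beta>_pos: "0 < \<beta>"
  using \<gamma> excess_pos by (simp add: \<beta>_def)

lemma penalty_lt_1: "c * rho 3 lam B / 3 < 1"
  using penalty_small \<kappa> excess_pos by (simp add: c_def field_simps)

lemma \<sigma>_ge_1: "1 \<le> \<sigma>"
  using penalty_lt_1 c_pos rho3_nonneg by (simp add: \<sigma>_def)

lemma \<sigma>_penalty: "\<sigma> * (c * rho 3 lam B / 3) = \<sigma> - 1"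
  using penalty_lt_1 unfolding \<sigma>_def by (simp add: field_simps)

text \<open>
  By the choice of \<open>\<beta>\<close> the exponential in \<open>profile_slope\<close> is at least
  \<open>exp (\<gamma> * (\<kappa> - lam * x)) / excess\<close> up to the capacity, and \<open>exp\<close> lies above its tangent.
\<close>

lemma profile_slope_ge:
  assumes "k \<le> hi" "0 \<le> x"
  shows "\<gamma> * (\<kappa> - lam * x) / excess \<le> profile_slope \<beta> \<gamma> k x"
proof -
  have "1 + \<gamma> * (\<kappa> - lam * x) \<le> exp (\<gamma> * (\<kappa> - lam * x))"
    by (rule exp_ge_add_one_self)
  also have "\<dots> = \<beta> * \<gamma> * excess * ((1 - \<gamma>) ^ hi * exp (- \<gamma> * (lam * x)))"
    using \<gamma> excess_pos by (simp add: \<beta>_def exp_diff exp_minus field_simps right_diff_distrib)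
  also have "\<dots> \<le> \<beta> * \<gamma> * excess * ((1 - \<gamma>) ^ k * exp (- \<gamma> * (lam * x)))"
    using \<gamma> excess_pos \<beta>_pos assms by (intro mult_left_mono mult_right_mono power_decreasing) auto
  finally have "\<gamma> * (\<kappa> - lam * x) \<le> (profile_slope \<beta> \<gamma> k x + 1 / excess) * excess - 1"
    by (simp add: profile_slope_def mult_ac)
  also have "\<dots> = profile_slope \<beta> \<gamma> k x * excess"
    using excess_pos by (simp add: distrib_right)
  finally show ?thesis
    using excess_pos by (simp add: divide_le_eq)
qed

lemma upper_slope_nonneg:
  assumes "k \<le> hi" "0 \<le> x" shows "0 \<le> profile_slope \<beta> \<gamma> k x + c * (lam * x)\<^sup>2"
proof -
  have "0 \<le> c * (2 * \<kappa> - lam * x)\<^sup>2" using c_pos by simp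
  also have "\<dots> = \<gamma> * (\<kappa> - lam * x) / excess + c * (lam * x)\<^sup>2"
    using \<kappa> excess_pos by (simp add: c_def field_simps power2_eq_square)
  also have "\<dots> \<le> profile_slope \<beta> \<gamma> k x + c * (lam * x)\<^sup>2"
    using profile_slope_ge[OF assms] by simp
  finally show ?thesis .
qed

lemma profile_0_nonneg: "k \<le> hi \<Longrightarrow> 0 \<le> profile \<beta> \<gamma> k 0"
proof (induction k)
  case 0 show ?case by (simp add: profile_def)
next
  case (Suc k)
  have "1 \<le> \<gamma> * \<kappa> / excess" using \<kappa> excess_pos by simp
  also have "\<dots> \<le> profile_slope \<beta> \<gamma> k 0"
    using profile_slope_ge[of k 0] Suc.prems by simp
  finally show ?case
    using profile_accept[of \<beta> \<gamma> k 0] Suc by simp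
qed

lemma upper_deriv: "(upper k has_real_derivative lam * upper_slope k x) (at x)"
  unfolding upper_def[abs_def] upper_slope_def
  by (auto intro!: derivative_eq_intros profile_deriv simp: field_simps power2_eq_square power3_eq_cube)

lemma upper_slope_cont: "isCont (\<lambda>x. lam * upper_slope k x) x"
  unfolding upper_slope_def profile_slope_def by (intro continuous_intros)

lemma upper_0_nonneg: "k \<le> hi \<Longrightarrow> 0 \<le> upper k 0"
  using profile_0_nonneg \<sigma>_ge_1 by (simp add: upper_def)

lemma upper_nonneg:
  assumes "k \<le> hi" "0 \<le> x" shows "0 \<le> upper k x"
proof -
  have "upper k 0 \<le> upper k x"
    by (rule DERIV_nonneg_imp_nondecreasing[OF assms(2)])
      (use upper_deriv upper_slope_nonneg assms(1) lam_pos \<sigma>_ge_1 in \<open>force simp: upper_slope_def\<close>)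
  then show ?thesis using upper_0_nonneg[OF assms(1)] by simp
qed

lemma integrable_upper: "integrable B (upper k)"
  unfolding upper_def[abs_def] using integrable_profile[of \<gamma>] \<gamma> by (simp add: power_mult_distrib)

lemma integral_upper:
  "integral\<^sup>L B (upper k) = \<sigma> * (\<beta> * (1 - (1 - \<gamma>) ^ k * transform \<gamma>) - rho 1 lam B * (k + 1) / excess)
     + (\<sigma> - 1) * (k + 1)"
proof -
  have "integral\<^sup>L B (upper k) = (\<integral>x. \<sigma> * profile \<beta> \<gamma> k x + \<sigma> * c * lam ^ 3 / 3 * x ^ 3 + (\<sigma> - 1) * k \<partial>B)"
    unfolding upper_def by (intro Bochner_Integration.integral_cong) (auto simp: power_mult_distrib field_simps)
  also have "\<dots> = \<sigma> * integral\<^sup>L B (profile \<beta> \<gamma> k) + \<sigma> * (c * rho 3 lam B / 3) + (\<sigma> - 1) * k"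
    using integrable_profile[of \<gamma>] \<gamma> by (simp add: rho_def B.prob_space[simplified])
  finally show ?thesis
    unfolding integral_profile[OF less_imp_le[OF \<gamma>(1)]] \<sigma>_penalty by (simp add: algebra_simps)
qed

lemma upper_departure:
  assumes "k < hi" shows "(\<integral>\<^sup>+x. ennreal (upper k x) \<partial>B) \<le> ennreal (upper (Suc k) 0)"
proof -
  have "(\<integral>\<^sup>+x. ennreal (upper k x) \<partial>B) = ennreal (integral\<^sup>L B (upper k))"
    by (rule nn_integral_eq_integral[OF integrable_upper])
      (use B_nonneg assms in \<open>auto elim!: eventually_mono intro: upper_nonneg\<close>)
  moreover have "integral\<^sup>L B (upper k) \<le> upper (Suc k) 0"
  proof -
    have "(1 - \<gamma>) ^ Suc k \<le> (1 - \<gamma>) ^ k * transform \<gamma>"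
      using mult_left_mono[OF transform_large, of "(1 - \<gamma>) ^ k"] \<gamma> by (simp add: mult_ac)
    then have "\<beta> * (1 - (1 - \<gamma>) ^ k * transform \<gamma>) \<le> \<beta> * (1 - (1 - \<gamma>) ^ Suc k)"
      using \<beta>_pos by (intro mult_left_mono) auto
    from mult_left_mono[OF this, of \<sigma>] show ?thesis
      using \<sigma>_ge_1 by (simp add: integral_upper upper_def profile_def right_diff_distrib add_ac)
  qed
  ultimately show ?thesis by (simp add: ennreal_leI)
qed

text \<open>
  \<open>upper\<close> is superharmonic: at an acceptance by definition of the slope, at a refusal because
  the slope is nonnegative up to the capacity, at a departure by the choice of \<open>\<sigma>\<close>.
\<close>

lemma processed_le_upper:
  assumes z: "\<And>i. i < n \<Longrightarrow> z i \<le> hi"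
  shows "k \<le> hi \<Longrightarrow> 0 \<le> r \<Longrightarrow> avg k (after_gap (processed n z)) [r] \<le> ennreal (upper k r)"
proof -
  have post: "avg k (after_gap (processed n z)) [r] \<le> ennreal (upper k r)"
    if "k \<le> hi" "0 \<le> r"
      and "\<And>k x. k \<le> hi \<Longrightarrow> 0 \<le> x \<Longrightarrow> avg k (processed n z) [x] \<le> ennreal (upper k x + upper_slope k x)" for k r n z
    by (rule avg_after_gap_le_harmonic[where K = hi and f = upper and f' = "\<lambda>k x. lam * upper_slope k x"])
      (use that lam_pos upper_deriv upper_slope_cont upper_departure upper_0_nonneg upper_nonneg
        upper_slope_nonneg \<sigma>_ge_1 in \<open>auto simp: upper_slope_def\<close>)
  have pre: "avg k (processed n z) [x] \<le> ennreal (upper k x + upper_slope k x)"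
    if "\<And>i. i < n \<Longrightarrow> z i \<le> hi" "k \<le> hi" "0 \<le> x" for k x n z
    using that
  proof (induction n arbitrary: z k x)
    case 0
    have "avg k (processed 0 z) [x] = avg k (\<lambda>_. 0) [x]" by (rule avg_cong) simp
    then show ?case by (simp add: avg_const)
  next
    case (Suc n)
    let ?z = "\<lambda>i. z (Suc i)"
    have IH: "avg k (after_gap (processed n ?z)) [r] \<le> ennreal (upper k r)" if "k \<le> hi" "0 \<le> r" for k r
      by (rule post[OF that Suc.IH]) (use Suc.prems in auto)
    have slope: "0 \<le> upper_slope k x"
      using upper_slope_nonneg[OF Suc.prems(2,3)] \<sigma>_ge_1 by (simp add: upper_slope_def)
    show ?case
    proof (cases "Suc k \<le> z 0")
      case True
      then have k: "Suc k \<le> hi" using Suc.prems(1)[of 0] by simp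
      have "1 + avg (Suc k) (after_gap (processed n ?z)) [x] \<le> 1 + ennreal (upper (Suc k) x)"
        using IH[OF k Suc.prems(3)] by (rule add_left_mono)
      also have "\<dots> = ennreal (1 + upper (Suc k) x)"
        using upper_nonneg[OF k Suc.prems(3)] by simp
      also have "\<dots> \<le> ennreal (upper k x + upper_slope k x)"
      proof (rule ennreal_leI)
        have "1 + upper (Suc k) x = upper k x + \<sigma> * profile_slope \<beta> \<gamma> k x"
        proof -
          have e: "profile \<beta> \<gamma> (Suc k) x = profile \<beta> \<gamma> k x + profile_slope \<beta> \<gamma> k x - 1"
            using profile_accept[of \<beta> \<gamma> k x] by simp
          show ?thesis unfolding upper_def e by (simp add: algebra_simps)
        qed
        also have "\<dots> \<le> upper k x + upper_slope k x"
          using \<sigma>_ge_1 c_pos by (simp add: upper_slope_def distrib_left)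
        finally show "1 + upper (Suc k) x \<le> upper k x + upper_slope k x" .
      qed
      finally show ?thesis
        using True by (simp add: avg_expected_reward_Suc[OF terminal_zero])
    next
      case False
      have "avg k (after_gap (processed n ?z)) [x] \<le> ennreal (upper k x)"
        by (rule IH[OF Suc.prems(2,3)])
      also have "\<dots> \<le> ennreal (upper k x + upper_slope k x)" using slope by (intro ennreal_leI) simp
      finally show ?thesis
        using False by (simp add: avg_expected_reward_Suc[OF terminal_zero])
    qed
  qed
  show "k \<le> hi \<Longrightarrow> 0 \<le> r \<Longrightarrow> avg k (after_gap (processed n z)) [r] \<le> ennreal (upper k r)"
    using post pre z by blast
qed

text \<open>
  The mean of \<open>upper 0\<close> over a service time, with \<open>1 - transform \<gamma>\<close> replaced by the larger \<open>\<gamma> * rho 1\<close>.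
\<close>

definition start_bound :: real where
  "start_bound = \<sigma> * (1 + rho 1 lam B * (exp (\<gamma> * \<kappa>) / (1 - \<gamma>) ^ hi - 1) / excess) - 1"

theorem start_processed_le:
  assumes z: "\<And>i. i < n \<Longrightarrow> z i \<le> hi"
  shows "start (processed n z) \<le> ennreal start_bound"
proof -
  have "start (processed n z) \<le> (\<integral>\<^sup>+x. ennreal (upper 0 x) \<partial>B)"
    unfolding start_def
    by (intro nn_integral_mono_AE eventually_mono[OF B_nonneg])
      (use processed_le_upper[where n = n and z = z and k = 0, OF z] in auto)
  also have "\<dots> = ennreal (integral\<^sup>L B (upper 0))"
    by (rule nn_integral_eq_integral[OF integrable_upper])
      (use B_nonneg in \<open>auto elim!: eventually_mono intro: upper_nonneg\<close>)
  also have "integral\<^sup>L B (upper 0) \<le> start_bound"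
  proof -
    have "\<beta> * (1 - transform \<gamma>) \<le> \<beta> * (\<gamma> * rho 1 lam B)"
      using transform_ge(2)[of \<gamma>] \<gamma> \<beta>_pos by (intro mult_left_mono) auto
    also have "\<dots> = rho 1 lam B * (exp (\<gamma> * \<kappa>) / (1 - \<gamma>) ^ hi) / excess"
      using \<gamma> excess_pos by (simp add: \<beta>_def field_simps)
    finally have "\<sigma> * (\<beta> * (1 - transform \<gamma>)) \<le> \<sigma> * (rho 1 lam B * (exp (\<gamma> * \<kappa>) / (1 - \<gamma>) ^ hi) / excess)"
      using \<sigma>_ge_1 by (intro mult_left_mono) auto
    then show ?thesis
      unfolding integral_upper start_bound_def
      by (simp add: algebra_simps diff_divide_distrib del: One_nat_def)
  qed
  finally show ?thesis by (simp add: ennreal_leI)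
qed

definition remaining_bound :: real where
  "remaining_bound = \<sigma> * \<beta> + (\<sigma> - 1) * hi + hi + 1"

text \<open>
  \<open>upper\<close> grows with the residual service, but a long service only fills the buffer: until it ends,
  at most \<open>hi + 1 - k\<close> messages are accepted, and afterwards \<open>upper\<close> is evaluated at 0.  This gives a
  bound that is uniform in the state.
\<close>

lemma remaining_processed_le:
  assumes z: "\<And>i. i < n \<Longrightarrow> z i \<le> hi" and "k \<le> hi" "0 \<le> x"
  shows "avg k (processed n z) [x] \<le> ennreal remaining_bound"
proof -
  let ?f = "\<lambda>k x::real. remaining_bound - real k"
  have nn: "0 \<le> ?f k 0" if "k \<le> hi" for k
  proof -
    have "real hi \<le> remaining_bound"
      using \<sigma>_ge_1 \<beta>_pos by (simp add: remaining_bound_def)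
    then show ?thesis using that by simp
  qed
  have "avg k (processed n z) [x] \<le> ennreal (?f k x)"
    using assms
  proof (induction n arbitrary: z k x)
    case 0
    have "avg k (processed 0 z) [x] = avg k (\<lambda>_. 0) [x]" by (rule avg_cong) simp
    then show ?case by (simp add: avg_const)
  next
    case (Suc n)
    let ?z = "\<lambda>i. z (Suc i)"
    have z': "\<And>i. i < n \<Longrightarrow> ?z i \<le> hi" using Suc.prems by simp
    have IH: "avg k (after_gap (processed n ?z)) [r] \<le> ennreal (?f k r)" if "k \<le> hi" "0 \<le> r" for k r
    proof (rule avg_after_gap_le[where K = hi and f = ?f and f' = "\<lambda>_ _. 0"])
      fix j assume j: "j < hi"
      have "(\<integral>\<^sup>+x. avg j (after_gap (processed n ?z)) [x] \<partial>B) \<le> (\<integral>\<^sup>+x. ennreal (upper j x) \<partial>B)"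
        by (intro nn_integral_mono_AE eventually_mono[OF B_nonneg] processed_le_upper z') (use j in auto)
      also have "\<dots> \<le> ennreal (upper (Suc j) 0)" by (rule upper_departure[OF j])
      also have "\<dots> \<le> ennreal (?f (Suc j) 0)"
      proof (rule ennreal_leI)
        have "profile \<beta> \<gamma> (Suc j) 0 \<le> \<beta>"
        proof -
          have "0 \<le> \<beta> * (1 - \<gamma>) ^ Suc j" using \<beta>_pos \<gamma> by simp
          moreover have "0 \<le> rho 1 lam B * real (Suc j) / excess" using excess_pos rho_eq by simp
          ultimately show ?thesis by (simp add: profile_def right_diff_distrib del: power_Suc of_nat_Suc)
        qed
        from mult_left_mono[OF this, of \<sigma>]
        have "\<sigma> * profile \<beta> \<gamma> (Suc j) 0 \<le> \<sigma> * \<beta>" using \<sigma>_ge_1 by simp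
        moreover have "(\<sigma> - 1) * real (Suc j) \<le> (\<sigma> - 1) * hi"
          using \<sigma>_ge_1 j by (intro mult_left_mono) auto
        moreover have "real (Suc j) \<le> real hi" using j by simp
        ultimately show "upper (Suc j) 0 \<le> ?f (Suc j) 0"
          unfolding upper_def remaining_bound_def by (simp del: of_nat_Suc)
      qed
      finally show "(\<integral>\<^sup>+x. avg j (after_gap (processed n ?z)) [x] \<partial>B) \<le> ennreal (?f (Suc j) 0)" .
    qed (use that Suc.IH[OF z'] nn in auto)
    show ?case
    proof (cases "Suc k \<le> z 0")
      case True
      then have k: "Suc k \<le> hi" using Suc.prems(1)[of 0] by simp
      have "1 + avg (Suc k) (after_gap (processed n ?z)) [x] \<le> 1 + ennreal (?f (Suc k) x)"
        using IH[OF k Suc.prems(3)] by (rule add_left_mono)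
      also have "\<dots> = ennreal (1 + ?f (Suc k) x)"
        by (subst ennreal_plus) (use nn[OF k] in auto)
      also have "\<dots> = ennreal (?f k x)" by simp
      finally show ?thesis
        using True by (simp add: avg_expected_reward_Suc[OF terminal_zero])
    next
      case False
      then show ?thesis
        using IH[OF Suc.prems(2,3)] by (simp add: avg_expected_reward_Suc[OF terminal_zero])
    qed
  qed
  also have "\<dots> \<le> ennreal remaining_bound" by (intro ennreal_leI) simp
  finally show ?thesis .
qed

lemma start_total_le:
  assumes z: "\<And>i. z i \<le> hi"
  shows "start (total_reward 1 0 z) \<le> ennreal start_bound"
proof -
  have "start (total_reward 1 0 z) = (SUP n. start (processed n z))"
    unfolding total_reward_def[abs_def]
    by (rule start_SUP) (auto simp: incseq_def le_fun_def intro: incseqD[OF incseq_expected_reward])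
  also have "\<dots> \<le> ennreal start_bound" by (intro SUP_least start_processed_le z)
  finally show ?thesis .
qed

text \<open>
  Only the first \<open>n\<close> arrivals matter, up to the probability of surviving them.
\<close>

theorem start_total_le_truncated:
  assumes z: "\<And>i. z i \<le> hi"
  shows "start (total_reward 1 0 z) \<le> start (processed n z) + ennreal remaining_bound * start (alive n z)"
proof -
  note [measurable] = measurable_expected_reward[OF terminal_total_reward]
  have total: "avg k (total_reward 1 0 z) [x] \<le> ennreal remaining_bound"
    if "\<And>i. z i \<le> hi" "k \<le> hi" "0 \<le> x" for k x z
  proof -
    have "avg k (total_reward 1 0 z) [x] = (SUP n. avg k (processed n z) [x])"
      unfolding total_reward_def[abs_def]
      by (rule avg_SUP) (auto simp: incseq_def le_fun_def intro: incseqD[OF incseq_expected_reward])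
    also have "\<dots> \<le> ennreal remaining_bound"
      by (intro SUP_least remaining_processed_le that)
    finally show ?thesis .
  qed
  have "start (expected_reward 0 0 (total_reward 1 0) n z) \<le> start (\<lambda>xs. ennreal remaining_bound * alive n z xs)"
    unfolding start_def
  proof (intro nn_integral_mono_AE eventually_mono[OF B_nonneg])
    fix x :: real assume x: "0 \<le> x"
    have "avg 0 (after_gap (expected_reward 0 0 (total_reward 1 0) n z)) [x] \<le>
        ennreal remaining_bound * avg 0 (after_gap (alive n z)) [x]"
    proof (rule avg_after_gap_mono[where K = hi])
      show "avg k (expected_reward 0 0 (total_reward 1 0) n z) [y] \<le> ennreal remaining_bound * avg k (alive n z) [y]"
        if "k \<le> hi" "0 \<le> y" for k y
        by (rule alive_reward_mono[OF terminal_total_reward total z that])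
    qed (use x in \<open>simp_all add: terminal_total_reward alive_Nil\<close>)
    then show "after_gap (expected_reward 0 0 (total_reward 1 0) n z) [x] \<le>
        after_gap (\<lambda>xs. ennreal remaining_bound * alive n z xs) [x]"
      by (simp add: after_gap_cmult)
  qed
  then have "start (expected_reward 0 0 (total_reward 1 0) n z) \<le> ennreal remaining_bound * start (alive n z)"
    by (simp add: start_cmult)
  moreover have "start (total_reward 1 0 z) =
      start (processed n z) + start (expected_reward 0 0 (total_reward 1 0) n z)"
    by (subst start_add[symmetric])
      (auto simp: total_reward_split[symmetric] terminal_total_reward)
  ultimately show ?thesis by (simp add: add_left_mono)
qed

end

section \<open>From sample paths to backlogs\<close>

primrec queue :: "(nat \<Rightarrow> nat) \<Rightarrow> (nat \<Rightarrow> real \<times> real) \<Rightarrow> real list \<Rightarrow> nat \<Rightarrow> real list" where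
  "queue z w xs 0 = xs"
| "queue z w xs (Suc i) = serve (w i) (z i) (queue z w xs i)"

text \<open>
  Departure times recovered from the remaining service times of a state at time \<open>t\<close>.
\<close>

primrec finish_times :: "real \<Rightarrow> real list \<Rightarrow> real list" where
  "finish_times t [] = []"
| "finish_times t (x # xs) = (t + x) # finish_times (t + x) xs"

lemma length_finish_times [simp]: "length (finish_times t xs) = length xs"
  by (induction xs arbitrary: t) auto

lemma finish_times_Nil_iff [simp]: "finish_times t xs = [] \<longleftrightarrow> xs = []"
  by (cases xs) auto

lemma finish_times_snoc: "finish_times t (xs @ [s]) = finish_times t xs @ [t + sum_list xs + s]"
  by (induction xs arbitrary: t) (auto simp: add.assoc)

lemma last_finish_times: "xs \<noteq> [] \<Longrightarrow> last (finish_times t xs) = t + sum_list xs"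
  by (cases xs rule: rev_cases) (auto simp: finish_times_snoc)

lemma finish_times_ge: "list_all (\<lambda>x. 0 \<le> x) xs \<Longrightarrow> d \<in> set (finish_times t xs) \<Longrightarrow> t \<le> d"
  by (induction xs arbitrary: t) fastforce+

lemma filter_finish_times:
  "list_all (\<lambda>x. 0 \<le> x) xs \<Longrightarrow> filter (\<lambda>d. t + a \<le> d) (finish_times t xs) = finish_times (t + a) (advance a xs)"
proof (induction xs arbitrary: t a)
  case (Cons x xs)
  show ?case
  proof (cases "a \<le> x")
    case True
    have "t + a \<le> d" if "d \<in> set (finish_times (t + x) xs)" for d
      using finish_times_ge[of xs d "t + x"] that Cons.prems True by auto
    then have "filter (\<lambda>d. t + a \<le> d) (finish_times (t + x) xs) = finish_times (t + x) xs"
      by (intro filter_True) auto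
    then show ?thesis using True by simp
  next
    case False
    then show ?thesis using Cons.IH[of "t + x" "a - x"] Cons.prems by simp
  qed
qed simp

text \<open>
  The departure times not yet passed, in increasing order, are those computed from the state.
  Sortedness of all departure times, which rests on nonnegative services, makes the latest departure
  time the start of service of an accepted message exactly if somebody is present.
\<close>

lemma present_departures:
  assumes a: "\<And>i. 0 \<le> a i" and s: "\<And>i. 0 \<le> s i"
  defines "w \<equiv> \<lambda>i. (a (Suc i), s i)"
  shows "rev (filter (\<lambda>d. arrival_time a i \<le> d) (departures a s z i)) =
      finish_times (arrival_time a i) (queue z w [] i)
    \<and> sorted_wrt (\<ge>) (departures a s z i) \<and> list_all (\<lambda>x. 0 \<le> x) (queue z w [] i)"
proof (induction i)
  case (Suc i)
  let ?t = "arrival_time a i" and ?ds = "departures a s z i" and ?q = "queue z w [] i"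
  let ?f = "filter (\<lambda>d. ?t \<le> d)"
  let ?ds' = "departures a s z (Suc i)" and ?q' = "if length ?q \<le> z i then ?q @ [s i] else ?q"
  have IH: "rev (?f ?ds) = finish_times ?t ?q" "sorted_wrt (\<ge>) ?ds" "list_all (\<lambda>x. 0 \<le> x) ?q"
    using Suc by auto
  have len: "length (?f ?ds) = length ?q"
    using arg_cong[OF IH(1), of length] by simp
  have t': "arrival_time a (Suc i) = ?t + a (Suc i)" by (simp add: arrival_time_def)
  have nn: "list_all (\<lambda>x. 0 \<le> x) ?q'" using IH(3) s by simp
  have main: "rev (?f ?ds') = finish_times ?t ?q' \<and> sorted_wrt (\<ge>) ?ds'"
  proof (cases "length ?q \<le> z i")
    case False
    then have "?ds' = ?ds" using len by (simp add: Let_def)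
    then show ?thesis using IH False by simp
  next
    case True
    define m where "m = (case ?ds of [] \<Rightarrow> ?t | d # _ \<Rightarrow> max ?t d)"
    have ds': "?ds' = (m + s i) # ?ds" using True len by (simp add: Let_def m_def)
    have m_t: "?t \<le> m" by (auto simp: m_def split: list.split)
    have m_ge: "d \<le> m" if "d \<in> set ?ds" for d
      using that IH(2) by (cases ?ds) (auto simp: m_def le_max_iff_disj)
    have "m = ?t + sum_list ?q"
    proof (cases ?ds)
      case Nil
      then show ?thesis using len by (simp add: m_def)
    next
      case (Cons d ds)
      show ?thesis
      proof (cases "?t \<le> d")
        case True
        then have "?f ?ds = d # ?f ds" using Cons by simp
        then have "last (rev (?f ?ds)) = d" "?q \<noteq> []" using len by auto
        then have "d = ?t + sum_list ?q" using last_finish_times IH(1) by metis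
        then show ?thesis using True Cons by (simp add: m_def)
      next
        case False
        then have "?f ?ds = []" using Cons IH(2) by (auto simp: filter_empty_conv)
        then have "?q = []" using len by simp
        then show ?thesis using False Cons by (simp add: m_def)
      qed
    qed
    then have "rev (?f ?ds') = finish_times ?t ?q'"
      using ds' m_t s[of i] IH(1) True by (simp add: finish_times_snoc)
    moreover have "sorted_wrt (\<ge>) ?ds'"
      using ds' m_ge s[of i] IH(2) by (auto intro: add_increasing2)
    ultimately show ?thesis ..
  qed
  have q: "queue z w [] (Suc i) = advance (a (Suc i)) ?q'"
    by (simp add: serve_def w_def)
  have "filter (\<lambda>d. ?t + a (Suc i) \<le> d) ?ds' = filter (\<lambda>d. ?t + a (Suc i) \<le> d) (?f ?ds')"
    using a[of "Suc i"] by (auto intro!: filter_cong)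
  then have "rev (filter (\<lambda>d. ?t + a (Suc i) \<le> d) ?ds') = filter (\<lambda>d. ?t + a (Suc i) \<le> d) (rev (?f ?ds'))"
    by (simp only: rev_filter)
  also have "\<dots> = finish_times (?t + a (Suc i)) (advance (a (Suc i)) ?q')"
    using main filter_finish_times[OF nn] by simp
  finally show ?case
    using main advance_nonneg[OF nn] unfolding q t' by simp
qed (simp_all add: arrival_time_def)

lemma number_before_eq:
  assumes a: "\<And>i. 0 \<le> a i" and s: "\<And>i. 0 \<le> s i"
  shows "number_before a s z i = length (queue z (\<lambda>i. (a (Suc i), s i)) [] i)"
proof -
  have "length (rev (filter (\<lambda>d. arrival_time a i \<le> d) (departures a s z i))) =
      length (queue z (\<lambda>i. (a (Suc i), s i)) [] i)"
    using present_departures[OF a s, where z = z and i = i] by simp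
  then show ?thesis by (simp add: number_before_def)
qed

lemma queue_shift:
  "queue z w xs (Suc i) = queue (\<lambda>i. z (Suc i)) (\<lambda>i. w (Suc i)) (serve (w 0) (z 0) xs) i"
  by (induction i) simp_all

text \<open>
  Relates the recursion from the front of the path, suited to conditioning on the first step, to the
  recursion from the back, by which the queue is defined.
\<close>

lemma reward_eq_sum:
  "reward u v (\<lambda>_ _. 0) n z w xs = (\<Sum>i<n. if \<forall>j\<le>i. queue z w xs j \<noteq> []
     then if length (queue z w xs i) \<le> z i then u else v else 0)"
proof (induction n arbitrary: z w xs)
  case (Suc n)
  have all: "(\<forall>j\<le>Suc i. P j) \<longleftrightarrow> P 0 \<and> (\<forall>j\<le>i. P (Suc j))" for P and i :: nat
    by (metis Suc_le_mono le0 not0_implies_Suc)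
  show ?case
    unfolding sum.lessThan_Suc_shift reward.simps Suc all queue_shift by auto
qed simp

text \<open>
  The reward of a busy period without its first message.
\<close>

definition busy_reward :: "ennreal \<Rightarrow> ennreal \<Rightarrow> (nat \<Rightarrow> nat) \<Rightarrow> (nat \<Rightarrow> real \<times> real) \<Rightarrow> ennreal" where
  "busy_reward u v z w =
     (SUP n. reward u v (\<lambda>_ _. 0) n (\<lambda>i. z (Suc i)) (\<lambda>i. w (Suc i)) (serve (w 0) (z 0) []))"

lemma busy_reward_eq_suminf:
  "busy_reward u v z w = (\<Sum>i. if \<forall>j. 0 < j \<and> j \<le> Suc i \<longrightarrow> queue z w [] j \<noteq> []
     then if length (queue z w [] (Suc i)) \<le> z (Suc i) then u else v else 0)"
proof -
  have all: "(\<forall>j. 0 < j \<and> j \<le> Suc i \<longrightarrow> P j) \<longleftrightarrow> (\<forall>j\<le>i. P (Suc j))" for P and i :: nat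
    by (metis Suc_le_mono not_gr_zero old.nat.exhaust zero_less_Suc)
  show ?thesis
    unfolding busy_reward_def reward_eq_sum suminf_eq_SUP all queue_shift ..
qed

lemma busy_reward_add: "busy_reward (u + u') (v + v') z w = busy_reward u v z w + busy_reward u' v' z w"
  unfolding busy_reward_def
  using reward_add[of u u' v v' "\<lambda>_ _. 0" "\<lambda>_ _. 0"]
  by (simp add: ennreal_SUP_add[OF incseq_reward incseq_reward])

lemma (in single_server) nn_integral_busy_reward:
  "(\<integral>\<^sup>+w. busy_reward u v z w \<partial>steps) = start (total_reward u v (\<lambda>i. z (Suc i)))"
proof -
  let ?z = "\<lambda>i. z (Suc i)"
  have m: "(\<lambda>w. reward u v (\<lambda>_ _. 0) n ?z (\<lambda>i. w (Suc i)) (serve (w 0) (z 0) [])) \<in> borel_measurable steps" for n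
  proof (intro measurable_reward)
    have [measurable]: "(\<lambda>w. w i) \<in> measurable steps (borel \<Otimes>\<^sub>M borel)" for i
      unfolding measurable_cong_sets[OF sets_steps refl]
      by (rule measurable_component_singleton) simp
    show "(\<lambda>w i. w (Suc i)) \<in> measurable steps (\<Pi>\<^sub>M i\<in>UNIV. borel \<Otimes>\<^sub>M borel)"
      by (rule measurable_PiM_single') (auto simp: space_pair_measure)
    show "(\<lambda>w. serve (w 0) (z 0) []) \<in> measurable steps list_borel" by measurable
  qed (auto simp: space_PiM)
  have m': "(\<lambda>w. reward u v (\<lambda>_ _. 0) n ?z w xs) \<in> borel_measurable steps" for n xs
    by (intro measurable_reward) (auto simp: measurable_cong_sets[OF refl sets_steps[symmetric]] space_PiM)
  have "(\<integral>\<^sup>+w. busy_reward u v z w \<partial>steps) =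
      (SUP n. \<integral>\<^sup>+w. reward u v (\<lambda>_ _. 0) n ?z (\<lambda>i. w (Suc i)) (serve (w 0) (z 0) []) \<partial>steps)"
    unfolding busy_reward_def
    by (intro nn_integral_monotone_convergence_SUP m)
      (auto simp: incseq_def le_fun_def intro: incseqD[OF incseq_reward])
  also have "\<dots> = (SUP n. start (expected_reward u v (\<lambda>_ _. 0) n ?z))"
    unfolding nn_integral_steps[OF m]
    by (simp add: start_def after_gap_def expected_reward_def serve_def)
  also have "\<dots> = start (total_reward u v ?z)"
    unfolding total_reward_def[abs_def]
    by (rule start_SUP[symmetric])
      (auto simp: incseq_def le_fun_def intro: incseqD[OF incseq_expected_reward])
  finally show ?thesis .
qed

lemma num_processed_eq:
  assumes a: "\<And>i. 0 \<le> a i" and s: "\<And>i. 0 \<le> s i"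
  shows "num_processed a s z = 1 + busy_reward 1 0 z (\<lambda>i. (a (Suc i), s i))"
    and "num_refused a s z = busy_reward 0 1 z (\<lambda>i. (a (Suc i), s i))"
proof -
  let ?w = "\<lambda>i. (a (Suc i), s i)"
  note nb = number_before_eq[OF a s]
  have sp: "(\<Sum>i. f i) = f 0 + (\<Sum>i. f (Suc i))" for f :: "nat \<Rightarrow> ennreal"
    using suminf_offset[of f 1] by simp
  show "num_processed a s z = 1 + busy_reward 1 0 z ?w"
    unfolding num_processed_def sp[of "\<lambda>i. of_bool (in_busy_period a s z i \<and> \<not> refused a s z i)"] busy_reward_eq_suminf
    by (intro arg_cong2[where f = "(+)"] suminf_cong)
      (auto simp: in_busy_period_def refused_def nb)
  have "num_refused a s z = 0 + busy_reward 0 1 z ?w"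
    unfolding num_refused_def sp[of "\<lambda>i. of_bool (in_busy_period a s z i \<and> refused a s z i)"] busy_reward_eq_suminf
    by (intro arg_cong2[where f = "(+)"] suminf_cong)
      (auto simp: in_busy_period_def refused_def nb)
  then show "num_refused a s z = busy_reward 0 1 z ?w" by simp
qed

section \<open>The loss probability in terms of the mean number of processed messages\<close>

context loss_queue
begin

sublocale single_server lam B
  by (rule single_server.intro) (use rate_pos service_law in auto)

definition source_events :: "source \<Rightarrow> 'b set set" where
  "source_events k = (case k of
        Interarrival i \<Rightarrow> {a i -` A \<inter> space Q | A. A \<in> sets borel}
      | Service i \<Rightarrow> {s i -` A \<inter> space Q | A. A \<in> sets borel}
      | Mark i \<Rightarrow> {mark i -` A \<inter> space Q | A. A \<in> sets (count_space UNIV)}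
      | Places \<Rightarrow> {(\<lambda>\<omega> i. z i \<omega>) -` A \<inter> space Q | A. A \<in> sets places_space})"

text \<open>
  The information contained in the sources \<open>J\<close>.  Disjoint sets of sources carry independent
  information, also for random variables of different types.
\<close>

definition known :: "source set \<Rightarrow> 'b measure" where
  "known J = sigma (space Q) (\<Union>k\<in>J. source_events k)"

lemma source_events_Pow: "(\<Union>k\<in>J. source_events k) \<subseteq> Pow (space Q)"
  by (auto simp: source_events_def split: source.splits)

lemma space_known [simp]: "space (known J) = space Q"
  unfolding known_def by (rule space_measure_of[OF source_events_Pow])

lemma sets_known: "sets (known J) = sigma_sets (space Q) (\<Union>k\<in>J. source_events k)"
  unfolding known_def by (rule sets_measure_of[OF source_events_Pow])

lemma Int_stable_source_events: "Int_stable (source_events k)"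
proof -
  have *: "Int_stable {f -` A \<inter> space Q | A. A \<in> sets N}" for f :: "'b \<Rightarrow> 'c" and N
  proof (safe intro!: Int_stableI)
    fix A A' assume "A \<in> sets N" "A' \<in> sets N"
    then show "\<exists>C. f -` A \<inter> space Q \<inter> (f -` A' \<inter> space Q) = f -` C \<inter> space Q \<and> C \<in> sets N"
      by (intro exI[of _ "A \<inter> A'"]) auto
  qed
  show ?thesis by (cases k) (simp_all only: source_events_def source.case *)
qed

lemma indep_source_events: "indep_sets source_events UNIV"
proof -
  have "source_events = (\<lambda>k. case k of
        Interarrival i \<Rightarrow> {a i -` A \<inter> space Q | A. A \<in> sets borel}
      | Service i \<Rightarrow> {s i -` A \<inter> space Q | A. A \<in> sets borel}
      | Mark i \<Rightarrow> {mark i -` A \<inter> space Q | A. A \<in> sets (count_space UNIV)}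
      | Places \<Rightarrow> {(\<lambda>\<omega> i. z i \<omega>) -` A \<inter> space Q | A. A \<in> sets places_space})"
    by (rule ext) (simp add: source_events_def)
  then show ?thesis using independence by simp
qed

lemma indep_known: "disjoint_family_on K L \<Longrightarrow> indep_sets (\<lambda>j. sets (known (K j))) L"
  unfolding sets_known
  by (rule indep_sets_collect_sigma)
    (auto intro: indep_sets_mono_index[OF _ indep_source_events] Int_stable_source_events)

lemma sets_known_subset: "sets (known J) \<subseteq> events"
  using indep_known[of "\<lambda>_. J" "{()}"] by (simp add: indep_sets_def disjoint_family_on_def)

lemma measurable_known: "f \<in> measurable (known J) N \<Longrightarrow> f \<in> measurable Q N"
  using sets_known_subset by (auto simp: measurable_def)

lemma prob_known_Int:
  assumes "J1 \<inter> J2 = {}" "A \<in> sets (known J1)" "A' \<in> sets (known J2)"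
  shows "prob (A \<inter> A') = prob A * prob A'"
proof -
  have "indep_sets (\<lambda>j. sets (known (case_bool J1 J2 j))) UNIV"
    by (rule indep_known) (use assms in \<open>auto simp: disjoint_family_on_def split: bool.split\<close>)
  moreover have "(\<lambda>j. sets (known (case_bool J1 J2 j))) = case_bool (sets (known J1)) (sets (known J2))"
    by (rule ext) (simp split: bool.split)
  ultimately have "indep_set (sets (known J1)) (sets (known J2))"
    by (simp add: indep_set_def)
  then show ?thesis using assms by (auto simp: indep_sets2_eq)
qed

lemma distr_known_pair:
  assumes disj: "J1 \<inter> J2 = {}" and X: "X \<in> measurable (known J1) N1" and Y: "Y \<in> measurable (known J2) N2"
  shows "distr Q N1 X \<Otimes>\<^sub>M distr Q N2 Y = distr Q (N1 \<Otimes>\<^sub>M N2) (\<lambda>\<omega>. (X \<omega>, Y \<omega>))"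
proof (rule pair_measure_eqI)
  note [measurable] = measurable_known[OF X] measurable_known[OF Y]
  interpret X: prob_space "distr Q N1 X" by (rule prob_space_distr) simp
  interpret Y: prob_space "distr Q N2 Y" by (rule prob_space_distr) simp
  show "sigma_finite_measure (distr Q N1 X)" "sigma_finite_measure (distr Q N2 Y)" ..
  show "sets (distr Q N1 X \<Otimes>\<^sub>M distr Q N2 Y) = sets (distr Q (N1 \<Otimes>\<^sub>M N2) (\<lambda>\<omega>. (X \<omega>, Y \<omega>)))"
    by (simp cong: sets_pair_measure_cong)
  fix A A' assume "A \<in> sets (distr Q N1 X)" "A' \<in> sets (distr Q N2 Y)"
  then have A [measurable]: "A \<in> sets N1" "A' \<in> sets N2" by simp_all
  have "prob ((X -` A \<inter> space Q) \<inter> (Y -` A' \<inter> space Q)) = prob (X -` A \<inter> space Q) * prob (Y -` A' \<inter> space Q)"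
    using measurable_sets[OF X A(1)] measurable_sets[OF Y A(2)] by (intro prob_known_Int[OF disj]) simp_all
  moreover have "(\<lambda>\<omega>. (X \<omega>, Y \<omega>)) -` (A \<times> A') \<inter> space Q = (X -` A \<inter> space Q) \<inter> (Y -` A' \<inter> space Q)" by auto
  ultimately show "emeasure (distr Q N1 X) A * emeasure (distr Q N2 Y) A' =
      emeasure (distr Q (N1 \<Otimes>\<^sub>M N2) (\<lambda>\<omega>. (X \<omega>, Y \<omega>))) (A \<times> A')"
    by (simp add: emeasure_distr emeasure_eq_measure ennreal_mult)
qed

lemma known_measurable:
  "Interarrival i \<in> J \<Longrightarrow> a i \<in> borel_measurable (known J)"
  "Service i \<in> J \<Longrightarrow> s i \<in> borel_measurable (known J)"
  "Mark i \<in> J \<Longrightarrow> mark i \<in> measurable (known J) (count_space UNIV)"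
  "Places \<in> J \<Longrightarrow> (\<lambda>\<omega> i. z i \<omega>) \<in> measurable (known J) places_space"
  by (intro measurableI; force simp: sets_known source_events_def space_PiM intro!: sigma_sets.Basic)+

definition path :: "'b \<Rightarrow> nat \<Rightarrow> real \<times> real" where
  "path \<omega> = (\<lambda>i. (a (Suc i) \<omega>, s i \<omega>))"

definition zpath :: "'b \<Rightarrow> nat \<Rightarrow> nat" where
  "zpath \<omega> = (\<lambda>i. z i \<omega>)"

abbreviation "traffic \<equiv> range Interarrival \<union> range Service"

lemma path_known: "traffic \<subseteq> J \<Longrightarrow> path \<in> measurable (known J) (\<Pi>\<^sub>M i\<in>UNIV. borel \<Otimes>\<^sub>M borel)"
  unfolding path_def[abs_def]
  by (intro measurable_PiM_single' measurable_Pair known_measurable) (auto simp: space_pair_measure)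

lemma zpath_known: "Places \<in> J \<Longrightarrow> zpath \<in> measurable (known J) places_space"
  unfolding zpath_def[abs_def] by (rule known_measurable)

lemma path_Q: "path \<in> measurable Q (\<Pi>\<^sub>M i\<in>UNIV. borel \<Otimes>\<^sub>M borel)"
  by (rule measurable_known[OF path_known[of traffic]]) simp

lemma zpath_Q: "zpath \<in> measurable Q places_space"
  by (rule measurable_known[OF zpath_known[of "{Places}"]]) simp

lemma distr_a: "distr Q borel (a i) = gap"
proof -
  have "distr Q borel (a i) = distr Q lborel (a i)" by (rule distr_cong) simp_all
  then show ?thesis using distributed_distr_eq_density[OF interarrival[of i]] by (simp add: gap_def)
qed

text \<open>
  Pairing each service time with the following interarrival time gives an i.i.d. sequence.
\<close>

lemma distr_path: "distr Q (\<Pi>\<^sub>M i\<in>UNIV. borel \<Otimes>\<^sub>M borel) path = steps"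
proof -
  let ?X = "\<lambda>i \<omega>. (a (Suc i) \<omega>, s i \<omega>)"
  let ?K = "\<lambda>i. {Interarrival (Suc i), Service i}"
  have X: "?X i \<in> measurable (known (?K i)) (borel \<Otimes>\<^sub>M borel)" for i
    by (intro measurable_Pair known_measurable) auto
  note rv = measurable_known[OF X]
  have "indep_vars (\<lambda>_. borel \<Otimes>\<^sub>M borel) ?X UNIV"
    unfolding indep_vars_def2
  proof (intro conjI ballI rv indep_sets_mono_sets[OF indep_known[of ?K UNIV]])
    show "disjoint_family ?K" by (auto simp: disjoint_family_on_def)
    show "{?X i -` A \<inter> space Q | A. A \<in> sets (borel \<Otimes>\<^sub>M borel)} \<subseteq> sets (known (?K i))" for i
      using measurable_sets[OF X[of i]] by auto
  qed
  then have "distr Q (\<Pi>\<^sub>M i\<in>UNIV. borel \<Otimes>\<^sub>M borel) (\<lambda>\<omega>. \<lambda>i\<in>UNIV. ?X i \<omega>) =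
      (\<Pi>\<^sub>M i\<in>UNIV. distr Q (borel \<Otimes>\<^sub>M borel) (?X i))"
    using indep_vars_iff_distr_eq_PiM[where I = UNIV and M' = "\<lambda>_. borel \<Otimes>\<^sub>M borel" and X = ?X] rv by simp
  moreover have "distr Q (borel \<Otimes>\<^sub>M borel) (?X i) = gap \<Otimes>\<^sub>M B" for i
  proof -
    have "distr Q borel (a (Suc i)) \<Otimes>\<^sub>M distr Q borel (s i) = distr Q (borel \<Otimes>\<^sub>M borel) (?X i)"
      by (rule distr_known_pair[of "{Interarrival (Suc i)}" "{Service i}"]) (auto intro: known_measurable)
    then show ?thesis by (simp add: distr_a service)
  qed
  ultimately show ?thesis by (simp add: steps_def path_def[abs_def] restrict_UNIV)
qed

lemma AE_nonneg: "AE \<omega> in Q. (\<forall>i. 0 \<le> a i \<omega>) \<and> (\<forall>i. 0 \<le> s i \<omega>)"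
proof -
  have "AE x in gap. 0 \<le> x"
    unfolding gap_def by (subst AE_density) (auto simp: exponential_density_def)
  then have "AE x in distr Q borel (a i). 0 \<le> x" for i unfolding distr_a .
  then have "AE \<omega> in Q. 0 \<le> a i \<omega>" for i
    by (rule AE_distrD[OF measurable_known[OF known_measurable(1)[of i UNIV]], rotated]) simp
  moreover have "AE x in distr Q borel (s i). 0 \<le> x" for i
    unfolding service(2) by (rule B_nonneg)
  then have "AE \<omega> in Q. 0 \<le> s i \<omega>" for i
    by (rule AE_distrD[OF service(1)])
  ultimately show ?thesis by (simp add: AE_all_countable)
qed

lemma measurable_busy_reward:
  assumes z: "zz \<in> measurable M places_space" and w: "ww \<in> measurable M (\<Pi>\<^sub>M i\<in>UNIV. borel \<Otimes>\<^sub>M borel)"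
  shows "(\<lambda>x. busy_reward u v (zz x) (ww x)) \<in> borel_measurable M"
  unfolding busy_reward_def
proof (intro borel_measurable_SUP measurable_reward)
  have [measurable]: "(\<lambda>x. zz x i) \<in> measurable M (count_space UNIV)" "(\<lambda>x. ww x i) \<in> measurable M (borel \<Otimes>\<^sub>M borel)" for i
    using measurable_compose[OF z measurable_component_singleton] measurable_compose[OF w measurable_component_singleton] by auto
  show "(\<lambda>x i. zz x (Suc i)) \<in> measurable M places_space"
    by (rule measurable_PiM_single') auto
  show "(\<lambda>x i. ww x (Suc i)) \<in> measurable M (\<Pi>\<^sub>M i\<in>UNIV. borel \<Otimes>\<^sub>M borel)"
    by (rule measurable_PiM_single') (auto simp: space_pair_measure)
  show "(\<lambda>x. serve (ww x 0) (zz x 0) []) \<in> measurable M list_borel" by measurable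
qed auto

text \<open>
  As the places are independent of the traffic, expectations may be taken over the traffic first,
  with the places fixed.
\<close>

lemma nn_integral_busy_reward_Q:
  "(\<integral>\<^sup>+\<omega>. busy_reward u v (zpath \<omega>) (path \<omega>) \<partial>Q) =
   (\<integral>\<^sup>+\<omega>. start (total_reward u v (\<lambda>i. z (Suc i) \<omega>)) \<partial>Q)"
proof -
  let ?W = "\<Pi>\<^sub>M i\<in>UNIV. (borel :: real measure) \<Otimes>\<^sub>M (borel :: real measure)"
  note zp = zpath_Q and wp = path_Q
  have pair: "distr Q places_space zpath \<Otimes>\<^sub>M distr Q ?W path = distr Q (places_space \<Otimes>\<^sub>M ?W) (\<lambda>\<omega>. (zpath \<omega>, path \<omega>))"
    by (rule distr_known_pair[of "{Places}" traffic]) (auto intro: zpath_known path_known)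
  have m: "(\<lambda>(x, w). busy_reward u v x w) \<in> borel_measurable (places_space \<Otimes>\<^sub>M ?W)"
    unfolding split_beta' by (intro measurable_busy_reward) simp_all
  have m': "(\<lambda>(x, w). busy_reward u v x w) \<in> borel_measurable (distr Q places_space zpath \<Otimes>\<^sub>M steps)"
    using m by (simp cong: measurable_cong_sets sets_pair_measure_cong add: sets_steps)
  have "(\<integral>\<^sup>+\<omega>. busy_reward u v (zpath \<omega>) (path \<omega>) \<partial>Q) =
      (\<integral>\<^sup>+x. (case x of (x, w) \<Rightarrow> busy_reward u v x w) \<partial>distr Q (places_space \<Otimes>\<^sub>M ?W) (\<lambda>\<omega>. (zpath \<omega>, path \<omega>)))"
    using m zp wp by (subst nn_integral_distr) auto
  also have "\<dots> = (\<integral>\<^sup>+x. (\<integral>\<^sup>+w. busy_reward u v x w \<partial>steps) \<partial>distr Q places_space zpath)"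
    unfolding pair[symmetric] distr_path using m' by (subst steps.nn_integral_fst[symmetric]) auto
  also have "\<dots> = (\<integral>\<^sup>+\<omega>. (\<integral>\<^sup>+w. busy_reward u v (zpath \<omega>) w \<partial>steps) \<partial>Q)"
    using steps.borel_measurable_nn_integral_fst[OF m'] zp by (subst nn_integral_distr) auto
  finally show ?thesis by (simp add: nn_integral_busy_reward zpath_def)
qed

definition mean_processed :: ennreal where
  "mean_processed = 1 + (\<integral>\<^sup>+\<omega>. start (total_reward 1 0 (\<lambda>i. z (Suc i) \<omega>)) \<partial>Q)"

lemma num_AE:
  "AE \<omega> in Q. num_processed (\<lambda>i. a i \<omega>) (\<lambda>i. s i \<omega>) (\<lambda>i. z i \<omega>) = 1 + busy_reward 1 0 (zpath \<omega>) (path \<omega>)"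
  "AE \<omega> in Q. num_refused (\<lambda>i. a i \<omega>) (\<lambda>i. s i \<omega>) (\<lambda>i. z i \<omega>) = busy_reward 0 1 (zpath \<omega>) (path \<omega>)"
  by (rule eventually_mono[OF AE_nonneg]; simp add: num_processed_eq zpath_def path_def)+

lemma busy_reward_measurable_Q [measurable]:
  "(\<lambda>\<omega>. busy_reward u v (zpath \<omega>) (path \<omega>)) \<in> borel_measurable Q"
  by (intro measurable_busy_reward zpath_Q path_Q)

lemma nn_integral_processed:
  "(\<integral>\<^sup>+\<omega>. num_processed (\<lambda>i. a i \<omega>) (\<lambda>i. s i \<omega>) (\<lambda>i. z i \<omega>) \<partial>Q) = mean_processed"
proof -
  have "(\<integral>\<^sup>+\<omega>. num_processed (\<lambda>i. a i \<omega>) (\<lambda>i. s i \<omega>) (\<lambda>i. z i \<omega>) \<partial>Q) =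
      (\<integral>\<^sup>+\<omega>. 1 + busy_reward 1 0 (zpath \<omega>) (path \<omega>) \<partial>Q)"
    by (rule nn_integral_cong_AE[OF num_AE(1)])
  then show ?thesis
    by (simp add: nn_integral_add emeasure_space_1 nn_integral_busy_reward_Q mean_processed_def)
qed

lemma measurable_start_total:
  "(\<lambda>\<omega>. start (total_reward u v (\<lambda>i. z (Suc i) \<omega>))) \<in> borel_measurable Q"
proof -
  have "(\<lambda>\<omega>. \<integral>\<^sup>+w. busy_reward u v (zpath \<omega>) w \<partial>steps) \<in> borel_measurable Q"
    using zpath_Q
    by (intro steps.borel_measurable_nn_integral)
      (auto simp: split_beta' measurable_cong_sets[OF refl sets_steps[symmetric]]
        intro!: measurable_busy_reward measurable_compose[OF measurable_fst])
  then show ?thesis by (simp add: nn_integral_busy_reward zpath_def)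
qed

lemma nn_integral_arrivals:
  "(\<integral>\<^sup>+\<omega>. num_refused (\<lambda>i. a i \<omega>) (\<lambda>i. s i \<omega>) (\<lambda>i. z i \<omega>) \<partial>Q) + mean_processed =
   1 + ennreal (rho 1 lam B) * mean_processed"
proof -
  let ?S = "\<lambda>\<omega>. start (total_reward 1 0 (\<lambda>i. z (Suc i) \<omega>))" and ?r = "ennreal (rho 1 lam B)"
  have "(\<integral>\<^sup>+\<omega>. num_refused (\<lambda>i. a i \<omega>) (\<lambda>i. s i \<omega>) (\<lambda>i. z i \<omega>) \<partial>Q) + mean_processed =
     (\<integral>\<^sup>+\<omega>. busy_reward 0 1 (zpath \<omega>) (path \<omega>) \<partial>Q) + (1 + (\<integral>\<^sup>+\<omega>. busy_reward 1 0 (zpath \<omega>) (path \<omega>) \<partial>Q))"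
    by (simp only: nn_integral_cong_AE[OF num_AE(2)] mean_processed_def nn_integral_busy_reward_Q)
  also have "\<dots> = 1 + (\<integral>\<^sup>+\<omega>. busy_reward 1 0 (zpath \<omega>) (path \<omega>) + busy_reward 0 1 (zpath \<omega>) (path \<omega>) \<partial>Q)"
    by (simp add: nn_integral_add ac_simps)
  also have "\<dots> = 1 + (\<integral>\<^sup>+\<omega>. busy_reward 1 1 (zpath \<omega>) (path \<omega>) \<partial>Q)"
    by (simp flip: busy_reward_add)
  also have "\<dots> = 1 + (\<integral>\<^sup>+\<omega>. ?r + ?r * ?S \<omega> \<partial>Q)"
    using service_mean by (simp add: nn_integral_busy_reward_Q start_arrivals)
  also have "(\<integral>\<^sup>+\<omega>. ?r + ?r * ?S \<omega> \<partial>Q) = ?r * mean_processed"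
  proof -
    note [measurable] = measurable_start_total[of 1 0]
    show ?thesis
      by (simp add: nn_integral_add nn_integral_cmult emeasure_space_1 mean_processed_def distrib_left)
  qed
  finally show ?thesis .
qed

text \<open>
  Whether message \<open>i\<close> is processed in the busy period is determined by the traffic and the places,
  hence independent of its mark.
\<close>

lemma nn_integral_lost:
  "(\<integral>\<^sup>+\<omega>. num_lost (\<lambda>i. a i \<omega>) (\<lambda>i. s i \<omega>) (\<lambda>i. z i \<omega>) (\<lambda>i. mark i \<omega>) \<partial>Q) =
   (\<integral>\<^sup>+\<omega>. num_refused (\<lambda>i. a i \<omega>) (\<lambda>i. s i \<omega>) (\<lambda>i. z i \<omega>) \<partial>Q) + ennreal p * mean_processed"
proof -
  let ?J = "insert Places traffic"
  define C where "C = (\<lambda>i \<omega>. (\<forall>j. 0 < j \<and> j \<le> i \<longrightarrow> queue (zpath \<omega>) (path \<omega>) [] j \<noteq> []) \<and>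
      length (queue (zpath \<omega>) (path \<omega>) [] i) \<le> zpath \<omega> i)"
  have zm [measurable]: "(\<lambda>\<omega>. zpath \<omega> i) \<in> measurable (known ?J) (count_space UNIV)" for i
    using measurable_compose[OF zpath_known[of ?J] measurable_component_singleton[of i]] by simp
  have pm [measurable]: "(\<lambda>\<omega>. path \<omega> i) \<in> measurable (known ?J) (borel \<Otimes>\<^sub>M borel)" for i
    using measurable_compose[OF path_known[of ?J] measurable_component_singleton[of i]] by auto
  have qm [measurable]: "(\<lambda>\<omega>. queue (zpath \<omega>) (path \<omega>) [] i) \<in> measurable (known ?J) list_borel" for i
  proof (induction i)
    case (Suc i)
    note [measurable] = Suc
    show ?case by simp
  qed simp
  have Cm: "{\<omega> \<in> space Q. C i \<omega>} \<in> sets (known ?J)" for i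
  proof -
    have "Measurable.pred (known ?J) (C i)" unfolding C_def by measurable
    then show ?thesis by (simp add: pred_def)
  qed
  have Mm: "{\<omega> \<in> space Q. mark i \<omega>} \<in> sets (known {Mark i})" for i
    using known_measurable(3)[of i "{Mark i}"] by (simp add: pred_def)
  have ind: "emeasure Q {\<omega> \<in> space Q. C i \<omega> \<and> mark i \<omega>} = ennreal p * emeasure Q {\<omega> \<in> space Q. C i \<omega>}" for i
  proof -
    have "prob ({\<omega> \<in> space Q. C i \<omega>} \<inter> {\<omega> \<in> space Q. mark i \<omega>}) = prob {\<omega> \<in> space Q. C i \<omega>} * p"
      by (subst prob_known_Int[OF _ Cm Mm]) (auto simp: marks)
    moreover have "{\<omega> \<in> space Q. C i \<omega>} \<inter> {\<omega> \<in> space Q. mark i \<omega>} = {\<omega> \<in> space Q. C i \<omega> \<and> mark i \<omega>}" by auto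
    ultimately show ?thesis using mark_prob_bounds by (simp add: emeasure_eq_measure ennreal_mult' mult.commute)
  qed
  have CQ [measurable]: "Measurable.pred Q (C i)" for i
    using Cm[of i] sets_known_subset by (auto simp: pred_def)
  have MQ [measurable]: "Measurable.pred Q (mark i)" for i
    using marks by simp
  have eq: "AE \<omega> in Q. \<forall>i. (in_busy_period (\<lambda>i. a i \<omega>) (\<lambda>i. s i \<omega>) (\<lambda>i. z i \<omega>) i \<and>
      \<not> refused (\<lambda>i. a i \<omega>) (\<lambda>i. s i \<omega>) (\<lambda>i. z i \<omega>) i) = C i \<omega>"
    by (rule eventually_mono[OF AE_nonneg])
      (auto simp: in_busy_period_def refused_def number_before_eq C_def zpath_def path_def)
  have ind_eq: "of_bool (P \<omega>) = (indicator {\<omega> \<in> space Q. P \<omega>} \<omega> :: ennreal)" if "\<omega> \<in> space Q" for P \<omega>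
    using that by (simp add: indicator_def)
  let ?M = "\<lambda>\<omega>. \<Sum>i. indicator {\<omega> \<in> space Q. C i \<omega> \<and> mark i \<omega>} \<omega> :: ennreal"
  have "(\<integral>\<^sup>+\<omega>. num_lost (\<lambda>i. a i \<omega>) (\<lambda>i. s i \<omega>) (\<lambda>i. z i \<omega>) (\<lambda>i. mark i \<omega>) \<partial>Q) =
      (\<integral>\<^sup>+\<omega>. busy_reward 0 1 (zpath \<omega>) (path \<omega>) + ?M \<omega> \<partial>Q)"
  proof (rule nn_integral_cong_AE)
    from eq num_AE(2) AE_space
    show "AE \<omega> in Q. num_lost (\<lambda>i. a i \<omega>) (\<lambda>i. s i \<omega>) (\<lambda>i. z i \<omega>) (\<lambda>i. mark i \<omega>) =
      busy_reward 0 1 (zpath \<omega>) (path \<omega>) + ?M \<omega>"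
    proof eventually_elim
      case (elim \<omega>)
      have "num_marked (\<lambda>i. a i \<omega>) (\<lambda>i. s i \<omega>) (\<lambda>i. z i \<omega>) (\<lambda>i. mark i \<omega>) = ?M \<omega>"
        unfolding num_marked_def
      proof (rule suminf_cong)
        fix i
        have "(in_busy_period (\<lambda>i. a i \<omega>) (\<lambda>i. s i \<omega>) (\<lambda>i. z i \<omega>) i \<and>
            \<not> refused (\<lambda>i. a i \<omega>) (\<lambda>i. s i \<omega>) (\<lambda>i. z i \<omega>) i \<and> mark i \<omega>) = (C i \<omega> \<and> mark i \<omega>)"
          using elim(1) by blast
        then show "of_bool (in_busy_period (\<lambda>i. a i \<omega>) (\<lambda>i. s i \<omega>) (\<lambda>i. z i \<omega>) i \<and>
            \<not> refused (\<lambda>i. a i \<omega>) (\<lambda>i. s i \<omega>) (\<lambda>i. z i \<omega>) i \<and> mark i \<omega>) =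
            (indicator {\<omega> \<in> space Q. C i \<omega> \<and> mark i \<omega>} \<omega> :: ennreal)"
          using ind_eq[of \<omega> "\<lambda>\<omega>. C i \<omega> \<and> mark i \<omega>", OF elim(3)] by (simp only:)
      qed
      then show ?case unfolding num_lost_def elim(2) by (simp only:)
    qed
  qed
  also have "\<dots> = (\<integral>\<^sup>+\<omega>. busy_reward 0 1 (zpath \<omega>) (path \<omega>) \<partial>Q) + (\<integral>\<^sup>+\<omega>. ?M \<omega> \<partial>Q)"
    by (rule nn_integral_add) measurable
  also have "(\<integral>\<^sup>+\<omega>. ?M \<omega> \<partial>Q) = (\<Sum>i. ennreal p * emeasure Q {\<omega> \<in> space Q. C i \<omega>})"
    by (subst nn_integral_suminf) (simp_all add: ind)
  also have "\<dots> = ennreal p * (\<Sum>i. emeasure Q {\<omega> \<in> space Q. C i \<omega>})"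
    by (rule ennreal_suminf_cmult)
  also have "(\<Sum>i. emeasure Q {\<omega> \<in> space Q. C i \<omega>}) = (\<integral>\<^sup>+\<omega>. (\<Sum>i. indicator {\<omega> \<in> space Q. C i \<omega>} \<omega>) \<partial>Q)"
    by (subst nn_integral_suminf) simp_all
  also have "\<dots> = mean_processed"
    unfolding nn_integral_processed[symmetric]
  proof (rule nn_integral_cong_AE)
    from eq AE_space
    show "AE \<omega> in Q. (\<Sum>i. indicator {\<omega> \<in> space Q. C i \<omega>} \<omega>) = num_processed (\<lambda>i. a i \<omega>) (\<lambda>i. s i \<omega>) (\<lambda>i. z i \<omega>)"
    proof eventually_elim
      case (elim \<omega>)
      then show ?case
        unfolding num_processed_def
        using ind_eq[OF elim(2), of "C i" for i] by (simp only:)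
    qed
  qed
  finally show ?thesis by (simp only: nn_integral_cong_AE[OF num_AE(2)])
qed

text \<open>
  Wald's identity eliminates the number of refused messages.
\<close>

theorem loss_probability_eq:
  assumes P: "mean_processed = ennreal P" "0 \<le> P"
  shows "loss_probability Q a s z mark = (1 + (rho 1 lam B - 1 + p) * P) / (1 + rho 1 lam B * P)"
proof -
  let ?R = "\<integral>\<^sup>+\<omega>. num_refused (\<lambda>i. a i \<omega>) (\<lambda>i. s i \<omega>) (\<lambda>i. z i \<omega>) \<partial>Q"
  have \<rho>: "0 < rho 1 lam B" using rate_pos service_mean by (simp add: rho_def)
  have R: "?R + ennreal P = ennreal (1 + rho 1 lam B * P)"
    using nn_integral_arrivals P \<rho> by (simp add: ennreal_mult)
  then obtain r where r: "?R = ennreal r" "0 \<le> r"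
    by (cases ?R) auto
  then have r_eq: "r = 1 + rho 1 lam B * P - P"
    using R P \<rho> by (simp add: ennreal_plus[symmetric] del: ennreal_plus)
  have "loss_probability Q a s z mark = enn2real ((?R + ennreal p * ennreal P) / (?R + ennreal P))"
    by (simp add: loss_probability_def nn_integral_lost nn_integral_processed P)
  also have "?R + ennreal p * ennreal P = ennreal (r + p * P)"
    using r P mark_prob_bounds by (simp add: ennreal_mult)
  also have "enn2real (ennreal (r + p * P) / (?R + ennreal P)) = (r + p * P) / (1 + rho 1 lam B * P)"
    unfolding R using r P \<rho> mark_prob_bounds by (subst divide_ennreal) (auto intro: add_pos_nonneg)
  finally show ?thesis by (simp add: r_eq algebra_simps)
qed

end

section \<open>From fixed to random numbers of waiting places\<close>

context loss_queue
begin

text \<open>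
  The bounds for fixed places are integrated over the places.  On the event that one of the first
  \<open>n\<close> numbers of places lies outside \<open>{lo..hi}\<close>, of probability at most \<open>n * \<pi>\<close>, the crude bound for a
  buffer of \<open>cap\<close> places is used; on the complement the survival of \<open>n\<close> arrivals costs
  the terms with \<open>G\<close> and \<open>\<beta>\<close>.
\<close>

theorem mean_processed_bounds:
  fixes U T G H \<beta> \<pi> :: real and n lo hi cap :: nat
  assumes cap: "AE \<omega> in Q. \<forall>i. z i \<omega> \<le> cap"
    and crude: "\<And>zz. (\<And>i. zz i \<le> cap) \<Longrightarrow> start (total_reward 1 0 zz) \<le> ennreal U"
    and truncated: "\<And>zz. (\<And>i. zz i \<le> cap) \<Longrightarrow> start (total_reward 1 0 zz) \<le>
        start (expected_reward 1 0 (\<lambda>_ _. 0) n zz) + ennreal G * start (alive n zz)"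
    and upper: "\<And>zz. (\<And>i. i < n \<Longrightarrow> zz i \<le> hi) \<Longrightarrow> start (expected_reward 1 0 (\<lambda>_ _. 0) n zz) \<le> ennreal T"
    and lower: "\<And>zz. (\<And>i. i < n \<Longrightarrow> lo \<le> zz i) \<Longrightarrow>
        ennreal H \<le> start (expected_reward 1 0 (\<lambda>_ _. 0) n zz) + ennreal \<beta> * start (alive n zz)"
    and bad: "\<And>i. prob {\<omega> \<in> space Q. \<not> (lo \<le> z i \<omega> \<and> z i \<omega> \<le> hi)} \<le> \<pi>"
    and n: "0 < n" and nonneg: "0 \<le> U" "0 \<le> T" "0 \<le> G" "0 \<le> H" "0 \<le> \<beta>"
  obtains P where "mean_processed = ennreal P" "0 \<le> P"
    "P \<le> 1 + T + G * (rho 1 lam B * (1 + U)) / n + U * (n * \<pi>)"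
    "1 + H - \<beta> * (rho 1 lam B * (1 + U)) / n - H * (n * \<pi>) \<le> P"
proof -
  let ?S = "\<lambda>\<omega>. start (total_reward 1 0 (\<lambda>i. z (Suc i) \<omega>))"
  let ?\<rho> = "rho 1 lam B"
  define A where "A = ?\<rho> * (1 + U) / n"
  define bd where "bd = {\<omega> \<in> space Q. \<exists>i<n. \<not> (lo \<le> z (Suc i) \<omega> \<and> z (Suc i) \<omega> \<le> hi)}"
  note [measurable] = places(1)
  have \<rho>: "0 < ?\<rho>" using rate_pos service_mean by (simp add: rho_def)
  have A: "0 \<le> A" using \<rho> nonneg by (simp add: A_def)
  have S_meas [measurable]: "?S \<in> borel_measurable Q"
    by (rule measurable_start_total)
  have alive: "start (alive n zz) \<le> ennreal A" if "\<And>i. zz i \<le> cap" for zz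
  proof -
    have "of_nat n * start (alive n zz) \<le> ennreal ?\<rho> + ennreal ?\<rho> * start (total_reward 1 0 zz)"
      by (rule start_alive_le) (use service_mean in simp)
    also have "\<dots> \<le> ennreal ?\<rho> + ennreal ?\<rho> * ennreal U"
      using crude[of zz] that by (intro add_left_mono mult_left_mono) auto
    also have "\<dots> = ennreal (?\<rho> * (1 + U))"
      using \<rho> nonneg by (simp add: ennreal_mult[symmetric] ennreal_plus[symmetric] distrib_left del: ennreal_plus)
    also have "?\<rho> * (1 + U) = real n * A" using n by (simp add: A_def)
    also have "\<dots> = of_nat n * ennreal A"
      using A by (simp add: ennreal_mult ennreal_of_nat_eq_real_of_nat)
    finally show ?thesis
      using n by (simp add: ennreal_mult_le_mult_iff)
  qed
  have bd_meas [measurable]: "bd \<in> events" unfolding bd_def by measurable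
  have bd_le: "prob bd \<le> n * \<pi>"
  proof -
    have "bd = (\<Union>i<n. {\<omega> \<in> space Q. \<not> (lo \<le> z (Suc i) \<omega> \<and> z (Suc i) \<omega> \<le> hi)})"
      by (auto simp: bd_def)
    then have "prob bd \<le> (\<Sum>i<n. prob {\<omega> \<in> space Q. \<not> (lo \<le> z (Suc i) \<omega> \<and> z (Suc i) \<omega> \<le> hi)})"
      by (simp only:) (intro finite_measure_subadditive_finite, auto)
    also have "\<dots> \<le> (\<Sum>i<n. \<pi>)" by (intro sum_mono bad)
    finally show ?thesis by simp
  qed
  have upS: "AE \<omega> in Q. ?S \<omega> \<le> ennreal (T + G * A) + ennreal U * indicator bd \<omega>"
    using cap AE_space
  proof eventually_elim
    case (elim \<omega>)
    show ?case
    proof (cases "\<omega> \<in> bd")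
      case True
      have "?S \<omega> \<le> ennreal U" by (rule crude) (use elim in simp)
      then show ?thesis using True by (simp add: add_increasing)
    next
      case False
      have "?S \<omega> \<le> ennreal T + ennreal G * ennreal A"
        by (rule order_trans[OF truncated add_mono[OF upper mult_left_mono[OF alive]]])
          (use elim False in \<open>auto simp: bd_def\<close>)
      then show ?thesis using False nonneg A by (simp add: ennreal_mult)
    qed
  qed
  have lowS: "AE \<omega> in Q. ennreal (H - \<beta> * A) * indicator (space Q - bd) \<omega> \<le> ?S \<omega>"
    using cap AE_space
  proof eventually_elim
    case (elim \<omega>)
    show ?case
    proof (cases "\<omega> \<in> bd")
      case False
      let ?zz = "\<lambda>i. z (Suc i) \<omega>"
      have "ennreal H \<le> start (expected_reward 1 0 (\<lambda>_ _. 0) n ?zz) + ennreal \<beta> * start (alive n ?zz)"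
        by (rule lower) (use elim False in \<open>auto simp: bd_def\<close>)
      also have "\<dots> \<le> ?S \<omega> + ennreal \<beta> * ennreal A"
      proof (intro add_mono mult_left_mono alive)
        show "start (expected_reward 1 0 (\<lambda>_ _. 0) n ?zz) \<le> ?S \<omega>"
          by (intro start_mono) (auto simp: total_reward_def intro: SUP_upper)
      qed (use elim in auto)
      also have "\<dots> = ?S \<omega> + ennreal (\<beta> * A)" using nonneg A by (simp add: ennreal_mult)
      finally have "ennreal H - ennreal (\<beta> * A) \<le> ?S \<omega>"
        by (simp add: ennreal_minus_le_iff add.commute)
      then show ?thesis using False elim nonneg A by (simp add: ennreal_minus)
    qed simp
  qed
  let ?I = "\<integral>\<^sup>+\<omega>. ?S \<omega> \<partial>Q"
  have "?I \<le> (\<integral>\<^sup>+\<omega>. ennreal (T + G * A) + ennreal U * indicator bd \<omega> \<partial>Q)"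
    by (rule nn_integral_mono_AE[OF upS])
  also have "\<dots> = ennreal (T + G * A) + ennreal U * emeasure Q bd"
    by (simp add: nn_integral_add emeasure_space_1 nn_integral_cmult)
  also have "\<dots> = ennreal (T + G * A + U * prob bd)"
    using nonneg A by (simp add: emeasure_eq_measure ennreal_mult)
  finally have I_le: "?I \<le> ennreal (T + G * A + U * prob bd)" .
  then obtain x where x: "?I = ennreal x" "0 \<le> x"
    by (cases ?I) (auto simp: top_unique)
  have x_le: "x \<le> T + G * A + U * prob bd"
    using I_le[unfolded x(1)] nonneg A by (subst (asm) ennreal_le_iff) auto
  have "ennreal ((H - \<beta> * A) * (1 - prob bd)) = ennreal (H - \<beta> * A) * emeasure Q (space Q - bd)"
    by (simp add: emeasure_eq_measure prob_compl ennreal_mult'')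
  also have "\<dots> = (\<integral>\<^sup>+\<omega>. ennreal (H - \<beta> * A) * indicator (space Q - bd) \<omega> \<partial>Q)"
    by (simp add: nn_integral_cmult)
  also have "\<dots> \<le> ?I" by (rule nn_integral_mono_AE[OF lowS])
  finally have "(H - \<beta> * A) * (1 - prob bd) \<le> x"
    using x by (simp add: ennreal_le_iff)
  moreover have "H - \<beta> * A - H * prob bd \<le> (H - \<beta> * A) * (1 - prob bd)"
  proof -
    have "0 \<le> \<beta> * A * prob bd" using nonneg A by simp
    then show ?thesis by (simp add: algebra_simps)
  qed
  moreover have "H * prob bd \<le> H * (n * \<pi>)" "U * prob bd \<le> U * (n * \<pi>)"
    using bd_le nonneg by (auto intro!: mult_left_mono)
  ultimately have low: "H - \<beta> * A - H * (n * \<pi>) \<le> x" and up: "x \<le> T + G * A + U * (n * \<pi>)"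
    using x_le by linarith+
  show thesis
  proof (rule that)
    show "mean_processed = ennreal (1 + x)"
      using x by (simp add: mean_processed_def)
  qed (use x low up in \<open>simp_all add: A_def\<close>)
qed

text \<open>
  The same \<open>\<gamma>\<close> and \<open>\<kappa>\<close> serve the sharp bound at \<open>hi\<close> and the crude one at \<open>cap\<close>.  The condition on
  the second and third moments makes \<open>transform \<gamma>\<close> exceed \<open>1 - \<gamma>\<close>; for the lower bound the equality
  \<open>\<gamma>' * rho 2 = 2 * e\<close> gives the reverse inequality with no error term.
\<close>

lemma mean_processed_explicit_bounds:
  fixes e \<gamma> \<kappa> \<gamma>' \<pi> V T U G H b :: real and n lo hi cap :: nat
  assumes third: "integrable B (\<lambda>x. x ^ 3)"
    and load: "rho 1 lam B = 1 + e" and e: "0 < e"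
    and cap: "AE \<omega> in Q. \<forall>i. z i \<omega> \<le> cap"
    and \<gamma>: "0 < \<gamma>" "\<gamma> < 1" and \<kappa>: "0 < \<kappa>" "e \<le> \<gamma> * \<kappa>"
    and drift: "\<gamma>\<^sup>2 * rho 3 lam B / 6 \<le> \<gamma> * rho 2 lam B / 2 - e"
    and penalty: "\<gamma> * rho 3 lam B < 12 * \<kappa> * e"
    and \<gamma>': "0 < \<gamma>'" "\<gamma>' < 1" "\<gamma>' * rho 2 lam B = 2 * e"
    and bad: "\<And>i. prob {\<omega> \<in> space Q. \<not> (lo \<le> z i \<omega> \<and> z i \<omega> \<le> hi)} \<le> \<pi>"
    and n: "0 < n"
  defines "V \<equiv> 1 / (1 - \<gamma> / (4 * \<kappa> * e) * rho 3 lam B / 3)"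
  defines "T \<equiv> V * (1 + (1 + e) * (exp (\<gamma> * \<kappa>) / (1 - \<gamma>) ^ hi - 1) / e) - 1"
  defines "U \<equiv> V * (1 + (1 + e) * (exp (\<gamma> * \<kappa>) / (1 - \<gamma>) ^ cap - 1) / e) - 1"
  defines "G \<equiv> V * (exp (\<gamma> * \<kappa>) / (\<gamma> * e * (1 - \<gamma>) ^ cap)) + (V - 1) * cap + cap + 1"
  defines "H \<equiv> (1 / (1 - \<gamma>') ^ lo - 1) / e - 1"
  defines "b \<equiv> 1 / (\<gamma>' * e * (1 - \<gamma>') ^ lo)"
  assumes H: "0 \<le> H"
  obtains P where "mean_processed = ennreal P" "0 \<le> P"
    "P \<le> 1 + T + G * ((1 + e) * (1 + U)) / n + U * (n * \<pi>)"
    "1 + H - b * ((1 + e) * (1 + U)) / n - H * (n * \<pi>) \<le> P"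
proof -
  interpret O: overloaded_server lam B
    by unfold_locales (use third load e in auto)
  have ex: "O.excess = e" using load by (simp add: O.excess_def)
  have tr: "1 - \<gamma> \<le> O.transform \<gamma>"
  proof -
    have "\<gamma> * (\<gamma>\<^sup>2 * rho 3 lam B / 6) \<le> \<gamma> * (\<gamma> * rho 2 lam B / 2 - e)"
      using drift \<gamma> by (intro mult_left_mono) auto
    then show ?thesis
      using O.transform_ge(1)[of \<gamma>] \<gamma>
      unfolding load by (simp add: algebra_simps power2_eq_square power3_eq_cube)
  qed
  have tr': "O.transform \<gamma>' \<le> 1 - \<gamma>'"
  proof -
    have "\<gamma>'\<^sup>2 * rho 2 lam B / 2 = \<gamma>' * e"
      using \<gamma>'(3) by (simp add: power2_eq_square)
    then show ?thesis
      using O.transform_le[of \<gamma>'] \<gamma>' unfolding load by (simp add: algebra_simps)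
  qed
  interpret hi: overload_profile lam B \<gamma> \<kappa> hi
    by unfold_locales (use \<gamma> \<kappa> tr penalty in \<open>simp_all add: ex\<close>)
  interpret cap: overload_profile lam B \<gamma> \<kappa> cap
    by unfold_locales (use \<gamma> \<kappa> tr penalty in \<open>simp_all add: ex\<close>)
  have V: "hi.\<sigma> = V" "cap.\<sigma> = V"
    by (simp_all add: hi.\<sigma>_def cap.\<sigma>_def V_def hi.c_def cap.c_def ex)
  have TU: "hi.start_bound = T" "cap.start_bound = U"
    by (simp_all add: hi.start_bound_def cap.start_bound_def V T_def U_def ex load del: One_nat_def)
  have G: "cap.remaining_bound = G"
    by (simp add: cap.remaining_bound_def V G_def cap.\<beta>_def ex)
  have S1: "1 \<le> V" using hi.\<sigma>_ge_1 V by simp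
  have pos: "0 \<le> V * (1 + (1 + e) * (exp (\<gamma> * \<kappa>) / (1 - \<gamma>) ^ m - 1) / e) - 1" for m
  proof -
    have "1 \<le> exp (\<gamma> * \<kappa>) / (1 - \<gamma>) ^ m"
      using \<gamma> \<kappa> e by (simp add: le_divide_eq power_le_one order_trans[OF power_le_one])
    then have "1 * 1 \<le> V * (1 + (1 + e) * (exp (\<gamma> * \<kappa>) / (1 - \<gamma>) ^ m - 1) / e)"
      using S1 e by (intro mult_mono) auto
    then show ?thesis by simp
  qed
  have nn: "0 \<le> U" "0 \<le> T" "0 \<le> G" "0 \<le> b"
    using pos S1 \<gamma> \<gamma>' e by (auto simp: U_def T_def G_def b_def)
  show thesis
  proof (rule mean_processed_bounds[OF cap _ _ _ _ bad n nn(1,2,3) H nn(4)])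
    show "start (total_reward 1 0 zz) \<le> ennreal U" if "\<And>i. zz i \<le> cap" for zz
      using cap.start_total_le[of zz] that by (simp add: TU)
    show "start (total_reward 1 0 zz) \<le>
        start (expected_reward 1 0 (\<lambda>_ _. 0) n zz) + ennreal G * start (alive n zz)" if "\<And>i. zz i \<le> cap" for zz
      using cap.start_total_le_truncated[of zz n] that by (simp add: G)
    show "start (expected_reward 1 0 (\<lambda>_ _. 0) n zz) \<le> ennreal T" if "\<And>i. i < n \<Longrightarrow> zz i \<le> hi" for zz
      using hi.start_processed_le[of n zz] that by (simp add: TU)
    show "ennreal H \<le> start (expected_reward 1 0 (\<lambda>_ _. 0) n zz) + ennreal b * start (alive n zz)"
      if "\<And>i. i < n \<Longrightarrow> lo \<le> zz i" for zz
      using O.start_processed_ge[OF \<gamma>'(1,2) tr', of n lo zz] that by (simp add: H_def b_def ex)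
  qed (use that load in \<open>simp_all del: One_nat_def\<close>)
qed

end

section \<open>Concentration of the number of waiting places\<close>

context message_sizes
begin

abbreviation packets :: "nat \<Rightarrow> 'a \<Rightarrow> nat" where
  "packets m \<omega> \<equiv> (\<Sum>i<m. \<nu> i \<omega>)"

lemma packets_ge: "\<omega> \<in> space M \<Longrightarrow> m \<le> packets m \<omega>"
proof (induction m)
  case (Suc m)
  then show ?case using size_pos[of \<omega> m] by simp
qed simp

lemma packets_mono: "m \<le> m' \<Longrightarrow> packets m \<omega> \<le> packets m' \<omega>"
  by (intro sum_mono2) auto

lemma le_waiting_places_iff:
  assumes \<omega>: "\<omega> \<in> space M"
  shows "m \<le> waiting_places \<nu> N \<omega> \<longleftrightarrow> packets m \<omega> \<le> N"
proof -
  let ?S = "{m. packets m \<omega> \<le> N}"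
  have fin: "finite ?S"
    by (rule finite_subset[of _ "{..N}"]) (use packets_ge[OF \<omega>] order_trans in auto)
  have ne: "?S \<noteq> {}" by (auto intro: exI[of _ 0])
  have wp: "waiting_places \<nu> N \<omega> = Max ?S"
    unfolding waiting_places_def using cSup_eq_Max[OF fin ne] .
  show ?thesis
  proof
    assume "m \<le> waiting_places \<nu> N \<omega>"
    then have "packets m \<omega> \<le> packets (Max ?S) \<omega>" unfolding wp by (rule packets_mono)
    also have "\<dots> \<le> N" using Max_in[OF fin ne] by simp
    finally show "packets m \<omega> \<le> N" .
  next
    assume "packets m \<omega> \<le> N"
    then show "m \<le> waiting_places \<nu> N \<omega>" unfolding wp by (intro Max_ge fin) simp
  qed
qed

lemma waiting_places_le: "\<omega> \<in> space M \<Longrightarrow> waiting_places \<nu> N \<omega> \<le> N"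
  using le_waiting_places_iff[of \<omega> "waiting_places \<nu> N \<omega>" N] packets_ge[of \<omega> "waiting_places \<nu> N \<omega>"] by simp

lemma measurable_size [measurable]: "\<nu> i \<in> measurable M (count_space UNIV)"
  using size_iid(1) by (auto simp: indep_vars_def)

lemma measurable_packets [measurable]: "packets m \<in> measurable M (count_space UNIV)"
  by (induction m) simp_all

lemma pred_le_waiting_places [measurable]: "Measurable.pred M (\<lambda>\<omega>. m \<le> waiting_places \<nu> N \<omega>)"
proof -
  have "Measurable.pred M (\<lambda>\<omega>. packets m \<omega> \<le> N)" by measurable
  then show ?thesis
    by (rule measurable_cong[THEN iffD1, rotated]) (simp add: le_waiting_places_iff)
qed

lemma measurable_waiting_places [measurable]: "waiting_places \<nu> N \<in> measurable M (count_space UNIV)"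
proof (subst measurable_count_space_eq2_countable, safe)
  fix m
  have "waiting_places \<nu> N -` {m} \<inter> space M =
      {\<omega> \<in> space M. m \<le> waiting_places \<nu> N \<omega> \<and> \<not> Suc m \<le> waiting_places \<nu> N \<omega>}"
    by auto
  also have "\<dots> \<in> sets M" by measurable
  finally show "waiting_places \<nu> N -` {m} \<inter> space M \<in> sets M" .
qed simp_all

definition mean_size :: real where "mean_size = expectation (\<lambda>\<omega>. real (\<nu> 0 \<omega>))"
definition width :: real where "width = real \<nu>_upper + 1"

lemma width_pos: "0 < width" by (simp add: width_def)

lemma hoeffding:
  assumes "0 < m"
  shows "iid_interval_bounded_random_variables M {..<m} (\<lambda>i \<omega>. real (\<nu> i \<omega>)) (\<lambda>\<omega>. real (\<nu> 0 \<omega>)) 0 width"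
proof unfold_locales
  show "indep_vars (\<lambda>_. borel) (\<lambda>i \<omega>. real (\<nu> i \<omega>)) {..<m}"
    by (rule indep_vars_compose2[OF indep_vars_subset[OF size_iid(1)]]) auto
  show "distr M borel (\<lambda>\<omega>. real (\<nu> i \<omega>)) = distr M borel (\<lambda>\<omega>. real (\<nu> 0 \<omega>))" for i
  proof -
    have "distr M borel (\<lambda>\<omega>. real (\<nu> i \<omega>)) = distr (distr M (count_space UNIV) (\<nu> i)) borel real" for i
      by (subst distr_distr) (auto simp: comp_def)
    then show ?thesis using size_iid(2)[of i] by simp
  qed
  show "AE \<omega> in M. real (\<nu> 0 \<omega>) \<in> {0..width}"
    using size_bounds[of 0] by eventually_elim (simp add: width_def)
qed simp_all

lemma mean_size_pos: "0 < mean_size"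
proof -
  have int: "integrable M (\<lambda>\<omega>. real (\<nu> 0 \<omega>))"
    by (rule integrable_const_bound[where B = width])
      (rule eventually_mono[OF size_bounds[of 0]], auto simp: width_def)
  have "expectation (\<lambda>_. 1) \<le> mean_size"
    unfolding mean_size_def
  proof (rule integral_mono)
    fix \<omega> assume "\<omega> \<in> space M"
    then show "1 \<le> real (\<nu> 0 \<omega>)" using size_pos[of \<omega> 0] by simp
  qed (use int in auto)
  then show ?thesis by (simp add: prob_space)
qed

lemma packets_deviation:
  assumes m: "0 < m" and t: "0 \<le> t"
  shows "prob {\<omega> \<in> space M. real m * mean_size + t \<le> real (packets m \<omega>)} \<le> exp (- 2 * t\<^sup>2 / (real m * width\<^sup>2))"
    and "prob {\<omega> \<in> space M. real (packets m \<omega>) \<le> real m * mean_size - t} \<le> exp (- 2 * t\<^sup>2 / (real m * width\<^sup>2))"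
proof -
  interpret H: Hoeffding_ineq_iid M "{..<m}" "\<lambda>i \<omega>. real (\<nu> i \<omega>)" "\<lambda>\<omega>. real (\<nu> 0 \<omega>)" 0 width mean_size
    by (intro Hoeffding_ineq_iid.intro hoeffding[OF m]) (simp add: mean_size_def)
  show "prob {\<omega> \<in> space M. real m * mean_size + t \<le> real (packets m \<omega>)} \<le> exp (- 2 * t\<^sup>2 / (real m * width\<^sup>2))"
    using H.X.Hoeffding_ineq_ge[OF t] m width_pos by simp
  show "prob {\<omega> \<in> space M. real (packets m \<omega>) \<le> real m * mean_size - t} \<le> exp (- 2 * t\<^sup>2 / (real m * width\<^sup>2))"
    using H.X.Hoeffding_ineq_le[OF t] m width_pos by simp
qed

lemma exp_minus_2_less: "exp (- 2) < (1 / 2 :: real)"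
proof -
  have "(2::real) < 1 + 2" by simp
  also have "\<dots> \<le> exp 2" by (rule exp_ge_add_one_self)
  finally show ?thesis by (simp add: exp_minus field_simps)
qed

text \<open>
  If the event \<open>m \<le> waiting_places \<nu> N\<close> has probability below one half, then \<open>N\<close> cannot exceed the
  mean of the first \<open>m\<close> message sizes by more than their fluctuation, and conversely.  So the
  median of the number of places locates \<open>N\<close>.
\<close>

lemma median_deviation:
  assumes m: "0 < m"
  shows "prob {\<omega> \<in> space M. m \<le> waiting_places \<nu> N \<omega>} < 1 / 2 \<Longrightarrow> real N < real m * mean_size + width * sqrt m"
    and "prob {\<omega> \<in> space M. \<not> m \<le> waiting_places \<nu> N \<omega>} < 1 / 2 \<Longrightarrow> real m * mean_size - width * sqrt m < real N"
proof -
  let ?t = "width * sqrt m"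
  have t: "0 \<le> ?t" using width_pos by simp
  have e: "exp (- 2 * ?t\<^sup>2 / (real m * width\<^sup>2)) < 1 / 2"
    using m width_pos exp_minus_2_less by (simp add: power_mult_distrib)
  have compl: "prob {\<omega> \<in> space M. m \<le> waiting_places \<nu> N \<omega>} = 1 - prob {\<omega> \<in> space M. \<not> m \<le> waiting_places \<nu> N \<omega>}"
  proof -
    have "{\<omega> \<in> space M. m \<le> waiting_places \<nu> N \<omega>} = space M - {\<omega> \<in> space M. \<not> m \<le> waiting_places \<nu> N \<omega>}" by auto
    then show ?thesis by (simp add: prob_compl)
  qed
  show "real N < real m * mean_size + ?t" if "prob {\<omega> \<in> space M. m \<le> waiting_places \<nu> N \<omega>} < 1 / 2"
  proof (rule ccontr)
    assume "\<not> real N < real m * mean_size + ?t"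
    then have "prob {\<omega> \<in> space M. \<not> m \<le> waiting_places \<nu> N \<omega>} \<le> prob {\<omega> \<in> space M. real m * mean_size + ?t \<le> real (packets m \<omega>)}"
      by (intro finite_measure_mono) (auto simp: le_waiting_places_iff simp del: of_nat_sum)
    also have "\<dots> < 1 / 2" using packets_deviation(1)[OF m t] e by simp
    finally show False using compl that by simp
  qed
  show "real m * mean_size - ?t < real N" if "prob {\<omega> \<in> space M. \<not> m \<le> waiting_places \<nu> N \<omega>} < 1 / 2"
  proof (rule ccontr)
    assume "\<not> real m * mean_size - ?t < real N"
    then have "prob {\<omega> \<in> space M. m \<le> waiting_places \<nu> N \<omega>} \<le> prob {\<omega> \<in> space M. real (packets m \<omega>) \<le> real m * mean_size - ?t}"
      by (intro finite_measure_mono) (auto simp: le_waiting_places_iff simp del: of_nat_sum)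
    also have "\<dots> < 1 / 2" using packets_deviation(2)[OF m t] e by simp
    finally show False using compl that by simp
  qed
qed

lemma tail_deviation:
  assumes m: "0 < m" and t: "0 \<le> t"
  shows "real N \<le> real m * mean_size - t \<Longrightarrow>
      prob {\<omega> \<in> space M. m \<le> waiting_places \<nu> N \<omega>} \<le> exp (- 2 * t\<^sup>2 / (real m * width\<^sup>2))"
    and "real m * mean_size + t \<le> real N \<Longrightarrow>
      prob {\<omega> \<in> space M. \<not> m \<le> waiting_places \<nu> N \<omega>} \<le> exp (- 2 * t\<^sup>2 / (real m * width\<^sup>2))"
  subgoal
    by (rule order_trans[OF finite_measure_mono packets_deviation(2)[OF m t]])
      (auto simp: le_waiting_places_iff simp del: of_nat_sum)
  subgoal
    by (rule order_trans[OF finite_measure_mono packets_deviation(1)[OF m t]])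
      (auto simp: le_waiting_places_iff simp del: of_nat_sum)
  done

lemma prob_far_tendsto_0:
  assumes conv: "AE \<omega> in M. (\<lambda>N. \<epsilon> N * real (waiting_places \<nu> N \<omega>)) \<longlonglongrightarrow> C" and \<delta>: "0 < \<delta>"
  shows "(\<lambda>N. prob {\<omega> \<in> space M. \<delta> < \<bar>\<epsilon> N * real (waiting_places \<nu> N \<omega>) - C\<bar>}) \<longlonglongrightarrow> 0"
proof -
  let ?A = "\<lambda>N. {\<omega> \<in> space M. \<delta> < \<bar>\<epsilon> N * real (waiting_places \<nu> N \<omega>) - C\<bar>}"
  have "(\<lambda>N. expectation (indicator (?A N))) \<longlonglongrightarrow> expectation (\<lambda>_. 0 :: real)"
  proof (rule integral_dominated_convergence[where w = "\<lambda>_. 1"])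
    show "AE \<omega> in M. (\<lambda>N. indicator (?A N) \<omega> :: real) \<longlonglongrightarrow> 0"
      using conv
    proof eventually_elim
      case (elim \<omega>)
      from tendstoD[OF elim \<delta>]
      have "\<forall>\<^sub>F N in sequentially. indicator (?A N) \<omega> = (0 :: real)"
        by eventually_elim (simp add: dist_real_def indicator_def)
      then show ?case by (rule tendsto_eventually)
    qed
  qed (auto simp: indicator_def)
  then show ?thesis by simp
qed

text \<open>
  Almost sure convergence locates the median of the number of places within \<open>\<eta> / 2\<close> of \<open>C\<close> on
  the scale \<open>1 / \<epsilon>\<close>, hence \<open>N\<close> up to an error of order \<open>sqrt (1 / \<epsilon>)\<close> in terms of the mean size.
  Hoeffding's inequality then makes deviations by \<open>\<eta>\<close> exponentially unlikely in \<open>1 / \<epsilon>\<close>.  Convergence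
  in probability alone would not do: about \<open>1 / \<epsilon>\<close> messages arrive in a busy period, and
  refusing even a proportion \<open>\<epsilon>\<close> of them changes the limit.
\<close>

theorem waiting_places_concentrated:
  fixes \<epsilon> :: "nat \<Rightarrow> real"
  assumes pos: "\<And>N. 0 < \<epsilon> N" and lim: "\<epsilon> \<longlonglongrightarrow> 0" and \<eta>: "0 < \<eta>" "\<eta> < C"
    and conv: "AE \<omega> in M. (\<lambda>N. \<epsilon> N * real (waiting_places \<nu> N \<omega>)) \<longlonglongrightarrow> C"
  obtains c K where "0 < c" "0 < K"
    and "\<forall>\<^sub>F N in sequentially.
      prob {\<omega> \<in> space M. \<not> (C - \<eta> \<le> \<epsilon> N * real (waiting_places \<nu> N \<omega>) \<and> \<epsilon> N * real (waiting_places \<nu> N \<omega>) \<le> C + \<eta>)}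
        \<le> 2 * exp (- c / \<epsilon> N)"
    and "\<forall>\<^sub>F N in sequentially. \<epsilon> N * real N \<le> K"
proof -
  define \<delta> where "\<delta> = \<eta> / 2"
  define a where "a = \<delta> * mean_size / 2"
  define c where "c = 2 * a\<^sup>2 / ((C + \<eta> + 1) * width\<^sup>2)"
  define K where "K = (C + \<eta> + 1) * (mean_size + width)"
  have \<delta>: "0 < \<delta>" and a: "0 < a" using \<eta> mean_size_pos by (simp_all add: \<delta>_def a_def)
  have c: "0 < c" using a \<eta> width_pos by (simp add: c_def)
  have K: "0 < K" using \<eta> width_pos mean_size_pos by (simp add: K_def)
  let ?far = "\<lambda>N. {\<omega> \<in> space M. \<delta> < \<bar>\<epsilon> N * real (waiting_places \<nu> N \<omega>) - C\<bar>}"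
  have ev1: "\<forall>\<^sub>F N in sequentially. prob (?far N) < 1 / 2"
    using order_tendstoD(2)[OF prob_far_tendsto_0[OF conv \<delta>], of "1 / 2"] by simp
  have "(\<lambda>N. mean_size * \<epsilon> N + width * sqrt (\<epsilon> N * (C + \<eta>) + (\<epsilon> N)\<^sup>2)) \<longlonglongrightarrow>
      mean_size * 0 + width * sqrt (0 * (C + \<eta>) + 0\<^sup>2)"
    by (intro tendsto_intros lim)
  then have ev2: "\<forall>\<^sub>F N in sequentially. mean_size * \<epsilon> N + width * sqrt (\<epsilon> N * (C + \<eta>) + (\<epsilon> N)\<^sup>2) < a"
    using order_tendstoD(2) a by fastforce
  have ev3: "\<forall>\<^sub>F N in sequentially. \<epsilon> N < 1"
    using order_tendstoD(2)[OF lim] by simp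
  have main: "prob {\<omega> \<in> space M. \<not> (C - \<eta> \<le> \<epsilon> N * real (waiting_places \<nu> N \<omega>) \<and> \<epsilon> N * real (waiting_places \<nu> N \<omega>) \<le> C + \<eta>)}
        \<le> 2 * exp (- c / \<epsilon> N) \<and> \<epsilon> N * real N \<le> K"
    if far: "prob (?far N) < 1 / 2" and small: "mean_size * \<epsilon> N + width * sqrt (\<epsilon> N * (C + \<eta>) + (\<epsilon> N)\<^sup>2) < a"
      and e1: "\<epsilon> N < 1" for N
  proof -
    let ?e = "\<epsilon> N" and ?w = "\<lambda>\<omega>. waiting_places \<nu> N \<omega>"
    have e: "0 < ?e" by (rule pos)
    have noise: "mean_size + width * sqrt ((C + \<eta>) / ?e + 1) \<le> a / ?e"
    proof -
      have "sqrt ((C + \<eta>) / ?e + 1) * ?e = sqrt (((C + \<eta>) / ?e + 1) * ?e\<^sup>2)"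
        using e by (simp add: real_sqrt_mult)
      also have "((C + \<eta>) / ?e + 1) * ?e\<^sup>2 = ?e * (C + \<eta>) + ?e\<^sup>2"
        using e by (simp add: field_simps power2_eq_square)
      finally have "(mean_size + width * sqrt ((C + \<eta>) / ?e + 1)) * ?e \<le> a"
        using small by (simp add: distrib_right mult.assoc)
      then show ?thesis using e by (simp add: pos_le_divide_eq)
    qed
    have gain: "\<delta> * mean_size / ?e = 2 * (a / ?e)" by (simp add: a_def)
    have decay: "exp (- 2 * (a / ?e)\<^sup>2 / (real m * width\<^sup>2)) \<le> exp (- c / ?e)"
      if m: "0 < m" "real m \<le> (C + \<eta>) / ?e + 1" for m
    proof -
      have "real m * ?e \<le> C + \<eta> + ?e" using m(2) e by (simp add: field_simps)
      then have "real m * ?e \<le> C + \<eta> + 1" using e1 by simp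
      then have "c \<le> 2 * a\<^sup>2 / (real m * ?e * width\<^sup>2)"
        unfolding c_def using m(1) e \<eta> width_pos by (intro divide_left_mono mult_right_mono mult_pos_pos) auto
      then have "c / ?e \<le> 2 * a\<^sup>2 / (real m * ?e * width\<^sup>2) / ?e"
        using e by (intro divide_right_mono) auto
      also have "\<dots> = 2 * (a / ?e)\<^sup>2 / (real m * width\<^sup>2)"
        using e by (simp add: power_divide power2_eq_square mult_ac)
      finally show ?thesis by simp
    qed
    \<comment> \<open>\<open>m1\<close> and \<open>m2\<close> are the least numbers above \<open>(C + \<delta>) / \<epsilon>\<close> and \<open>(C + \<eta>) / \<epsilon>\<close>: the first
      bounds the median, the second is exceeded by a large deviation\<close>
    define m1 where "m1 = nat \<lfloor>(C + \<delta>) / ?e\<rfloor> + 1"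
    define m2 where "m2 = nat \<lfloor>(C + \<eta>) / ?e\<rfloor> + 1"
    have q1: "0 \<le> (C + \<delta>) / ?e" and q2: "0 \<le> (C + \<eta>) / ?e" using \<eta> \<delta> e by auto
    have m1: "0 < m1" "(C + \<delta>) / ?e < real m1" "real m1 \<le> (C + \<delta>) / ?e + 1"
      using q1 by (auto simp: m1_def of_nat_nat) linarith+
    have m2: "0 < m2" "(C + \<eta>) / ?e < real m2" "real m2 \<le> (C + \<eta>) / ?e + 1"
      using q2 by (auto simp: m2_def of_nat_nat) linarith+
    have "prob {\<omega> \<in> space M. m1 \<le> ?w \<omega>} \<le> prob (?far N)"
    proof (rule finite_measure_mono)
      show "{\<omega> \<in> space M. m1 \<le> ?w \<omega>} \<subseteq> ?far N"
      proof safe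
        fix \<omega> assume "m1 \<le> ?w \<omega>"
        then have "(C + \<delta>) / ?e < real (?w \<omega>)" using m1(2) by (meson of_nat_mono less_le_trans)
        then have "C + \<delta> < ?e * real (?w \<omega>)" using e by (simp add: divide_less_eq mult.commute)
        then show "\<delta> < \<bar>?e * real (?w \<omega>) - C\<bar>" by simp
      qed
    qed measurable
    then have N1: "real N < real m1 * mean_size + width * sqrt m1"
      using far by (intro median_deviation(1) m1(1)) simp
    have s1: "sqrt m1 \<le> sqrt ((C + \<eta>) / ?e + 1)"
    proof -
      have "(C + \<delta>) / ?e \<le> (C + \<eta>) / ?e" using e \<delta>_def \<eta> by (intro divide_right_mono) auto
      then show ?thesis using m1(3) by simp
    qed
    have p1: "prob {\<omega> \<in> space M. m2 \<le> ?w \<omega>} \<le> exp (- c / ?e)"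
    proof -
      have "real m2 - real m1 \<ge> \<delta> / ?e - 1"
      proof -
        have "(C + \<eta>) / ?e - (C + \<delta>) / ?e = \<delta> / ?e" by (simp add: \<delta>_def diff_divide_distrib[symmetric])
        then show ?thesis using m1(3) m2(2) by linarith
      qed
      from mult_right_mono[OF this, of mean_size]
      have "2 * (a / ?e) - mean_size \<le> real m2 * mean_size - real m1 * mean_size"
        using mean_size_pos gain by (simp add: left_diff_distrib)
      moreover have "width * sqrt m1 \<le> width * sqrt ((C + \<eta>) / ?e + 1)"
        using s1 width_pos by (intro mult_left_mono) auto
      ultimately have "real N \<le> real m2 * mean_size - a / ?e" using N1 noise by linarith
      from tail_deviation(1)[OF m2(1) _ this] show ?thesis
        using order_trans[OF _ decay[OF m2(1) m2(3)]] a e by simp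
    qed
    have NK: "?e * real N \<le> K"
    proof -
      have "sqrt m1 \<le> real m1" using m1(1) self_le_power[of "real m1" 2] by (intro real_le_lsqrt) auto
      then have "width * sqrt m1 \<le> width * real m1"
        by (rule mult_left_mono) (use width_pos in simp)
      moreover have "real m1 * (mean_size + width) = real m1 * mean_size + width * real m1"
        by (simp add: algebra_simps)
      ultimately have "real N \<le> real m1 * (mean_size + width)" using N1 by linarith
      then have "?e * real N \<le> ?e * real m1 * (mean_size + width)"
        using e by (simp add: mult.assoc)
      also have "?e * real m1 \<le> C + \<eta> + 1"
      proof -
        have "?e * real m1 \<le> ?e * ((C + \<delta>) / ?e + 1)" using m1(3) e by (intro mult_left_mono) auto
        also have "\<dots> = C + \<delta> + ?e" using e by (simp add: field_simps)
        also have "\<dots> \<le> C + \<eta> + 1" using e1 \<eta> by (simp add: \<delta>_def)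
        finally show ?thesis .
      qed
      finally show ?thesis
        using mean_size_pos width_pos by (simp add: K_def mult_right_mono)
    qed
    \<comment> \<open>the same below \<open>C\<close>\<close>
    define m3 where "m3 = nat \<lceil>(C - \<delta>) / ?e\<rceil>"
    define m4 where "m4 = nat \<lceil>(C - \<eta>) / ?e\<rceil>"
    have q3: "0 < (C - \<delta>) / ?e" and q4: "0 < (C - \<eta>) / ?e" using \<eta> e by (auto simp: \<delta>_def)
    have m3: "0 < m3" "(C - \<delta>) / ?e \<le> real m3" "real m3 < (C - \<delta>) / ?e + 1"
      using q3 by (auto simp: m3_def of_nat_nat) linarith+
    have m4: "0 < m4" "(C - \<eta>) / ?e \<le> real m4" "real m4 < (C - \<eta>) / ?e + 1"
      using q4 by (auto simp: m4_def of_nat_nat) linarith+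
    have "prob {\<omega> \<in> space M. \<not> m3 \<le> ?w \<omega>} \<le> prob (?far N)"
    proof (rule finite_measure_mono)
      show "{\<omega> \<in> space M. \<not> m3 \<le> ?w \<omega>} \<subseteq> ?far N"
      proof safe
        fix \<omega> assume "\<not> m3 \<le> ?w \<omega>"
        then have "real (?w \<omega>) + 1 \<le> real m3" by linarith
        then have "real (?w \<omega>) < (C - \<delta>) / ?e" using m3(3) by linarith
        then have "?e * real (?w \<omega>) < C - \<delta>" using e by (simp add: less_divide_eq mult.commute)
        then show "\<delta> < \<bar>?e * real (?w \<omega>) - C\<bar>" by simp
      qed
    qed measurable
    then have N2: "real m3 * mean_size - width * sqrt m3 < real N"
      using far by (intro median_deviation(2) m3(1)) simp
    have p2: "prob {\<omega> \<in> space M. \<not> m4 \<le> ?w \<omega>} \<le> exp (- c / ?e)"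
    proof -
      have le: "(C - \<delta>) / ?e \<le> (C + \<eta>) / ?e" "(C - \<eta>) / ?e \<le> (C + \<eta>) / ?e"
        using e \<delta> \<eta> by (auto intro!: divide_right_mono)
      have "real m3 - real m4 \<ge> \<delta> / ?e - 1"
      proof -
        have "(C - \<delta>) / ?e - (C - \<eta>) / ?e = \<delta> / ?e" by (simp add: \<delta>_def diff_divide_distrib[symmetric])
        then show ?thesis using m3(2) m4(3) by linarith
      qed
      from mult_right_mono[OF this, of mean_size]
      have "2 * (a / ?e) - mean_size \<le> real m3 * mean_size - real m4 * mean_size"
        using mean_size_pos gain by (simp add: left_diff_distrib)
      moreover have "width * sqrt m3 \<le> width * sqrt ((C + \<eta>) / ?e + 1)"
        using m3(3) le width_pos by (intro mult_left_mono) auto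
      ultimately have "real m4 * mean_size + a / ?e \<le> real N" using N2 noise by linarith
      from tail_deviation(2)[OF m4(1) _ this] show ?thesis
        using order_trans[OF _ decay[OF m4(1)]] m4(3) le a e by simp
    qed
    have "prob {\<omega> \<in> space M. \<not> (C - \<eta> \<le> ?e * real (?w \<omega>) \<and> ?e * real (?w \<omega>) \<le> C + \<eta>)}
      \<le> prob ({\<omega> \<in> space M. \<not> m4 \<le> ?w \<omega>} \<union> {\<omega> \<in> space M. m2 \<le> ?w \<omega>})"
    proof (rule finite_measure_mono)
      show "{\<omega> \<in> space M. \<not> (C - \<eta> \<le> ?e * real (?w \<omega>) \<and> ?e * real (?w \<omega>) \<le> C + \<eta>)}
        \<subseteq> {\<omega> \<in> space M. \<not> m4 \<le> ?w \<omega>} \<union> {\<omega> \<in> space M. m2 \<le> ?w \<omega>}"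
      proof (rule subsetI, rule ccontr)
        fix \<omega>
        assume \<omega>: "\<omega> \<in> {\<omega> \<in> space M. \<not> (C - \<eta> \<le> ?e * real (?w \<omega>) \<and> ?e * real (?w \<omega>) \<le> C + \<eta>)}"
          and "\<omega> \<notin> {\<omega> \<in> space M. \<not> m4 \<le> ?w \<omega>} \<union> {\<omega> \<in> space M. m2 \<le> ?w \<omega>}"
        then have "m4 \<le> ?w \<omega>" "\<not> m2 \<le> ?w \<omega>" by auto
        then have "real m4 \<le> real (?w \<omega>)" "real (?w \<omega>) + 1 \<le> real m2" by linarith+
        then have "(C - \<eta>) / ?e \<le> real (?w \<omega>)" "real (?w \<omega>) \<le> (C + \<eta>) / ?e"
          using m4(2) m2(3) by linarith+
        then show False using \<omega> e by (simp add: divide_le_eq le_divide_eq mult.commute)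
      qed
    qed measurable
    also have "\<dots> \<le> prob {\<omega> \<in> space M. \<not> m4 \<le> ?w \<omega>} + prob {\<omega> \<in> space M. m2 \<le> ?w \<omega>}"
      by (rule measure_Un_le) measurable
    finally show ?thesis using p1 p2 NK by simp
  qed
  show thesis
  proof (rule that[OF c K])
    show "\<forall>\<^sub>F N in sequentially.
      prob {\<omega> \<in> space M. \<not> (C - \<eta> \<le> \<epsilon> N * real (waiting_places \<nu> N \<omega>) \<and> \<epsilon> N * real (waiting_places \<nu> N \<omega>) \<le> C + \<eta>)}
        \<le> 2 * exp (- c / \<epsilon> N)"
      using ev1 ev2 ev3 by eventually_elim (rule main[THEN conjunct1])
    show "\<forall>\<^sub>F N in sequentially. \<epsilon> N * real N \<le> K"
      using ev1 ev2 ev3 by eventually_elim (rule main[THEN conjunct2])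
  qed
qed

end

section \<open>The heavy-traffic limit\<close>

lemma one_minus_power_tendsto:
  fixes x :: "nat \<Rightarrow> real" and k :: "nat \<Rightarrow> nat"
  assumes x: "x \<longlonglongrightarrow> 0" "\<And>N. 0 \<le> x N" and xk: "(\<lambda>N. x N * real (k N)) \<longlonglongrightarrow> l"
  shows "(\<lambda>N. (1 - x N) ^ k N) \<longlonglongrightarrow> exp (- l)"
proof -
  have small: "\<forall>\<^sub>F N in sequentially. x N < 1 / 2"
    using order_tendstoD(2)[OF x(1), of "1 / 2"] by simp
  have "(\<lambda>N. real (k N) * ln (1 - x N)) \<longlonglongrightarrow> - l"
  proof (rule tendsto_sandwich)
    have "(\<lambda>N. - (x N * real (k N)) - 2 * x N * (x N * real (k N))) \<longlonglongrightarrow> - l - 2 * 0 * l"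
      by (intro tendsto_intros x xk)
    then show "(\<lambda>N. - (x N * real (k N)) - 2 * x N * (x N * real (k N))) \<longlonglongrightarrow> - l" by simp
    show "(\<lambda>N. - (x N * real (k N))) \<longlonglongrightarrow> - l" by (intro tendsto_intros xk)
    show "\<forall>\<^sub>F N in sequentially. - (x N * real (k N)) - 2 * x N * (x N * real (k N)) \<le> real (k N) * ln (1 - x N)"
      using small
    proof eventually_elim
      case (elim N)
      have "real (k N) * (- x N - 2 * (x N)\<^sup>2) \<le> real (k N) * ln (1 - x N)"
        by (intro mult_left_mono ln_one_minus_pos_lower_bound) (use x elim in auto)
      then show ?case by (simp add: algebra_simps power2_eq_square)
    qed
    show "\<forall>\<^sub>F N in sequentially. real (k N) * ln (1 - x N) \<le> - (x N * real (k N))"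
      using small
    proof eventually_elim
      case (elim N)
      have "real (k N) * ln (1 - x N) \<le> real (k N) * (- x N)"
        by (intro mult_left_mono ln_one_minus_pos_upper_bound) (use x elim in auto)
      then show ?case by (simp add: mult.commute)
    qed
  qed
  then have "(\<lambda>N. exp (real (k N) * ln (1 - x N))) \<longlonglongrightarrow> exp (- l)" by (rule tendsto_exp)
  moreover have "\<forall>\<^sub>F N in sequentially. exp (real (k N) * ln (1 - x N)) = (1 - x N) ^ k N"
    using small by eventually_elim (simp add: exp_of_nat_mult)
  ultimately show ?thesis by (rule Lim_transform_eventually)
qed

lemma one_minus_power_ge:
  fixes x :: real
  assumes x: "0 \<le> x" "x \<le> 1 / 2" and xk: "x * real k \<le> l"
  shows "exp (- 2 * l) \<le> (1 - x) ^ k"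
proof -
  have "- 2 * x \<le> - x - 2 * x\<^sup>2"
    using x mult_left_mono[of x "1 / 2" x] by (simp add: power2_eq_square)
  also have "\<dots> \<le> ln (1 - x)" by (rule ln_one_minus_pos_lower_bound[OF x])
  finally have "real k * (- 2 * x) \<le> real k * ln (1 - x)" by (intro mult_left_mono) auto
  then have "- 2 * l \<le> real k * ln (1 - x)" using xk by (simp add: mult_ac)
  then have "exp (- 2 * l) \<le> exp (real k * ln (1 - x))" by simp
  also have "\<dots> = (1 - x) ^ k" using x by (simp add: exp_of_nat_mult)
  finally show ?thesis .
qed

lemma floor_tendsto:
  fixes e :: "nat \<Rightarrow> real"
  assumes e: "e \<longlonglongrightarrow> 0" "\<And>N. 0 < e N" and a: "0 \<le> a"
  shows "(\<lambda>N. e N * real (nat \<lfloor>a / e N\<rfloor>)) \<longlonglongrightarrow> a" and "(\<lambda>N. e N * real (nat \<lceil>a / e N\<rceil>)) \<longlonglongrightarrow> a"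
proof -
  have fl: "a - e N \<le> e N * real (nat \<lfloor>a / e N\<rfloor>)" "e N * real (nat \<lfloor>a / e N\<rfloor>) \<le> a"
    and ce: "a \<le> e N * real (nat \<lceil>a / e N\<rceil>)" "e N * real (nat \<lceil>a / e N\<rceil>) \<le> a + e N" for N
  proof -
    have q: "0 \<le> a / e N" using a e(2)[of N] by simp
    have "a / e N - 1 \<le> real (nat \<lfloor>a / e N\<rfloor>)" "real (nat \<lfloor>a / e N\<rfloor>) \<le> a / e N"
      "a / e N \<le> real (nat \<lceil>a / e N\<rceil>)" "real (nat \<lceil>a / e N\<rceil>) \<le> a / e N + 1"
      using q by (auto simp: of_nat_nat; linarith)+
    then show "a - e N \<le> e N * real (nat \<lfloor>a / e N\<rfloor>)" "e N * real (nat \<lfloor>a / e N\<rfloor>) \<le> a"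
      "a \<le> e N * real (nat \<lceil>a / e N\<rceil>)" "e N * real (nat \<lceil>a / e N\<rceil>) \<le> a + e N"
      using e(2)[of N] by (auto simp: field_simps)
  qed
  have l: "(\<lambda>N. a - e N) \<longlonglongrightarrow> a" "(\<lambda>N. a + e N) \<longlonglongrightarrow> a"
    using tendsto_diff[OF tendsto_const[of a] e(1)] tendsto_add[OF tendsto_const[of a] e(1)] by simp_all
  show "(\<lambda>N. e N * real (nat \<lfloor>a / e N\<rfloor>)) \<longlonglongrightarrow> a"
    by (rule tendsto_sandwich[OF _ _ l(1) tendsto_const]) (use fl in auto)
  show "(\<lambda>N. e N * real (nat \<lceil>a / e N\<rceil>)) \<longlonglongrightarrow> a"
    by (rule tendsto_sandwich[OF _ _ tendsto_const l(2)]) (use ce in auto)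
qed

lemma cube_exp_tendsto_0:
  fixes e :: "nat \<Rightarrow> real"
  assumes e: "e \<longlonglongrightarrow> 0" "\<And>N. 0 < e N" and c: "0 < c"
  shows "(\<lambda>N. (1 / e N) ^ 3 * exp (- c / e N)) \<longlonglongrightarrow> 0"
proof -
  have "filterlim (\<lambda>N. c / e N) at_top sequentially"
    unfolding divide_inverse
    by (rule filterlim_tendsto_pos_mult_at_top[OF tendsto_const c filterlim_inverse_at_top[OF e(1)]])
      (simp add: e(2))
  then have "(\<lambda>N. (c / e N) ^ 3 / exp (c / e N)) \<longlonglongrightarrow> 0"
    by (rule filterlim_compose[OF tendsto_power_div_exp_0])
  then have "(\<lambda>N. 1 / c ^ 3 * ((c / e N) ^ 3 / exp (c / e N))) \<longlonglongrightarrow> 1 / c ^ 3 * 0"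
    by (intro tendsto_intros)
  then show ?thesis using c by (simp add: power_divide exp_minus field_simps)
qed

text \<open>
  From expanding the mean of \<open>(lam * x - 1)\<^sup>2\<close>; it keeps the limit \<open>\<rho>2\<close> away from 0.
\<close>

lemma (in overloaded_server) rho2_ge_1: "1 \<le> rho 2 lam B"
proof -
  have "0 \<le> (\<integral>x. (lam * x - 1)\<^sup>2 \<partial>B)" by simp
  also have "\<dots> = (\<integral>x. lam\<^sup>2 * x\<^sup>2 - 2 * lam * x + 1 \<partial>B)"
    by (intro Bochner_Integration.integral_cong) (auto simp: power2_eq_square algebra_simps)
  also have "\<dots> = rho 2 lam B - 2 * rho 1 lam B + 1"
    by (simp add: rho_def B.prob_space[simplified])
  finally show ?thesis using overload by simp
qed

locale heavy_traffic = message_sizes M \<nu> \<nu>_lower \<nu>_upper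
  for M :: "'a measure" and \<nu> :: "nat \<Rightarrow> 'a \<Rightarrow> nat" and \<nu>_lower \<nu>_upper :: nat +
  fixes Q :: "nat \<Rightarrow> 'b measure" and lam p \<epsilon> :: "nat \<Rightarrow> real" and B :: "nat \<Rightarrow> real measure"
    and a s :: "nat \<Rightarrow> nat \<Rightarrow> 'b \<Rightarrow> real" and z :: "nat \<Rightarrow> nat \<Rightarrow> 'b \<Rightarrow> nat"
    and mark :: "nat \<Rightarrow> nat \<Rightarrow> 'b \<Rightarrow> bool"
    and C \<rho>2 :: real
  assumes systems: "\<And>N. loss_queue (Q N) (lam N) (B N)
          (distr M (count_space UNIV) (waiting_places \<nu> N)) (p N) (a N) (s N) (z N) (mark N)"
    and load: "\<And>N. rho 1 (lam N) (B N) = 1 + \<epsilon> N"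
    and eps_pos: "\<And>N. \<epsilon> N > 0"
    and eps_lim: "\<epsilon> \<longlonglongrightarrow> 0"
    and C_pos: "C > 0"
    and places_lim: "AE \<omega> in M. (\<lambda>N. \<epsilon> N * real (waiting_places \<nu> N \<omega>)) \<longlonglongrightarrow> C"
    and third_moment: "\<And>N. integrable (B N) (\<lambda>x. x ^ 3)"
    and rho3_bounded: "Bseq (\<lambda>N. rho 3 (lam N) (B N))"
    and rho2_lim: "(\<lambda>N. rho 2 (lam N) (B N)) \<longlonglongrightarrow> \<rho>2"
begin

definition processed_mean :: "nat \<Rightarrow> ennreal" where
  "processed_mean N = loss_queue.mean_processed (Q N) (lam N) (B N) (z N)"

lemma system_overload: "overloaded_server (lam N) (B N)"
proof -
  interpret q: loss_queue "Q N" "lam N" "B N" "distr M (count_space UNIV) (waiting_places \<nu> N)" "p N" "a N" "s N" "z N" "mark N"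
    by (rule systems)
  show ?thesis by unfold_locales (use third_moment load eps_pos in auto)
qed

lemma rho2_ge: "1 \<le> rho 2 (lam N) (B N)"
  by (rule overloaded_server.rho2_ge_1[OF system_overload])

lemma rho2_limit_ge: "1 \<le> \<rho>2"
  by (rule LIMSEQ_le_const[OF rho2_lim]) (use rho2_ge in auto)

lemma places_capped: "AE \<omega> in Q N. \<forall>i. z N i \<omega> \<le> N"
proof -
  interpret q: loss_queue "Q N" "lam N" "B N" "distr M (count_space UNIV) (waiting_places \<nu> N)" "p N" "a N" "s N" "z N" "mark N"
    by (rule systems)
  have "AE \<omega> in Q N. z N i \<omega> \<le> N" for i
  proof (rule AE_distrD[OF q.places(1)])
    show "AE m in distr (Q N) (count_space UNIV) (z N i). m \<le> N"
      unfolding q.places(2) by (subst AE_distr_iff) (auto simp: waiting_places_le)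
  qed
  then show ?thesis by (simp add: AE_all_countable)
qed

lemma prob_places:
  "measure (Q N) {\<omega> \<in> space (Q N). R (z N i \<omega>)} = prob {\<omega> \<in> space M. R (waiting_places \<nu> N \<omega>)}"
proof -
  interpret q: loss_queue "Q N" "lam N" "B N" "distr M (count_space UNIV) (waiting_places \<nu> N)" "p N" "a N" "s N" "z N" "mark N"
    by (rule systems)
  have "measure (Q N) {\<omega> \<in> space (Q N). R (z N i \<omega>)} = measure (distr (Q N) (count_space UNIV) (z N i)) {m. R m}"
    using q.places(1) by (subst measure_distr) (auto intro!: arg_cong[where f = "measure (Q N)"])
  also have "\<dots> = prob {\<omega> \<in> space M. R (waiting_places \<nu> N \<omega>)}"
    unfolding q.places(2) by (subst measure_distr) (auto intro!: arg_cong[where f = prob])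
  finally show ?thesis .
qed

text \<open>
  The parameters follow the heuristics: \<open>\<gamma>\<close> is \<open>2 * \<epsilon> / \<rho>2\<close> up to the factor \<open>1 + \<eta>\<close>, which makes room
  for the third-moment error; \<open>\<kappa> = \<eta> / \<epsilon>\<close> is small against the capacity and large against 1;
  \<open>n\<close>, of order \<open>1 / \<epsilon> ^ 3\<close>, is large against \<open>1 / \<epsilon>\<^sup>2\<close>, which is \<open>\<epsilon>\<close> times the product of the
  remaining reward, of order \<open>1 / \<epsilon>\<^sup>2\<close>, and the mean number of arrivals, of order \<open>1 / \<epsilon>\<close>; and it is
  small against the reciprocal of the probability of bad places.
\<close>

lemma processed_mean_sandwich:
  assumes \<eta>: "0 < \<eta>" "\<eta> < C"
  obtains low up where
    "low \<longlonglongrightarrow> exp (2 * (C - \<eta>) / \<rho>2) - 1"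
    "up \<longlonglongrightarrow> exp (2 * (1 + \<eta>) * (C + 2 * \<eta>) / \<rho>2) - 1"
    "\<forall>\<^sub>F N in sequentially. \<exists>P. processed_mean N = ennreal P \<and> 0 \<le> P \<and> low N \<le> \<epsilon> N * P \<and> \<epsilon> N * P \<le> up N"
proof -
  obtain c K where c: "0 < c" and K: "0 < K"
    and conc: "\<forall>\<^sub>F N in sequentially.
      prob {\<omega> \<in> space M. \<not> (C - \<eta> \<le> \<epsilon> N * real (waiting_places \<nu> N \<omega>) \<and> \<epsilon> N * real (waiting_places \<nu> N \<omega>) \<le> C + \<eta>)}
        \<le> 2 * exp (- c / \<epsilon> N)"
    and capK: "\<forall>\<^sub>F N in sequentially. \<epsilon> N * real N \<le> K"
    using waiting_places_concentrated[OF eps_pos eps_lim \<eta> places_lim] by blast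
  let ?r2 = "\<lambda>N. rho 2 (lam N) (B N)" and ?r3 = "\<lambda>N. rho 3 (lam N) (B N)"
  obtain M3 where M3: "0 < M3" "\<And>N. \<bar>?r3 N\<bar> \<le> M3"
    using rho3_bounded by (auto simp: Bseq_def)
  define \<gamma> where "\<gamma> = (\<lambda>N. 2 * \<epsilon> N * (1 + \<eta>) / ?r2 N)"
  define \<kappa> where "\<kappa> = (\<lambda>N. \<eta> / \<epsilon> N)"
  define \<gamma>' where "\<gamma>' = (\<lambda>N. 2 * \<epsilon> N / ?r2 N)"
  define hi where "hi = (\<lambda>N. nat \<lfloor>(C + \<eta>) / \<epsilon> N\<rfloor>)"
  define lo where "lo = (\<lambda>N. nat \<lceil>(C - \<eta>) / \<epsilon> N\<rceil>)"
  define n where "n = (\<lambda>N. nat \<lceil>(1 / \<epsilon> N) ^ 3\<rceil>)"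
  define V where "V = (\<lambda>N. 1 / (1 - \<gamma> N / (4 * \<kappa> N * \<epsilon> N) * ?r3 N / 3))"
  define T where "T = (\<lambda>N. V N * (1 + (1 + \<epsilon> N) * (exp (\<gamma> N * \<kappa> N) / (1 - \<gamma> N) ^ hi N - 1) / \<epsilon> N) - 1)"
  define U where "U = (\<lambda>N. V N * (1 + (1 + \<epsilon> N) * (exp (\<gamma> N * \<kappa> N) / (1 - \<gamma> N) ^ N - 1) / \<epsilon> N) - 1)"
  define G where "G = (\<lambda>N. V N * (exp (\<gamma> N * \<kappa> N) / (\<gamma> N * \<epsilon> N * (1 - \<gamma> N) ^ N)) + (V N - 1) * N + N + 1)"
  define H where "H = (\<lambda>N. (1 / (1 - \<gamma>' N) ^ lo N - 1) / \<epsilon> N - 1)"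
  define b where "b = (\<lambda>N. 1 / (\<gamma>' N * \<epsilon> N * (1 - \<gamma>' N) ^ lo N))"
  have e0: "\<And>N. \<epsilon> N \<noteq> 0" using eps_pos by (simp add: less_imp_neq[symmetric])
  have r2p: "\<And>N. 0 < ?r2 N" using rho2_ge by (meson less_le_trans zero_less_one)
  have \<rho>2p: "0 < \<rho>2" using rho2_limit_ge by simp
  have \<gamma>p: "\<And>N. 0 < \<gamma> N" and \<gamma>'p: "\<And>N. 0 < \<gamma>' N" and \<kappa>p: "\<And>N. 0 < \<kappa> N"
    using eps_pos r2p \<eta> by (auto simp: \<gamma>_def \<gamma>'_def \<kappa>_def)
  have "(\<lambda>N. 2 * \<epsilon> N * (1 + \<eta>) / ?r2 N) \<longlonglongrightarrow> 2 * 0 * (1 + \<eta>) / \<rho>2"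
    using \<rho>2p by (intro tendsto_intros eps_lim rho2_lim) auto
  then have \<gamma>_lim: "\<gamma> \<longlonglongrightarrow> 0" by (simp add: \<gamma>_def)
  have "(\<lambda>N. 2 * \<epsilon> N / ?r2 N) \<longlonglongrightarrow> 2 * 0 / \<rho>2"
    using \<rho>2p by (intro tendsto_intros eps_lim rho2_lim) auto
  then have \<gamma>'_lim: "\<gamma>' \<longlonglongrightarrow> 0" by (simp add: \<gamma>'_def)
  have \<gamma>\<kappa>: "\<And>N. \<gamma> N * \<kappa> N = 2 * \<eta> * (1 + \<eta>) / ?r2 N"
    using e0 by (simp add: \<gamma>_def \<kappa>_def)
  have \<gamma>\<kappa>_lim: "(\<lambda>N. \<gamma> N * \<kappa> N) \<longlonglongrightarrow> 2 * \<eta> * (1 + \<eta>) / \<rho>2"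
    unfolding \<gamma>\<kappa> using \<rho>2p by (intro tendsto_intros rho2_lim) auto
  have \<gamma>r3: "(\<lambda>N. \<gamma> N * ?r3 N) \<longlonglongrightarrow> 0"
  proof (rule Lim_null_comparison)
    show "\<forall>\<^sub>F N in sequentially. norm (\<gamma> N * ?r3 N) \<le> \<gamma> N * M3"
      using M3 \<gamma>p by (auto simp: abs_mult less_imp_le intro!: always_eventually mult_left_mono)
    show "(\<lambda>N. \<gamma> N * M3) \<longlonglongrightarrow> 0" using tendsto_mult_right[OF \<gamma>_lim, of M3] by simp
  qed
  have V_eq: "V = (\<lambda>N. 1 / (1 - \<gamma> N * ?r3 N / (12 * \<eta>)))"
    using e0 by (simp add: V_def \<kappa>_def fun_eq_iff)
  have V_lim: "V \<longlonglongrightarrow> 1"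
  proof -
    have "V \<longlonglongrightarrow> 1 / (1 - 0 / (12 * \<eta>))"
      unfolding V_eq using \<eta> by (intro tendsto_intros \<gamma>r3) auto
    then show ?thesis by simp
  qed
  have hi_lim: "(\<lambda>N. \<epsilon> N * real (hi N)) \<longlonglongrightarrow> C + \<eta>"
    unfolding hi_def using \<eta> by (intro floor_tendsto(1) eps_lim eps_pos) simp
  have lo_lim: "(\<lambda>N. \<epsilon> N * real (lo N)) \<longlonglongrightarrow> C - \<eta>"
    unfolding lo_def using \<eta> by (intro floor_tendsto(2) eps_lim eps_pos) simp
  have pow_hi: "(\<lambda>N. (1 - \<gamma> N) ^ hi N) \<longlonglongrightarrow> exp (- (2 * (1 + \<eta>) / \<rho>2 * (C + \<eta>)))"
  proof (rule one_minus_power_tendsto[OF \<gamma>_lim])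
    have "(\<lambda>N. 2 * (1 + \<eta>) / ?r2 N * (\<epsilon> N * real (hi N))) \<longlonglongrightarrow> 2 * (1 + \<eta>) / \<rho>2 * (C + \<eta>)"
      using \<rho>2p by (intro tendsto_intros rho2_lim hi_lim) auto
    then show "(\<lambda>N. \<gamma> N * real (hi N)) \<longlonglongrightarrow> 2 * (1 + \<eta>) / \<rho>2 * (C + \<eta>)"
      by (simp add: \<gamma>_def mult_ac)
  qed (use \<gamma>p less_imp_le in blast)
  have pow_lo: "(\<lambda>N. (1 - \<gamma>' N) ^ lo N) \<longlonglongrightarrow> exp (- (2 / \<rho>2 * (C - \<eta>)))"
  proof (rule one_minus_power_tendsto[OF \<gamma>'_lim])
    have "(\<lambda>N. 2 / ?r2 N * (\<epsilon> N * real (lo N))) \<longlonglongrightarrow> 2 / \<rho>2 * (C - \<eta>)"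
      using \<rho>2p by (intro tendsto_intros rho2_lim lo_lim) auto
    then show "(\<lambda>N. \<gamma>' N * real (lo N)) \<longlonglongrightarrow> 2 / \<rho>2 * (C - \<eta>)"
      by (simp add: \<gamma>'_def mult_ac)
  qed (use \<gamma>'p less_imp_le in blast)
  have T_lim: "(\<lambda>N. \<epsilon> N * (1 + T N)) \<longlonglongrightarrow> exp (2 * (1 + \<eta>) * (C + 2 * \<eta>) / \<rho>2) - 1"
  proof -
    have "(\<lambda>N. V N * (\<epsilon> N + (1 + \<epsilon> N) * (exp (\<gamma> N * \<kappa> N) / (1 - \<gamma> N) ^ hi N - 1))) \<longlonglongrightarrow>
        1 * (0 + (1 + 0) * (exp (2 * \<eta> * (1 + \<eta>) / \<rho>2) / exp (- (2 * (1 + \<eta>) / \<rho>2 * (C + \<eta>))) - 1))"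
      by (intro tendsto_intros V_lim eps_lim \<gamma>\<kappa>_lim pow_hi) auto
    moreover have "\<And>N. \<epsilon> N * (1 + T N) = V N * (\<epsilon> N + (1 + \<epsilon> N) * (exp (\<gamma> N * \<kappa> N) / (1 - \<gamma> N) ^ hi N - 1))"
      using e0 by (simp add: T_def distrib_left mult.left_commute[of "\<epsilon> _" "V _"])
    moreover have "exp (2 * \<eta> * (1 + \<eta>) / \<rho>2) / exp (- (2 * (1 + \<eta>) / \<rho>2 * (C + \<eta>))) = exp (2 * (1 + \<eta>) * (C + 2 * \<eta>) / \<rho>2)"
      using \<rho>2p by (simp add: exp_diff[symmetric] field_simps)
    ultimately show ?thesis by simp
  qed
  have H_eq: "\<And>N. \<epsilon> N * (1 + H N) = 1 / (1 - \<gamma>' N) ^ lo N - 1"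
    using e0 by (simp add: H_def)
  have H_lim: "(\<lambda>N. \<epsilon> N * (1 + H N)) \<longlonglongrightarrow> exp (2 * (C - \<eta>) / \<rho>2) - 1"
  proof -
    have "(\<lambda>N. 1 / (1 - \<gamma>' N) ^ lo N - 1) \<longlonglongrightarrow> 1 / exp (- (2 / \<rho>2 * (C - \<eta>))) - 1"
      by (intro tendsto_intros pow_lo) auto
    moreover have "1 / exp (- (2 / \<rho>2 * (C - \<eta>))) = exp (2 * (C - \<eta>) / \<rho>2)"
      by (simp add: exp_minus inverse_eq_divide)
    ultimately show ?thesis unfolding H_eq by (simp only:)
  qed
  \<comment> \<open>\<open>c1\<close>, \<open>c2\<close>, \<open>c3\<close>, \<open>c4\<close> bound \<open>\<epsilon> * U\<close>, \<open>\<epsilon>\<^sup>2 * G\<close>, \<open>\<epsilon>\<^sup>2 * b\<close> and \<open>\<epsilon> * H\<close>; \<open>w0\<close> bounds \<open>(1 - \<gamma>) ^ N\<close> from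
      below, since \<open>\<epsilon> * N\<close> is at most \<open>K\<close>\<close>
  define c4 where "c4 = exp (2 * (C - \<eta>) / \<rho>2)"
  define E0 where "E0 = exp (2 * \<eta> * (1 + \<eta>))"
  define w0 where "w0 = exp (- 2 * (2 * (1 + \<eta>) * K))"
  define c1 where "c1 = 2 * (1 + 2 * (E0 / w0))"
  define c2 where "c2 = 2 * (E0 * (\<rho>2 + 1) / w0) + 2 * K + 1"
  define c3 where "c3 = (\<rho>2 + 1) * (c4 + 1)"
  define low where "low = (\<lambda>N. \<epsilon> N * (1 + H N) - 2 * c3 * c1 * \<epsilon> N - 4 * c4 * ((1 / \<epsilon> N) ^ 3 * exp (- c / \<epsilon> N)))"
  define up where "up = (\<lambda>N. \<epsilon> N * (1 + T N) + 2 * c2 * c1 * \<epsilon> N + 4 * c1 * ((1 / \<epsilon> N) ^ 3 * exp (- c / \<epsilon> N)))"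
  have w0: "0 < w0" and E0: "1 \<le> E0" using \<eta> by (simp_all add: w0_def E0_def)
  have c1: "0 < c1" and c2: "0 < c2" and c3: "0 < c3" and c4: "1 < c4"
    using w0 E0 K \<rho>2p \<eta> by (auto simp: c1_def c2_def c3_def c4_def intro!: add_pos_pos mult_pos_pos add_nonneg_pos)
  note cube = cube_exp_tendsto_0[OF eps_lim eps_pos c]
  have up_lim: "up \<longlonglongrightarrow> exp (2 * (1 + \<eta>) * (C + 2 * \<eta>) / \<rho>2) - 1"
  proof -
    have "up \<longlonglongrightarrow> (exp (2 * (1 + \<eta>) * (C + 2 * \<eta>) / \<rho>2) - 1) + 2 * c2 * c1 * 0 + 4 * c1 * 0"
      unfolding up_def by (intro tendsto_intros T_lim eps_lim cube)
    then show ?thesis by simp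
  qed
  have low_lim: "low \<longlonglongrightarrow> exp (2 * (C - \<eta>) / \<rho>2) - 1"
  proof -
    have "low \<longlonglongrightarrow> (exp (2 * (C - \<eta>) / \<rho>2) - 1) - 2 * c3 * c1 * 0 - 4 * c4 * 0"
      unfolding low_def by (intro tendsto_intros H_lim eps_lim cube)
    then show ?thesis by simp
  qed
  have ev_e: "\<forall>\<^sub>F N in sequentially. \<epsilon> N < min 1 (2 * \<eta> * (1 + \<eta>) / (\<rho>2 + 1))"
    using \<eta> \<rho>2p by (intro order_tendstoD(2)[OF eps_lim]) (auto intro!: divide_pos_pos mult_pos_pos)
  have ev_r2: "\<forall>\<^sub>F N in sequentially. ?r2 N < \<rho>2 + 1"
    by (rule order_tendstoD(2)[OF rho2_lim]) simp
  have ev_\<gamma>: "\<forall>\<^sub>F N in sequentially. \<gamma> N < 1 / 2"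
    by (rule order_tendstoD(2)[OF \<gamma>_lim]) simp
  have ev_\<gamma>': "\<forall>\<^sub>F N in sequentially. \<gamma>' N < 1"
    by (rule order_tendstoD(2)[OF \<gamma>'_lim]) simp
  have ev_pen: "\<forall>\<^sub>F N in sequentially. \<gamma> N * ?r3 N < 12 * \<eta>"
    using \<eta> by (intro order_tendstoD(2)[OF \<gamma>r3]) simp
  have ev_drift: "\<forall>\<^sub>F N in sequentially. \<gamma> N * ?r3 N < 6 * \<eta> / (2 * (1 + \<eta>))"
    using \<eta> by (intro order_tendstoD(2)[OF \<gamma>r3]) simp
  have ev_V: "\<forall>\<^sub>F N in sequentially. V N < 2" "\<forall>\<^sub>F N in sequentially. 0 < V N"
    using order_tendstoD[OF V_lim] by auto
  have ev_H: "\<forall>\<^sub>F N in sequentially. \<epsilon> N * (1 + H N) < c4"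
    using order_tendstoD(2)[OF H_lim, of c4] by (simp add: c4_def)
  have ev_H0: "\<forall>\<^sub>F N in sequentially. \<epsilon> N < \<epsilon> N * (1 + H N)"
  proof -
    have "(\<lambda>N. \<epsilon> N * (1 + H N) - \<epsilon> N) \<longlonglongrightarrow> (exp (2 * (C - \<eta>) / \<rho>2) - 1) - 0"
      by (intro tendsto_diff H_lim eps_lim)
    then have "\<forall>\<^sub>F N in sequentially. 0 < \<epsilon> N * (1 + H N) - \<epsilon> N"
      by (rule order_tendstoD(1)) (use \<eta> \<rho>2p in simp)
    then show ?thesis by simp
  qed
  have "\<forall>\<^sub>F N in sequentially. \<exists>P. processed_mean N = ennreal P \<and> 0 \<le> P \<and> low N \<le> \<epsilon> N * P \<and> \<epsilon> N * P \<le> up N"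
    using conc capK ev_e ev_r2 ev_\<gamma> ev_\<gamma>' ev_pen ev_drift ev_V ev_H ev_H0
  proof eventually_elim
    case (elim N)
    interpret q: loss_queue "Q N" "lam N" "B N" "distr M (count_space UNIV) (waiting_places \<nu> N)" "p N" "a N" "s N" "z N" "mark N"
      by (rule systems)
    let ?e = "\<epsilon> N" and ?\<pi> = "2 * exp (- c / \<epsilon> N)"
    have e: "0 < ?e" "?e < 1" using eps_pos elim(3) by auto
    have r2: "1 \<le> ?r2 N" "?r2 N < \<rho>2 + 1" using rho2_ge elim(4) by auto
    have n_bounds: "(1 / ?e) ^ 3 \<le> real (n N)" "real (n N) \<le> 2 * (1 / ?e) ^ 3" "0 < n N"
    proof -
      have "1 \<le> (1 / ?e) ^ 3" using e by (intro one_le_power) simp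
      then show "(1 / ?e) ^ 3 \<le> real (n N)" "real (n N) \<le> 2 * (1 / ?e) ^ 3" "0 < n N"
        unfolding n_def using e by (auto simp: of_nat_nat; linarith)+
    qed
    have H0: "0 \<le> H N"
      using elim(12) e by simp
    obtain P where P: "q.mean_processed = ennreal P" "0 \<le> P"
      "P \<le> 1 + T N + G N * ((1 + ?e) * (1 + U N)) / n N + U N * (n N * ?\<pi>)"
      "1 + H N - b N * ((1 + ?e) * (1 + U N)) / n N - H N * (n N * ?\<pi>) \<le> P"
    proof (rule q.mean_processed_explicit_bounds[where e = ?e and \<gamma> = "\<gamma> N" and \<kappa> = "\<kappa> N" and \<gamma>' = "\<gamma>' N" and
          \<pi> = ?\<pi> and n = "n N" and lo = "lo N" and hi = "hi N" and cap = N])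
      show "AE \<omega> in Q N. \<forall>i. z N i \<omega> \<le> N" by (rule places_capped)
      show "?e \<le> \<gamma> N * \<kappa> N"
      proof -
        have "?e \<le> 2 * \<eta> * (1 + \<eta>) / (\<rho>2 + 1)" using elim(3) by simp
        also have "\<dots> \<le> \<gamma> N * \<kappa> N"
          unfolding \<gamma>\<kappa> using \<eta> r2 by (intro divide_left_mono) auto
        finally show ?thesis .
      qed
      show "(\<gamma> N)\<^sup>2 * ?r3 N / 6 \<le> \<gamma> N * ?r2 N / 2 - ?e"
      proof -
        have "\<gamma> N * ?r2 N / 2 - ?e = ?e * \<eta>"
          using r2 by (simp add: \<gamma>_def field_simps)
        moreover have "\<gamma> N \<le> 2 * ?e * (1 + \<eta>)"
        proof -
          have "2 * ?e * (1 + \<eta>) / ?r2 N \<le> 2 * ?e * (1 + \<eta>) / 1"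
            using r2 e \<eta> by (intro divide_left_mono) auto
          then show ?thesis by (simp add: \<gamma>_def)
        qed
        moreover have "(\<gamma> N)\<^sup>2 * ?r3 N / 6 \<le> \<gamma> N * (6 * \<eta> / (2 * (1 + \<eta>))) / 6"
        proof (rule divide_right_mono)
          show "(\<gamma> N)\<^sup>2 * ?r3 N \<le> \<gamma> N * (6 * \<eta> / (2 * (1 + \<eta>)))"
            unfolding power2_eq_square mult.assoc
            using elim(8) \<gamma>p[of N] by (intro mult_left_mono less_imp_le)
        qed simp
        moreover have "\<gamma> N * (6 * \<eta> / (2 * (1 + \<eta>))) / 6 \<le> (2 * ?e * (1 + \<eta>)) * (6 * \<eta> / (2 * (1 + \<eta>))) / 6"
          using \<open>\<gamma> N \<le> 2 * ?e * (1 + \<eta>)\<close> \<eta> by (intro divide_right_mono mult_right_mono) auto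
        moreover have "(2 * ?e * (1 + \<eta>)) * (6 * \<eta> / (2 * (1 + \<eta>))) / 6 = ?e * \<eta>"
          using \<eta> by (simp add: field_simps)
        ultimately show ?thesis by linarith
      qed
      show "\<gamma> N * ?r3 N < 12 * \<kappa> N * ?e" using elim(7) e by (simp add: \<kappa>_def)
      show "\<gamma>' N * ?r2 N = 2 * ?e" using r2 by (simp add: \<gamma>'_def)
      show "q.prob {\<omega> \<in> space (Q N). \<not> (lo N \<le> z N i \<omega> \<and> z N i \<omega> \<le> hi N)} \<le> ?\<pi>" for i
      proof -
        have "q.prob {\<omega> \<in> space (Q N). \<not> (lo N \<le> z N i \<omega> \<and> z N i \<omega> \<le> hi N)} =
            prob {\<omega> \<in> space M. \<not> (lo N \<le> waiting_places \<nu> N \<omega> \<and> waiting_places \<nu> N \<omega> \<le> hi N)}"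
          by (rule prob_places)
        also have "\<dots> \<le> prob {\<omega> \<in> space M. \<not> (C - \<eta> \<le> ?e * real (waiting_places \<nu> N \<omega>) \<and> ?e * real (waiting_places \<nu> N \<omega>) \<le> C + \<eta>)}"
        proof (intro finite_measure_mono subsetI)
          fix \<omega> assume \<omega>: "\<omega> \<in> {\<omega> \<in> space M. \<not> (lo N \<le> waiting_places \<nu> N \<omega> \<and> waiting_places \<nu> N \<omega> \<le> hi N)}"
          have "lo N \<le> w \<and> w \<le> hi N" if "C - \<eta> \<le> ?e * real w" "?e * real w \<le> C + \<eta>" for w
          proof -
            have "(C - \<eta>) / ?e \<le> real w" "real w \<le> (C + \<eta>) / ?e"
              using that e by (simp_all add: field_simps)
            then show ?thesis unfolding lo_def hi_def by (auto simp: ceiling_le_iff le_nat_iff le_floor_iff nat_le_iff)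
          qed
          with \<omega> show "\<omega> \<in> {\<omega> \<in> space M. \<not> (C - \<eta> \<le> ?e * real (waiting_places \<nu> N \<omega>) \<and> ?e * real (waiting_places \<nu> N \<omega>) \<le> C + \<eta>)}"
            by auto
        qed measurable
        also have "\<dots> \<le> ?\<pi>" by (rule elim(1))
        finally show ?thesis .
      qed
      show "0 \<le> (1 / (1 - \<gamma>' N) ^ lo N - 1) / ?e - 1" using H0 by (simp add: H_def)
    qed (use third_moment load e \<gamma>p \<gamma>'p \<kappa>p elim n_bounds in \<open>auto simp: V_def T_def U_def G_def H_def b_def\<close>)
    \<comment> \<open>the crude bounds: \<open>U\<close> is of order \<open>1 / \<epsilon>\<close>, while \<open>G\<close> and \<open>b\<close> are of order \<open>1 / \<epsilon>\<^sup>2\<close>\<close>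
    have wN: "w0 \<le> (1 - \<gamma> N) ^ N"
      unfolding w0_def
    proof (rule one_minus_power_ge)
      have "\<gamma> N * real N = 2 * (1 + \<eta>) * (?e * real N) / ?r2 N" by (simp add: \<gamma>_def)
      also have "\<dots> \<le> 2 * (1 + \<eta>) * (?e * real N) / 1"
        using r2 e \<eta> by (intro divide_left_mono) auto
      also have "\<dots> \<le> 2 * (1 + \<eta>) * K" using elim(2) \<eta> by (simp add: mult_left_mono)
      finally show "\<gamma> N * real N \<le> 2 * (1 + \<eta>) * K" .
    qed (use \<gamma>p[of N] elim(5) in auto)
    have E: "0 < exp (\<gamma> N * \<kappa> N)" "exp (\<gamma> N * \<kappa> N) \<le> E0" "1 \<le> exp (\<gamma> N * \<kappa> N)"
    proof -
      have "2 * \<eta> * (1 + \<eta>) / ?r2 N \<le> 2 * \<eta> * (1 + \<eta>) / 1" using r2 \<eta> by (intro divide_left_mono) auto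
      then show "exp (\<gamma> N * \<kappa> N) \<le> E0" by (simp add: \<gamma>\<kappa> E0_def)
      show "1 \<le> exp (\<gamma> N * \<kappa> N)" using \<gamma>p[of N] \<kappa>p[of N] by simp
    qed simp
    have q0: "exp (\<gamma> N * \<kappa> N) / (1 - \<gamma> N) ^ N \<le> E0 / w0"
      using E E0 wN w0 by (intro frac_le) auto
    have q1: "1 \<le> exp (\<gamma> N * \<kappa> N) / (1 - \<gamma> N) ^ N"
    proof -
      have "(1 - \<gamma> N) ^ N \<le> 1" using \<gamma>p[of N] elim(5) by (intro power_le_one) auto
      then have "(1 - \<gamma> N) ^ N \<le> exp (\<gamma> N * \<kappa> N)" using E(3) by (rule order_trans)
      then show ?thesis using wN w0 by (simp add: le_divide_eq)
    qed
    have V: "0 < V N" "V N < 2" using elim by auto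
    have U_bound: "?e * (1 + U N) \<le> c1" "0 \<le> ?e * (1 + U N)"
    proof -
      let ?q = "exp (\<gamma> N * \<kappa> N) / (1 - \<gamma> N) ^ N"
      have eq: "?e * (1 + U N) = V N * (?e + (1 + ?e) * (?q - 1))"
        using e by (simp add: U_def distrib_left mult.left_commute[of ?e "V N"])
      have "?e + (1 + ?e) * (?q - 1) \<le> 1 + 2 * (E0 / w0)"
        using e q0 q1 by (intro add_mono mult_mono) auto
      moreover have nn: "0 \<le> ?e + (1 + ?e) * (?q - 1)" using e q1 by auto
      ultimately show "?e * (1 + U N) \<le> c1"
        unfolding eq c1_def using V by (intro mult_mono) auto
      show "0 \<le> ?e * (1 + U N)" unfolding eq using nn V by simp
    qed
    have eU: "?e * U N \<le> c1" using U_bound e by (simp add: distrib_left)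
    have U1: "0 \<le> 1 + U N" using U_bound(2) e by (simp add: zero_le_mult_iff)
    have G_bound: "?e\<^sup>2 * G N \<le> c2"
    proof -
      have "?e\<^sup>2 * G N = V N * ((?e / \<gamma> N) * (exp (\<gamma> N * \<kappa> N) / (1 - \<gamma> N) ^ N)) + V N * (?e * (?e * N)) + ?e\<^sup>2"
        using e \<gamma>p[of N] by (simp add: G_def algebra_simps power2_eq_square)
      also have "\<dots> \<le> 2 * ((\<rho>2 + 1) * (E0 / w0)) + 2 * (1 * K) + 1"
      proof (intro add_mono mult_mono q0)
        have "?e / \<gamma> N = ?r2 N / (2 * (1 + \<eta>))" using e by (simp add: \<gamma>_def)
        also have "\<dots> \<le> ?r2 N / 1" using r2 \<eta> by (intro divide_left_mono) auto
        finally show "?e / \<gamma> N \<le> \<rho>2 + 1" using r2 by simp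
        show "?e\<^sup>2 \<le> 1" using e by (simp add: power_le_one)
      qed (use V e elim(2,5) \<rho>2p \<gamma>p[of N] q1 in auto)
      also have "\<dots> = c2" by (simp add: c2_def)
      finally show ?thesis .
    qed
    \<comment> \<open>the cost of surviving \<open>n\<close> arrivals, and of bad places among them\<close>
    have err: "?e * (g * ((1 + ?e) * (1 + U N)) / n N) \<le> 2 * cc * c1 * ?e" if g: "?e\<^sup>2 * g \<le> cc" "0 \<le> g" "0 < cc" for g cc
    proof -
      have "1 / real (n N) \<le> 1 / (1 / ?e) ^ 3"
        using n_bounds e by (intro divide_left_mono) auto
      then have inv: "1 / real (n N) \<le> ?e ^ 3" by (simp add: power_divide)
      have "?e * (g * ((1 + ?e) * (1 + U N)) / n N) = (?e * g * (1 + ?e) * (1 + U N)) * (1 / n N)" by simp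
      also have "\<dots> \<le> (?e * g * (1 + ?e) * (1 + U N)) * ?e ^ 3"
        using e g U1 inv by (intro mult_left_mono) auto
      also have "\<dots> = ((?e\<^sup>2 * g) * (?e * (1 + U N))) * (1 + ?e) * ?e"
        by (simp add: power2_eq_square power3_eq_cube mult_ac)
      also have "\<dots> \<le> (cc * c1) * 2 * ?e"
        using e g U_bound c1 by (intro mult_right_mono mult_mono) auto
      finally show ?thesis by (simp add: mult_ac)
    qed
    have err2: "?e * (u * (n N * ?\<pi>)) \<le> 4 * cc * ((1 / ?e) ^ 3 * exp (- c / ?e))" if "?e * u \<le> cc" "0 < cc" for u cc
    proof -
      have "?e * (u * (n N * ?\<pi>)) = (?e * u) * (n N * ?\<pi>)" by simp
      also have "\<dots> \<le> cc * (2 * (1 / ?e) ^ 3 * ?\<pi>)"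
        using that n_bounds e by (intro mult_mono) auto
      finally show ?thesis by simp
    qed
    have G0: "0 \<le> G N"
    proof -
      have "G N = V N * (exp (\<gamma> N * \<kappa> N) / (\<gamma> N * ?e * (1 - \<gamma> N) ^ N)) + V N * N + 1"
        by (simp add: G_def algebra_simps)
      then show ?thesis using V e \<gamma>p[of N] elim(5) by simp
    qed
    have b_bound: "?e\<^sup>2 * b N \<le> c3" "0 \<le> b N"
    proof -
      show "0 \<le> b N" using \<gamma>'p[of N] elim(6) e by (simp add: b_def)
      have "?e\<^sup>2 * b N = (?e / \<gamma>' N) * (1 / (1 - \<gamma>' N) ^ lo N)"
        using e \<gamma>'p[of N] by (simp add: b_def power2_eq_square)
      also have "\<dots> = (?r2 N / 2) * (?e * (1 + H N) + 1)"
        using e unfolding H_eq by (simp add: \<gamma>'_def)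
      also have "\<dots> \<le> (\<rho>2 + 1) * (c4 + 1)"
        using r2 elim(11) e H0 by (intro mult_mono) auto
      finally show "?e\<^sup>2 * b N \<le> c3" by (simp add: c3_def)
    qed
    have "?e * P \<le> ?e * (1 + T N + G N * ((1 + ?e) * (1 + U N)) / n N + U N * (n N * ?\<pi>))"
      using P(3) e by (intro mult_left_mono) auto
    also have "\<dots> \<le> up N"
    proof -
      have split: "?e * (1 + t + x + y) = ?e * (1 + t) + ?e * x + ?e * y" for t x y
        by (simp add: algebra_simps)
      show ?thesis
        unfolding split up_def by (intro add_mono order_refl err[OF G_bound G0 c2] err2[OF eU c1])
    qed
    finally have "?e * P \<le> up N" .
    moreover have "low N \<le> ?e * P"
    proof -
      have eH: "?e * H N \<le> c4" using elim(11) e by (simp add: distrib_left)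
      have "low N \<le> ?e * (1 + H N - b N * ((1 + ?e) * (1 + U N)) / n N - H N * (n N * ?\<pi>))"
      proof -
        have split: "?e * (1 + h - x - y) = ?e * (1 + h) - ?e * x - ?e * y" for h x y
          by (simp add: algebra_simps)
        show ?thesis
          unfolding split low_def
          by (intro diff_mono order_refl err[OF b_bound c3] err2[OF eH]) (use c4 in simp)
      qed
      also have "\<dots> \<le> ?e * P" using P(4) e by (intro mult_left_mono) auto
      finally show ?thesis .
    qed
    ultimately show ?case using P(1,2) unfolding processed_mean_def by blast
  qed
  then show thesis using that low_lim up_lim by blast
qed

theorem processed_mean_tendsto:
  obtains P where "\<forall>\<^sub>F N in sequentially. processed_mean N = ennreal (P N) \<and> 0 \<le> P N"
    "(\<lambda>N. \<epsilon> N * P N) \<longlonglongrightarrow> exp (2 * C / \<rho>2) - 1"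
proof -
  define P where "P = (\<lambda>N. enn2real (processed_mean N))"
  let ?l = "exp (2 * C / \<rho>2) - 1"
  let ?L = "\<lambda>\<eta>. exp (2 * (C - \<eta>) / \<rho>2) - 1" and ?U = "\<lambda>\<eta>. exp (2 * (1 + \<eta>) * (C + 2 * \<eta>) / \<rho>2) - 1"
  have \<rho>2: "\<rho>2 \<noteq> 0" using rho2_limit_ge by simp
  have lims: "(?L \<longlongrightarrow> ?L 0) (at_right 0)" "(?U \<longlongrightarrow> ?U 0) (at_right 0)"
  proof -
    have "continuous (at_right 0) ?L" "continuous (at_right 0) ?U"
      using \<rho>2 by (intro continuous_intros; simp)+
    then show "(?L \<longlongrightarrow> ?L 0) (at_right 0)" "(?U \<longlongrightarrow> ?U 0) (at_right 0)"
      unfolding continuous_within .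
  qed
  have "\<forall>\<^sub>F N in sequentially. processed_mean N = ennreal (P N) \<and> 0 \<le> P N"
  proof -
    obtain low up where "\<forall>\<^sub>F N in sequentially. \<exists>P. processed_mean N = ennreal P \<and> 0 \<le> P \<and> low N \<le> \<epsilon> N * P \<and> \<epsilon> N * P \<le> up N"
      using processed_mean_sandwich[OF half_gt_zero[OF C_pos]] C_pos by fastforce
    then show ?thesis by eventually_elim (auto simp: P_def)
  qed
  moreover have "(\<lambda>N. \<epsilon> N * P N) \<longlonglongrightarrow> ?l"
  proof (rule order_tendstoI)
    fix x assume x: "x < ?l"
    have "\<forall>\<^sub>F \<eta> in at_right 0. x < ?L \<eta>" using order_tendstoD(1)[OF lims(1)] x by simp
    moreover have "\<forall>\<^sub>F \<eta> in at_right 0. 0 < \<eta> \<and> \<eta> < C"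
      using C_pos by (auto simp: eventually_at_right_field)
    ultimately have "\<forall>\<^sub>F \<eta> in at_right 0. x < ?L \<eta> \<and> 0 < \<eta> \<and> \<eta> < C" by eventually_elim auto
    then obtain \<eta> where \<eta>: "x < ?L \<eta>" "0 < \<eta>" "\<eta> < C"
      using eventually_happens trivial_limit_at_right_real by blast
    obtain low up where lu: "low \<longlonglongrightarrow> ?L \<eta>"
      "\<forall>\<^sub>F N in sequentially. \<exists>P. processed_mean N = ennreal P \<and> 0 \<le> P \<and> low N \<le> \<epsilon> N * P \<and> \<epsilon> N * P \<le> up N"
      using processed_mean_sandwich[OF \<eta>(2,3)] by blast
    show "\<forall>\<^sub>F N in sequentially. x < \<epsilon> N * P N"
      using lu(2) order_tendstoD(1)[OF lu(1) \<eta>(1)] by eventually_elim (auto simp: P_def)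
  next
    fix x assume x: "?l < x"
    have "\<forall>\<^sub>F \<eta> in at_right 0. ?U \<eta> < x" using order_tendstoD(2)[OF lims(2)] x by simp
    moreover have "\<forall>\<^sub>F \<eta> in at_right 0. 0 < \<eta> \<and> \<eta> < C"
      using C_pos by (auto simp: eventually_at_right_field)
    ultimately have "\<forall>\<^sub>F \<eta> in at_right 0. ?U \<eta> < x \<and> 0 < \<eta> \<and> \<eta> < C" by eventually_elim auto
    then obtain \<eta> where \<eta>: "?U \<eta> < x" "0 < \<eta>" "\<eta> < C"
      using eventually_happens trivial_limit_at_right_real by blast
    obtain low up where lu: "up \<longlonglongrightarrow> ?U \<eta>"
      "\<forall>\<^sub>F N in sequentially. \<exists>P. processed_mean N = ennreal P \<and> 0 \<le> P \<and> low N \<le> \<epsilon> N * P \<and> \<epsilon> N * P \<le> up N"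
      using processed_mean_sandwich[OF \<eta>(2,3)] by blast
    show "\<forall>\<^sub>F N in sequentially. \<epsilon> N * P N < x"
      using lu(2) order_tendstoD(2)[OF lu(1) \<eta>(1)] by eventually_elim (auto simp: P_def)
  qed
  ultimately show thesis by (rule that)
qed

end

theorem theorem5p3:
  fixes M :: "'a measure" and \<nu> :: "nat \<Rightarrow> 'a \<Rightarrow> nat" and \<nu>_lower \<nu>_upper :: nat
    and Q :: "nat \<Rightarrow> 'b measure" and lam p \<epsilon> :: "nat \<Rightarrow> real" and B :: "nat \<Rightarrow> real measure"
    and a s :: "nat \<Rightarrow> nat \<Rightarrow> 'b \<Rightarrow> real" and z :: "nat \<Rightarrow> nat \<Rightarrow> 'b \<Rightarrow> nat"
    and mark :: "nat \<Rightarrow> nat \<Rightarrow> 'b \<Rightarrow> bool"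
    and C \<rho>2 :: real
  assumes sizes: "message_sizes M \<nu> \<nu>_lower \<nu>_upper"
    and systems: "\<And>N. loss_queue (Q N) (lam N) (B N)
          (distr M (count_space UNIV) (waiting_places \<nu> N)) (p N) (a N) (s N) (z N) (mark N)"
    and load: "\<And>N. rho 1 (lam N) (B N) = 1 + \<epsilon> N"
    and eps_pos: "\<And>N. \<epsilon> N > 0"
    and eps_lim: "\<epsilon> \<longlonglongrightarrow> 0"
    and C_pos: "C > 0"
    and places_lim: "AE \<omega> in M. (\<lambda>N. \<epsilon> N * real (waiting_places \<nu> N \<omega>)) \<longlonglongrightarrow> C"
    and p_lim: "p \<longlonglongrightarrow> 0"
    and third_moment: "\<And>N. integrable (B N) (\<lambda>x. x ^ 3)"
    and rho3_bounded: "Bseq (\<lambda>N. rho 3 (lam N) (B N))"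
    and rho2_lim: "(\<lambda>N. rho 2 (lam N) (B N)) \<longlonglongrightarrow> \<rho>2"
  shows "(\<forall>D\<ge>0. (\<lambda>N. p N / \<epsilon> N) \<longlonglongrightarrow> D \<longrightarrow>
            (\<lambda>N. loss_probability (Q N) (a N) (s N) (z N) (mark N)
               - (D + exp (2 * C / \<rho>2) / (exp (2 * C / \<rho>2) - 1)) * \<epsilon> N) \<in> o(\<epsilon>)) \<and>
         (filterlim (\<lambda>N. p N / \<epsilon> N) at_top sequentially \<longrightarrow>
            (\<lambda>N. loss_probability (Q N) (a N) (s N) (z N) (mark N) - p N) \<in> O(\<epsilon>))"
proof -
  interpret heavy_traffic M \<nu> \<nu>_lower \<nu>_upper Q lam p \<epsilon> B a s z mark C \<rho>2
    by (intro heavy_traffic.intro heavy_traffic_axioms.intro sizes systems load eps_pos eps_lim C_pos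
        places_lim third_moment rho3_bounded rho2_lim)
  define Y where "Y = exp (2 * C / \<rho>2) - 1"
  let ?loss = "\<lambda>N. loss_probability (Q N) (a N) (s N) (z N) (mark N)"
  have Y: "0 < Y" using C_pos rho2_limit_ge by (simp add: Y_def)
  obtain P where P: "\<forall>\<^sub>F N in sequentially. processed_mean N = ennreal (P N) \<and> 0 \<le> P N"
    and lim: "(\<lambda>N. \<epsilon> N * P N) \<longlonglongrightarrow> Y"
    using processed_mean_tendsto unfolding Y_def by blast
  have e0: "\<epsilon> N \<noteq> 0" for N using eps_pos[of N] by simp
  have loss: "\<forall>\<^sub>F N in sequentially. ?loss N = (1 + (\<epsilon> N + p N) * P N) / (1 + (1 + \<epsilon> N) * P N) \<and> 0 \<le> P N"
    using P
  proof eventually_elim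
    case (elim N)
    interpret q: loss_queue "Q N" "lam N" "B N" "distr M (count_space UNIV) (waiting_places \<nu> N)" "p N" "a N" "s N" "z N" "mark N"
      by (rule systems)
    show ?case
      using q.loss_probability_eq[of "P N"] elim load[of N] by (simp add: processed_mean_def)
  qed
  have den: "0 < 1 + (1 + \<epsilon> N) * P N" if "0 \<le> P N" for N
    using that eps_pos[of N] by (simp add: add_pos_nonneg)
  show ?thesis
  proof (intro conjI allI impI)
    fix D :: real assume D: "0 \<le> D" "(\<lambda>N. p N / \<epsilon> N) \<longlonglongrightarrow> D"
    let ?A = "D + exp (2 * C / \<rho>2) / (exp (2 * C / \<rho>2) - 1)"
    \<comment> \<open>the quotient of the loss probability and \<open>\<epsilon>\<close>, written in terms of \<open>\<epsilon> * P\<close> and \<open>p / \<epsilon>\<close>\<close>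
    have "(\<lambda>N. (1 + \<epsilon> N * P N + p N / \<epsilon> N * (\<epsilon> N * P N)) / (\<epsilon> N + (1 + \<epsilon> N) * (\<epsilon> N * P N)) - ?A)
        \<longlonglongrightarrow> (1 + Y + D * Y) / (0 + (1 + 0) * Y) - ?A"
      using Y by (intro tendsto_intros lim eps_lim D(2)) auto
    moreover have "(1 + Y + D * Y) / (0 + (1 + 0) * Y) - ?A = 0"
    proof -
      have "exp (2 * C / \<rho>2) = 1 + Y" by (simp add: Y_def)
      then show ?thesis using Y by (simp add: field_simps)
    qed
    ultimately have "(\<lambda>N. (1 + \<epsilon> N * P N + p N / \<epsilon> N * (\<epsilon> N * P N)) / (\<epsilon> N + (1 + \<epsilon> N) * (\<epsilon> N * P N)) - ?A) \<longlonglongrightarrow> 0"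
      by simp
    moreover have "\<forall>\<^sub>F N in sequentially. (1 + \<epsilon> N * P N + p N / \<epsilon> N * (\<epsilon> N * P N)) / (\<epsilon> N + (1 + \<epsilon> N) * (\<epsilon> N * P N)) - ?A
        = (?loss N - ?A * \<epsilon> N) / \<epsilon> N"
      using loss
    proof eventually_elim
      case (elim N)
      have eq1: "1 + \<epsilon> N * P N + p N / \<epsilon> N * (\<epsilon> N * P N) = 1 + (\<epsilon> N + p N) * P N"
        using e0 by (simp add: distrib_right)
      have eq2: "\<epsilon> N + (1 + \<epsilon> N) * (\<epsilon> N * P N) = (1 + (1 + \<epsilon> N) * P N) * \<epsilon> N"
        by (simp add: algebra_simps)
      have "?loss N / \<epsilon> N = (1 + (\<epsilon> N + p N) * P N) / ((1 + (1 + \<epsilon> N) * P N) * \<epsilon> N)"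
        using elim by simp
      then show ?case unfolding eq1 eq2 using e0 by (simp add: diff_divide_distrib)
    qed
    ultimately have "(\<lambda>N. (?loss N - ?A * \<epsilon> N) / \<epsilon> N) \<longlonglongrightarrow> 0"
      by (rule Lim_transform_eventually)
    then show "(\<lambda>N. ?loss N - ?A * \<epsilon> N) \<in> o(\<epsilon>)"
      using e0 by (intro smalloI_tendsto) auto
  next
    \<comment> \<open>the loss probability minus \<open>p\<close> carries the factor \<open>1 - p\<close>, so its quotient with \<open>\<epsilon>\<close> converges\<close>
    have "(\<lambda>N. (1 - p N) * (1 + \<epsilon> N * P N) / (\<epsilon> N + (1 + \<epsilon> N) * (\<epsilon> N * P N))) \<longlonglongrightarrow> (1 - 0) * (1 + Y) / (0 + (1 + 0) * Y)"
      using Y by (intro tendsto_intros lim eps_lim p_lim) auto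
    moreover have "\<forall>\<^sub>F N in sequentially. (1 - p N) * (1 + \<epsilon> N * P N) / (\<epsilon> N + (1 + \<epsilon> N) * (\<epsilon> N * P N)) = (?loss N - p N) / \<epsilon> N"
      using loss
    proof eventually_elim
      case (elim N)
      let ?d = "1 + (1 + \<epsilon> N) * P N"
      have "?loss N - p N = (1 - p N) * (1 + \<epsilon> N * P N) / ?d"
        using elim den[of N] by (simp add: field_simps)
      moreover have "\<epsilon> N + (1 + \<epsilon> N) * (\<epsilon> N * P N) = ?d * \<epsilon> N"
        by (simp add: algebra_simps)
      ultimately show ?case by simp
    qed
    ultimately have "(\<lambda>N. (?loss N - p N) / \<epsilon> N) \<longlonglongrightarrow> (1 - 0) * (1 + Y) / (0 + (1 + 0) * Y)"
      by (rule Lim_transform_eventually)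
    then show "(\<lambda>N. ?loss N - p N) \<in> O(\<epsilon>)"
      using e0 by (intro bigoI_tendsto) auto
  qed
qed

end
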